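(* Let $\Omega\subset\mathbb{R}^n$ be a bounded Lipschitz domain. For $i=1,\dots,n$ let $q_i^+>1$, $q_i^->1$ be real exponents and put $\underline{q}_i:=\min\{q_i^+,q_i^-\}$, $\overline{q}_i:=\max\{q_i^+,q_i^-\}$. Let $\Gamma(t)=1+t^2$. For $i=1,\dots,n$ let $h_i,H_i:\mathbb{R}\to(0,\infty)$ be functions such that, with positive constants $\underline{a}_i,\overline{a}_i$, $$\underline{a}_i\,\Gamma^{\frac{q_i^--2}{2}}(|t|)\le h_i(t)\ \text{ and }\ H_i(t)\le \overline{a}_i\,\Gamma^{\frac{q_i^--2}{2}}(|t|)\quad\text{if } t<-1,$$ $$\underline{a}_i\,\Gamma^{\frac{q_i^+-2}{2}}(|t|)\le h_i(t)\ \text{ and }\ H_i(t)\le \overline{a}_i\,\Gamma^{\frac{q_i^+-2}{2}}(|t|)\quad\text{if } t>1.$$ Suppose that for $i=1,\dots,n$ the function $f_i:\mathbb{R}\to[0,\infty)$ is of class $C^2(\mathbb{R})$ and satisfies $$h_i(t)\le f_i''(t)\le H_i(t)\qquad\text{for all } t\in\mathbb{R}.$$ Assume in addition that for every fixed $1\le i\le n$ $$\overline{q}_j<2\underline{q}_i+2\quad\text{for all } i<j\le n,\qquad\qquad \overline{q}_j<3\underline{q}_i+2\quad\text{for all } 1\le j<i.$$ Let $u\in L^\infty(\Omega)\cap E_f(\Omega)$ be a local minimizer of $$J[w]=\int_\Omega\Big[\sum_{i=1}^n f_i(\partial_i w)\Big]\,dx .$$ Then there exists a real number $\delta>-1/2$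 such that for every $1\le i\le n$, for every ball $B=B_{2r}(x_0)$ compactly contained in $\Omega$, every $\eta\in C_0^\infty(B)$ with $0\le\eta\le1$, $\eta\equiv1$ on $B_r(x_0)$ and $|\nabla\eta|\le c/r$, and all sufficiently large $k>0$, there is a finite constant $c$ with $$\int_B f_i(\partial_i u)\,\Gamma^{1+\delta}(|\partial_i u|)\,\eta^{2k}\,dx\le c .$$
   Context: Notation: $\Gamma^{\alpha}(|t|)$ means $(1+t^2)^{\alpha}$. With $f(Z):=\sum_{i=1}^n f_i(Z_i)$ for $Z\in\mathbb{R}^n$, the energy class is $$E_f(\Omega):=\Big\{w\in W^{1,1}(\Omega):\ \int_\Omega f(\nabla w)\,dx<\infty\Big\}.$$ A function $u\in E_f(\Omega)$ is a local minimizer of $J$ if $\int_\Omega f(\nabla u)\,dx\le\int_\Omega f(\nabla w)\,dx$ for all $w\in E_f(\Omega)$ such that $\operatorname{spt}(u-w)$ is compactly contained in $\Omega$. *)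

theory Defs
  imports "HOL-Analysis.Analysis"
begin

definition compactly_contained :: "'a::topological_space set \<Rightarrow> 'a set \<Rightarrow> bool" where
  "compactly_contained S \<Omega> \<longleftrightarrow> compact (closure S) \<and> closure S \<subseteq> \<Omega>"

text \<open>Near each boundary point, \<open>\<Omega>\<close> is the strict epigraph, in some direction \<open>\<nu>\<close>, of a Lipschitz
  function on the hyperplane orthogonal to \<open>\<nu>\<close>; choosing \<open>\<nu>\<close> amounts to choosing the rotated
  coordinate system.\<close>

definition lipschitz_domain :: "'a::euclidean_space set \<Rightarrow> bool" where
  "lipschitz_domain \<Omega> \<longleftrightarrow> open \<Omega> \<and> connected \<Omega> \<and> \<Omega> \<noteq> {} \<and>
     (\<forall>p\<in>frontier \<Omega>. \<exists>\<rho>>0. \<exists>\<nu>. \<exists>L. \<exists>\<gamma> :: 'a \<Rightarrow> real. norm \<nu> = 1 \<and>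
        L-lipschitz_on {y. y \<bullet> \<nu> = 0} \<gamma> \<and>
        \<Omega> \<inter> ball p \<rho> = {x \<in> ball p \<rho>. x \<bullet> \<nu> > \<gamma> (x - (x \<bullet> \<nu>) *\<^sub>R \<nu>)})"

definition partial :: "'n \<Rightarrow> (real^'n::finite \<Rightarrow> real) \<Rightarrow> real^'n \<Rightarrow> real" where
  "partial i \<phi> x = frechet_derivative \<phi> (at x) (axis i 1)"

definition gradient :: "(real^'n::finite \<Rightarrow> real) \<Rightarrow> real^'n \<Rightarrow> real^'n" where
  "gradient \<phi> x = (\<chi> i. partial i \<phi> x)"

primrec C_k :: "nat \<Rightarrow> (real^'n::finite \<Rightarrow> real) \<Rightarrow> bool" where
  "C_k 0 \<phi> \<longleftrightarrow> continuous_on UNIV \<phi>"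
| "C_k (Suc k) \<phi> \<longleftrightarrow> (\<forall>x. \<phi> differentiable (at x)) \<and> (\<forall>i. C_k k (partial i \<phi>))"

text \<open>\<open>C\<^sub>0\<^sup>\<infinity>(\<Omega>)\<close>, each function being identified with its extension by zero to the whole space.\<close>

definition test_functions :: "(real^'n::finite) set \<Rightarrow> (real^'n \<Rightarrow> real) set" where
  "test_functions \<Omega> = {\<phi>. (\<forall>k. C_k k \<phi>) \<and> compactly_contained {x. \<phi> x \<noteq> 0} \<Omega>}"

definition C2_real :: "(real \<Rightarrow> real) \<Rightarrow> bool" where
  "C2_real g \<longleftrightarrow> (\<forall>t. g field_differentiable (at t)) \<and> (\<forall>t. deriv g field_differentiable (at t)) \<and>
     continuous_on UNIV (deriv (deriv g))"

definition locally_integrable :: "'a::euclidean_space set \<Rightarrow> ('a \<Rightarrow> real) \<Rightarrow> bool" where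
  "locally_integrable \<Omega> v \<longleftrightarrow> (\<forall>K. compact K \<and> K \<subseteq> \<Omega> \<longrightarrow> integrable (lebesgue_on K) v)"

definition is_weak_partial ::
  "(real^'n::finite) set \<Rightarrow> 'n \<Rightarrow> (real^'n \<Rightarrow> real) \<Rightarrow> (real^'n \<Rightarrow> real) \<Rightarrow> bool" where
  "is_weak_partial \<Omega> i w v \<longleftrightarrow> locally_integrable \<Omega> w \<and> locally_integrable \<Omega> v \<and>
     (\<forall>\<phi>\<in>test_functions \<Omega>.
        (\<integral>x. w x * partial i \<phi> x \<partial>lebesgue_on \<Omega>) = - (\<integral>x. v x * \<phi> x \<partial>lebesgue_on \<Omega>))"

text \<open>The weak derivative is unique only up to null sets; we choose a representative.\<close>

definition weak_partial :: "(real^'n::finite) set \<Rightarrow> 'n \<Rightarrow> (real^'n \<Rightarrow> real) \<Rightarrow> real^'n \<Rightarrow> real" where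
  "weak_partial \<Omega> i w = (SOME v. is_weak_partial \<Omega> i w v)"

definition weak_gradient :: "(real^'n::finite) set \<Rightarrow> (real^'n \<Rightarrow> real) \<Rightarrow> real^'n \<Rightarrow> real^'n" where
  "weak_gradient \<Omega> w x = (\<chi> i. weak_partial \<Omega> i w x)"

definition W11 :: "(real^'n::finite) set \<Rightarrow> (real^'n \<Rightarrow> real) set" where
  "W11 \<Omega> = {w. integrable (lebesgue_on \<Omega>) w \<and>
     (\<forall>i. (\<exists>v. is_weak_partial \<Omega> i w v) \<and> integrable (lebesgue_on \<Omega>) (weak_partial \<Omega> i w))}"

definition L_infty :: "'a::euclidean_space set \<Rightarrow> ('a \<Rightarrow> real) set" where
  "L_infty \<Omega> = {w \<in> borel_measurable (lebesgue_on \<Omega>). \<exists>M. AE x in lebesgue_on \<Omega>. \<bar>w x\<bar> \<le> M}"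

definition split_density :: "('n \<Rightarrow> real \<Rightarrow> real) \<Rightarrow> real^'n::finite \<Rightarrow> real" where
  "split_density f Z = (\<Sum>i\<in>UNIV. f i (Z $ i))"

text \<open>The densities considered are nonnegative and continuous, so the integral is taken in
  \<open>[0,\<infinity>]\<close>.\<close>

definition energy :: "(real^'n::finite \<Rightarrow> real) \<Rightarrow> (real^'n) set \<Rightarrow> (real^'n \<Rightarrow> real) \<Rightarrow> ennreal" where
  "energy F \<Omega> w = (\<integral>\<^sup>+x. ennreal (F (weak_gradient \<Omega> w x)) \<partial>lebesgue_on \<Omega>)"

definition energy_class :: "(real^'n::finite \<Rightarrow> real) \<Rightarrow> (real^'n) set \<Rightarrow> (real^'n \<Rightarrow> real) set" where
  "energy_class F \<Omega> = {w \<in> W11 \<Omega>. energy F \<Omega> w < \<infinity>}"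

text \<open>The support of an equivalence class of functions modulo null sets.\<close>

definition ess_support :: "'a::euclidean_space set \<Rightarrow> ('a \<Rightarrow> real) \<Rightarrow> 'a set" where
  "ess_support \<Omega> g = {x \<in> \<Omega>. \<forall>\<epsilon>>0. \<not> (AE y in lebesgue_on (\<Omega> \<inter> ball x \<epsilon>). g y = 0)}"

definition local_minimizer ::
  "(real^'n::finite \<Rightarrow> real) \<Rightarrow> (real^'n) set \<Rightarrow> (real^'n \<Rightarrow> real) \<Rightarrow> bool" where
  "local_minimizer F \<Omega> u \<longleftrightarrow> u \<in> energy_class F \<Omega> \<and>
     (\<forall>w\<in>energy_class F \<Omega>. compactly_contained (ess_support \<Omega> (\<lambda>x. u x - w x)) \<Omega> \<longrightarrow>
        energy F \<Omega> u \<le> energy F \<Omega> w)"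

definition Gam :: "real \<Rightarrow> real" where
  "Gam t = 1 + t\<^sup>2"

end

theory Submission
  imports Defs
begin

text \<open>
  Write \<open>v\<close> for the \<open>i\<close>-th weak derivative of \<open>u\<close>, \<open>v\<^sub>h\<close> for its translate by \<open>h e\<^sub>i\<close>, and \<open>\<Delta>\<close> for the
  increment of \<open>u\<close> itself. No regularised problem is needed: comparing \<open>u\<close> with \<open>u + \<tau> \<zeta> \<Delta>\<close>, and the
  translate of \<open>u\<close> with its analogue, and letting \<open>\<tau>\<close> tend to \<open>0\<close> gives a Caccioppoli inequality which bounds
  the integral of \<open>good = (f\<^sub>i'(v\<^sub>h) - f\<^sub>i'(v)) (v\<^sub>h - v)\<close> by those of \<open>f\<^sub>j''(\<partial>\<^sub>j u) \<Delta>\<^sup>2\<close>.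

  If the integral of \<open>good\<close> is of order \<open>h\<^sup>\<sigma>\<close> locally, then \<open>f\<^sub>i(v) \<bar>v\<bar>\<^bsup>\<sigma>'\<^esup>\<close> is locally integrable for
  \<open>\<sigma>' < \<sigma>\<close>: since \<open>u\<close> is bounded, the mean of \<open>v\<close> over a segment of length \<open>h\<close> is at most \<open>2 M / h\<close>, so
  where \<open>\<bar>v\<bar>\<close> is larger than \<open>8 M / h\<close> the increments of \<open>v\<close> with steps between \<open>h\<close> and \<open>2 h\<close> are
  comparable to \<open>v\<close>. Conversely, since \<open>\<bar>\<Delta>\<bar>\<close> is at most \<open>2 M\<close> and \<open>\<Delta> / h\<close> is a mean of \<open>v\<close>, this
  integrability and Young's inequality improve the order of decay. The conditions on the exponents are exactly
  what makes each round gain a fixed amount as long as \<open>\<sigma> \<le> 1\<close>; the variables are treated in increasing order,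
  so that for \<open>j < i\<close> the gain already obtained for \<open>\<partial>\<^sub>j u\<close> is available.
\<close>

section \<open>Smooth functions and cutoffs\<close>

text \<open>The term with j = i is the obstacle. Nothing relates q_i^+ to q_i^-, so where the i-th
  derivative and \<Delta> have opposite signs, Young's inequality does not control f_i''(v)
  \<Delta>^2. \<open>monotone_term_clamped\<close> therefore splits the increment of f_i' at 0. The
  part on the side of the sign of \<Delta> is absorbed with the exponent of that side only; the
  other part is kept linear in \<Delta>. As \<Delta> / h is a mean of v, that linear term is h times
  monotonicity products with steps up to h, hence of order 1 + \<sigma>. The numbers 2 and 3 arise
  as follows. Let Q be an exponent of f_j, q the smaller exponent of f_i, and \<tau> the extra
  integrability known for the j-th derivative. Young's inequality gives order \<rho> if (Q - 2)/(Q +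
  \<tau>) + \<rho>/(q + \<sigma>) <= 1. A gain up to \<sigma> = 1 requires strict inequality for
  \<rho> = \<sigma> = 1, which is Q < (2 + \<tau>) q + 2, with \<tau> = 1 for j < i and \<tau> = 0
  for j > i. The Euler equation appears only as an inequality for increments: products of f_j'(v)
  with a translated derivative are not known to be integrable when the two exponents of f_j
  differ.\<close>

lemma partial_has_derivative:
  assumes "(\<phi> has_derivative D) (at x)"
  shows "partial i \<phi> x = D (axis i 1)"
  using frechet_derivative_at[OF assms] by (simp add: partial_def)

lemma C_k_Suc_imp_C_k: "C_k (Suc k) \<phi> \<Longrightarrow> C_k k \<phi>"
proof (induction k arbitrary: \<phi>)
  case 0
  then show ?case
    by (auto simp: continuous_on_eq_continuous_at intro!: differentiable_imp_continuous_within)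
next
  case (Suc k)
  then show ?case by auto
qed

lemma partial_const: "partial i (\<lambda>x. c) = (\<lambda>x. 0)"
  by (rule ext, subst partial_has_derivative[OF has_derivative_const]) simp

lemma C_k_const: "C_k k (\<lambda>x. c)"
proof (induction k arbitrary: c)
  case (Suc k)
  then show ?case by (simp add: partial_const)
qed simp

lemma partial_add:
  assumes "\<phi> differentiable (at x)" "\<psi> differentiable (at x)"
  shows "partial i (\<lambda>x. \<phi> x + \<psi> x) x = partial i \<phi> x + partial i \<psi> x"
  using partial_has_derivative[OF has_derivative_add[OF assms[THEN frechet_derivative_works[THEN iffD1]]]]
  by (simp add: partial_def)

lemma partial_mult:
  assumes "\<phi> differentiable (at x)" "\<psi> differentiable (at x)"
  shows "partial i (\<lambda>x. \<phi> x * \<psi> x) x = \<phi> x * partial i \<psi> x + partial i \<phi> x * \<psi> x"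
  using partial_has_derivative[OF has_derivative_mult[OF assms[THEN frechet_derivative_works[THEN iffD1]]]]
  by (simp add: partial_def)

lemma partial_shift:
  assumes "\<phi> differentiable (at (x + a))"
  shows "partial i (\<lambda>x. \<phi> (x + a)) x = partial i \<phi> (x + a)"
proof -
  have "((\<lambda>x. \<phi> (x + a)) has_derivative frechet_derivative \<phi> (at (x + a))) (at x)"
    by (rule has_derivative_compose[of "\<lambda>x. x + a" "\<lambda>h. h" x UNIV \<phi>, simplified])
      (use assms in \<open>auto intro!: derivative_eq_intros simp: frechet_derivative_works[symmetric]\<close>)
  from partial_has_derivative[OF this] show ?thesis by (simp add: partial_def)
qed

lemma C_k_add: "C_k k \<phi> \<Longrightarrow> C_k k \<psi> \<Longrightarrow> C_k k (\<lambda>x. \<phi> x + \<psi> x)"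
proof (induction k arbitrary: \<phi> \<psi>)
  case (Suc k)
  then have "partial i (\<lambda>x. \<phi> x + \<psi> x) = (\<lambda>x. partial i \<phi> x + partial i \<psi> x)" for i
    by (auto intro!: partial_add)
  with Suc show ?case by auto
qed (auto intro: continuous_on_add)

lemma C_k_mult: "C_k k \<phi> \<Longrightarrow> C_k k \<psi> \<Longrightarrow> C_k k (\<lambda>x. \<phi> x * \<psi> x)"
proof (induction k arbitrary: \<phi> \<psi>)
  case (Suc k)
  then have "partial i (\<lambda>x. \<phi> x * \<psi> x) = (\<lambda>x. \<phi> x * partial i \<psi> x + partial i \<phi> x * \<psi> x)" for i
    by (auto intro!: partial_mult)
  moreover have "C_k k \<phi>" "C_k k \<psi>"
    using Suc.prems by (auto intro: C_k_Suc_imp_C_k)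
  ultimately show ?case using Suc by (auto intro!: C_k_add)
qed (auto intro: continuous_on_mult)

lemma C_k_prod:
  assumes "finite I" "\<And>i. i \<in> I \<Longrightarrow> C_k k (\<phi> i)"
  shows "C_k k (\<lambda>x. \<Prod>i\<in>I. \<phi> i x)"
  using assms by (induction I rule: finite_induct) (auto intro!: C_k_mult C_k_const)

lemma C_k_shift: "C_k k \<phi> \<Longrightarrow> C_k k (\<lambda>x. \<phi> (x + a))"
proof (induction k arbitrary: \<phi>)
  case 0
  then show ?case
    by (auto intro!: continuous_on_compose2[of UNIV \<phi>] continuous_intros)
next
  case (Suc k)
  then have "partial i (\<lambda>x. \<phi> (x + a)) = (\<lambda>x. partial i \<phi> (x + a))" for i
    by (auto intro!: partial_shift)
  moreover have "(\<lambda>x. \<phi> (x + a)) differentiable at x" for x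
    using Suc.prems differentiable_chain_at[of "\<lambda>x. x + a" x \<phi>] by (auto simp: o_def)
  ultimately show ?case using Suc by auto
qed

text \<open>The family is closed under differentiation: \<open>b\<^sub>m' = b\<^bsub>m+2\<^esub> - m b\<^bsub>m+1\<^esub>\<close>.\<close>

definition exp_bump :: "nat \<Rightarrow> real \<Rightarrow> real" where
  "exp_bump m t = (if t > 0 then (1 / t) ^ m * exp (- (1 / t)) else 0)"

lemma exp_bump_at_0: "(exp_bump m \<longlongrightarrow> 0) (at 0)"
proof -
  have "((\<lambda>t::real. (1 / t) ^ m * exp (- (1 / t))) \<longlongrightarrow> 0) (at_right 0)"
  proof -
    have "((\<lambda>s::real. s ^ m * exp (- s)) \<longlongrightarrow> 0) at_top"
      using tendsto_power_div_exp_0[of m] by (simp add: exp_minus field_simps)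
    moreover have "filterlim (\<lambda>t::real. 1 / t) at_top (at_right 0)"
      using filterlim_inverse_at_top_right by (simp add: inverse_eq_divide)
    ultimately show ?thesis by (rule filterlim_compose)
  qed
  then have "(exp_bump m \<longlongrightarrow> 0) (at_right 0)"
    by (rule Lim_transform_eventually)
      (auto simp: eventually_at_filter exp_bump_def)
  moreover have "(exp_bump m \<longlongrightarrow> 0) (at_left 0)"
    by (rule Lim_transform_eventually[OF tendsto_const])
      (auto simp: eventually_at_filter exp_bump_def)
  ultimately show ?thesis by (simp add: filterlim_at_split)
qed

lemma exp_bump_DERIV:
  "(exp_bump m has_real_derivative exp_bump (m + 2) t - real m * exp_bump (m + 1) t) (at t)"
proof -
  consider "t > 0" | "t < 0" | "t = 0" by linarith
  then show ?thesis
  proof cases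
    case 1
    have D1: "((\<lambda>s. s ^ m * exp (- s)) has_real_derivative real m * s ^ (m - 1) * exp (- s) - s ^ m * exp (- s)) (at s)"
      for s :: real
      by (auto intro!: derivative_eq_intros)
    have D2: "((\<lambda>t. 1 / t) has_real_derivative - (1 / t)\<^sup>2) (at t)"
      using 1 by (auto intro!: derivative_eq_intros simp: power2_eq_square)
    have "((\<lambda>t. (1 / t) ^ m * exp (- (1 / t))) has_real_derivative
        exp_bump (m + 2) t - real m * exp_bump (m + 1) t) (at t)"
      using DERIV_chain2[OF D1 D2] 1
      by (cases m) (simp_all add: exp_bump_def power2_eq_square algebra_simps add_divide_distrib)
    then show ?thesis
      by (rule has_field_derivative_transform_within_open[where S = "{0<..}"])
        (use 1 in \<open>auto simp: exp_bump_def\<close>)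
  next
    case 2
    have "((\<lambda>t. 0) has_real_derivative exp_bump (m + 2) t - real m * exp_bump (m + 1) t) (at t)"
      using 2 by (auto simp: exp_bump_def)
    then show ?thesis
      by (rule has_field_derivative_transform_within_open[where S = "{..<0}"])
        (use 2 in \<open>auto simp: exp_bump_def\<close>)
  next
    case 3
    \<comment> \<open>At 0 the difference quotient is the next member of the family, and that tends
      to 0; the claimed derivative vanishes at 0 as well.\<close>
    have "(\<lambda>s. (exp_bump m s - exp_bump m 0) / (s - 0)) = exp_bump (m + 1)"
      by (auto simp: exp_bump_def)
    then show ?thesis
      using exp_bump_at_0[of "m + 1"] by (simp add: 3 has_field_derivative_iff exp_bump_def)
  qed
qed

lemma C_k_exp_bump_coord: "C_k k (\<lambda>x. exp_bump m (l * x $ i + c))"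
proof (induction k arbitrary: m)
  case 0
  have "continuous_on UNIV (exp_bump m)"
    using exp_bump_DERIV by (meson DERIV_isCont continuous_at_imp_continuous_on)
  then show ?case
    by (auto intro!: continuous_on_compose2[of UNIV "exp_bump m"] continuous_intros)
next
  case (Suc k)
  have der: "((\<lambda>x. exp_bump m (l * x $ i + c)) has_derivative
      (\<lambda>h. (l * h $ i) * (exp_bump (m + 2) (l * x $ i + c) - real m * exp_bump (m + 1) (l * x $ i + c)))) (at x)" for x
  proof (rule DERIV_compose_FDERIV[OF exp_bump_DERIV])
    show "((\<lambda>x. l * x $ i + c) has_derivative (\<lambda>h. l * h $ i)) (at x)"
      by (auto intro!: derivative_eq_intros bounded_linear.has_derivative[OF bounded_linear_vec_nth])
  qed
  have "partial j (\<lambda>x. exp_bump m (l * x $ i + c)) =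
      (\<lambda>x. (l * axis j 1 $ i) * (exp_bump (m + 2) (l * x $ i + c) + (- real m) * exp_bump (m + 1) (l * x $ i + c)))" for j
    by (rule ext, subst partial_has_derivative[OF der]) simp
  moreover have "C_k k (\<lambda>x. (l * axis j 1 $ i) * (exp_bump (m + 2) (l * x $ i + c) + (- real m) * exp_bump (m + 1) (l * x $ i + c)))" for j
    by (intro C_k_mult C_k_add C_k_const Suc)
  ultimately show ?case
    using der by (auto simp: differentiable_def)
qed

text \<open>The dilation \<open>l\<close> serves one purpose: as it grows, the bumps tend to the
  indicator of the open box, which the fundamental lemma needs.\<close>

definition box_bump :: "real \<Rightarrow> real^'n::finite \<Rightarrow> real^'n \<Rightarrow> real^'n \<Rightarrow> real" where
  "box_bump l a b x = (\<Prod>i\<in>UNIV. exp_bump 0 (l * (x $ i - a $ i)) * exp_bump 0 (l * (b $ i - x $ i)))"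

lemma exp_bump_0_bounds: "0 \<le> exp_bump 0 t" "exp_bump 0 t \<le> 1" "exp_bump 0 t > 0 \<longleftrightarrow> t > 0"
  by (auto simp: exp_bump_def)

lemma C_k_box_bump: "C_k k (box_bump l a b)"
proof -
  have "C_k k (\<lambda>x. \<Prod>i\<in>UNIV. exp_bump 0 (l * x $ i + (- (l * a $ i))) * exp_bump 0 ((-l) * x $ i + l * b $ i))"
    by (intro C_k_prod C_k_mult C_k_exp_bump_coord) auto
  then show ?thesis by (simp add: box_bump_def[abs_def] algebra_simps)
qed

lemma box_bump_bounds: "0 \<le> box_bump l a b x" "box_bump l a b x \<le> 1"
proof -
  have "0 \<le> exp_bump 0 s * exp_bump 0 t" "exp_bump 0 s * exp_bump 0 t \<le> 1" for s t
    by (simp_all add: exp_bump_0_bounds mult_le_one)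
  then show "0 \<le> box_bump l a b x" "box_bump l a b x \<le> 1"
    unfolding box_bump_def by (simp_all add: prod_nonneg prod_le_1)
qed

lemma box_bump_pos_iff:
  assumes "l > 0"
  shows "box_bump l a b x > 0 \<longleftrightarrow> x \<in> box a b"
proof -
  have "box_bump l a b x > 0 \<longleftrightarrow> (\<forall>i. exp_bump 0 (l * (x $ i - a $ i)) * exp_bump 0 (l * (b $ i - x $ i)) \<noteq> 0)"
    using box_bump_bounds(1)[of l a b x] by (auto simp: box_bump_def less_le)
  also have "\<dots> \<longleftrightarrow> (\<forall>i. exp_bump 0 (l * (x $ i - a $ i)) > 0 \<and> exp_bump 0 (l * (b $ i - x $ i)) > 0)"
    using exp_bump_0_bounds(1) by (auto simp: less_le)
  also have "\<dots> \<longleftrightarrow> x \<in> box a b"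
    using assms by (auto simp: exp_bump_0_bounds mem_box_cart zero_less_mult_iff)
  finally show ?thesis .
qed

lemma box_bump_eq_0_iff:
  "l > 0 \<Longrightarrow> box_bump l a b x = 0 \<longleftrightarrow> x \<notin> box a b"
  using box_bump_pos_iff[of l a b x] box_bump_bounds(1)[of l a b x] by (auto simp: less_le)

lemma box_bump_tendsto_indicator:
  "(\<lambda>n. box_bump (real (Suc n)) a b x) \<longlonglongrightarrow> indicator (box a b) x"
proof (cases "x \<in> box a b")
  case True
  have "(\<lambda>n. exp_bump 0 (real (Suc n) * t)) \<longlonglongrightarrow> 1" if "t > 0" for t
  proof -
    have "(\<lambda>n. exp (- (1 / t * (1 / real (Suc n))))) \<longlonglongrightarrow> exp (- (1 / t * 0))"
      by (intro tendsto_intros lim_1_over_n[THEN LIMSEQ_Suc])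
    moreover have "exp_bump 0 (real (Suc n) * t) = exp (- (1 / t * (1 / real (Suc n))))" for n
      using that by (simp add: exp_bump_def add_pos_nonneg)
    ultimately show ?thesis by simp
  qed
  then have "(\<lambda>n. box_bump (real (Suc n)) a b x) \<longlonglongrightarrow> (\<Prod>i\<in>(UNIV::'a set). 1 * 1)"
    unfolding box_bump_def using True by (intro tendsto_intros) (auto simp: mem_box_cart)
  then show ?thesis using True by simp
next
  case False
  then have "box_bump (real (Suc n)) a b x = 0" for n
    by (subst box_bump_eq_0_iff) auto
  with False show ?thesis by simp
qed

section \<open>Test functions: bounds, products, translates, cutoffs\<close>

lemma test_functionsD:
  assumes "\<phi> \<in> test_functions \<Omega>"
  shows "C_k k \<phi>" "\<phi> differentiable (at x)" "continuous_on UNIV \<phi>" "continuous_on UNIV (partial i \<phi>)"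
    "compact (closure {x. \<phi> x \<noteq> 0})" "closure {x. \<phi> x \<noteq> 0} \<subseteq> \<Omega>"
proof -
  have *: "C_k k \<phi>" for k using assms by (auto simp: test_functions_def)
  show "C_k k \<phi>" "\<phi> differentiable (at x)" "continuous_on UNIV \<phi>" "continuous_on UNIV (partial i \<phi>)"
    using *[of k] *[of 1] *[of 0] by auto
  show "compact (closure {x. \<phi> x \<noteq> 0})" "closure {x. \<phi> x \<noteq> 0} \<subseteq> \<Omega>"
    using assms by (auto simp: test_functions_def compactly_contained_def)
qed

lemma test_functionsI:
  assumes "\<And>k. C_k k \<phi>" "compact K" "K \<subseteq> \<Omega>" "\<And>x. x \<notin> K \<Longrightarrow> \<phi> x = 0"
  shows "\<phi> \<in> test_functions \<Omega>"
proof -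
  have "closure {x. \<phi> x \<noteq> 0} \<subseteq> K"
    using assms by (intro closure_minimal) (auto intro: compact_imp_closed)
  moreover from this have "compact (closure {x. \<phi> x \<noteq> 0})"
    using closed_Int_compact[OF closed_closure[of "{x. \<phi> x \<noteq> 0}"] assms(2)] by (simp add: Int_absorb2)
  ultimately show ?thesis
    using assms(1,3) by (auto simp: test_functions_def compactly_contained_def)
qed

lemma test_functions_zero_outside:
  assumes "\<phi> \<in> test_functions \<Omega>" "x \<notin> closure {x. \<phi> x \<noteq> 0}"
  shows "\<phi> x = 0" "partial i \<phi> x = 0"
proof -
  show "\<phi> x = 0" using assms(2) closure_subset[of "{x. \<phi> x \<noteq> 0}"] by auto
  have "(\<phi> has_derivative (\<lambda>h. 0)) (at x)"
  proof (rule has_derivative_transform_within_open[where f = "\<lambda>x. 0"])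
    show "open (- closure {x. \<phi> x \<noteq> 0})" by auto
  qed (use assms(2) closure_subset[of "{x. \<phi> x \<noteq> 0}"] in auto)
  from partial_has_derivative[OF this] show "partial i \<phi> x = 0" by simp
qed

lemma test_functions_bounded:
  assumes "\<phi> \<in> test_functions \<Omega>"
  shows "\<exists>B>0. \<forall>x. \<bar>\<phi> x\<bar> \<le> B \<and> (\<forall>i. \<bar>partial i \<phi> x\<bar> \<le> B)"
proof -
  let ?K = "closure {x. \<phi> x \<noteq> 0}"
  note D = test_functionsD[OF assms]
  have bnd: "\<exists>B. \<forall>x\<in>?K. \<bar>g x\<bar> \<le> B" if "continuous_on UNIV g" for g :: "real^'a \<Rightarrow> real"
  proof -
    have "bounded (g ` ?K)"
      by (intro compact_imp_bounded compact_continuous_image continuous_on_subset[OF that] D) auto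
    then show ?thesis by (auto simp: bounded_iff)
  qed
  obtain B0 where B0: "\<And>x. x \<in> ?K \<Longrightarrow> \<bar>\<phi> x\<bar> \<le> B0" using bnd[OF D(3)] by auto
  obtain B1 where B1: "\<And>i x. x \<in> ?K \<Longrightarrow> \<bar>partial i \<phi> x\<bar> \<le> B1 i" using bnd[OF D(4)] by metis
  define B where "B = 1 + \<bar>B0\<bar> + (\<Sum>i\<in>UNIV. \<bar>B1 i\<bar>)"
  have S: "(\<Sum>i\<in>UNIV. \<bar>B1 i\<bar>) \<ge> 0" by (auto intro: sum_nonneg)
  have le: "\<bar>B1 i\<bar> \<le> (\<Sum>i\<in>UNIV. \<bar>B1 i\<bar>)" for i by (rule member_le_sum) auto
  have "\<bar>\<phi> x\<bar> \<le> B \<and> (\<forall>i. \<bar>partial i \<phi> x\<bar> \<le> B)" for x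
  proof (cases "x \<in> ?K")
    case True
    have "\<bar>partial i \<phi> x\<bar> \<le> B" for i
      using B1[OF True, of i] le[of i] unfolding B_def by linarith
    moreover have "\<bar>\<phi> x\<bar> \<le> B" using B0[OF True] S unfolding B_def by linarith
    ultimately show ?thesis by blast
  next
    case False
    then show ?thesis using test_functions_zero_outside[OF assms False] S by (auto simp: B_def)
  qed
  moreover have "B > 0" using S unfolding B_def by linarith
  ultimately show ?thesis by blast
qed

lemma test_functions_mult:
  assumes "\<phi> \<in> test_functions \<Omega>" "\<And>k. C_k k \<psi>"
  shows "(\<lambda>x. \<phi> x * \<psi> x) \<in> test_functions \<Omega>"
proof (rule test_functionsI[OF C_k_mult[OF test_functionsD(1)[OF assms(1)] assms(2)] test_functionsD(5,6)[OF assms(1)]])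
  show "\<phi> x * \<psi> x = 0" if "x \<notin> closure {x. \<phi> x \<noteq> 0}" for x
    using test_functions_zero_outside(1)[OF assms(1) that] by simp
qed

lemma test_functions_add:
  assumes "\<phi> \<in> test_functions \<Omega>" "\<psi> \<in> test_functions \<Omega>"
  shows "(\<lambda>x. \<phi> x + \<psi> x) \<in> test_functions \<Omega>"
proof (rule test_functionsI)
  let ?K = "closure {x. \<phi> x \<noteq> 0} \<union> closure {x. \<psi> x \<noteq> 0}"
  show "C_k k (\<lambda>x. \<phi> x + \<psi> x)" for k
    by (intro C_k_add assms[THEN test_functionsD(1)])
  show "compact ?K" by (intro compact_Un assms[THEN test_functionsD(5)])
  show "?K \<subseteq> \<Omega>" by (intro Un_least assms[THEN test_functionsD(6)])
  show "\<phi> x + \<psi> x = 0" if "x \<notin> ?K" for x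
    using test_functions_zero_outside(1)[OF assms(1), of x] test_functions_zero_outside(1)[OF assms(2), of x] that
    by (metis UnI1 UnI2 add_0)
qed

lemma test_functions_shift:
  assumes "\<phi> \<in> test_functions \<Omega>" "\<And>x. x \<in> closure {x. \<phi> x \<noteq> 0} \<Longrightarrow> x - a \<in> \<Omega>'"
  shows "(\<lambda>x. \<phi> (x + a)) \<in> test_functions \<Omega>'"
proof (rule test_functionsI)
  let ?K = "(\<lambda>x. x - a) ` closure {x. \<phi> x \<noteq> 0}"
  show "C_k k (\<lambda>x. \<phi> (x + a))" for k using assms(1) by (intro C_k_shift test_functionsD)
  show "compact ?K"
    by (intro compact_continuous_image continuous_intros test_functionsD(5)[OF assms(1)])
  show "?K \<subseteq> \<Omega>'" using assms(2) by auto
  show "\<phi> (x + a) = 0" if "x \<notin> ?K" for x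
    using that by (intro test_functions_zero_outside(1)[OF assms(1)]) (auto simp: image_iff eq_diff_eq)
qed

lemma box_bump_test_function:
  assumes "l > 0" "cbox a b \<subseteq> \<Omega>"
  shows "box_bump l a b \<in> test_functions \<Omega>"
  by (rule test_functionsI[OF C_k_box_bump compact_cbox assms(2)])
    (use box_bump_eq_0_iff[OF assms(1), of a b] box_subset_cbox[of a b] in auto)

text \<open>Finitely many boxes with closures in \<Omega> cover \<open>K\<close>, and the sum of
  their bumps is positive there. The Caccioppoli argument asks of its cutoff only a positive lower
  bound on \<open>K\<close>, so no function equal to 1 on \<open>K\<close> has to be built.\<close>

lemma test_function_positive_on_compact:
  assumes "compact K" "K \<subseteq> \<Omega>" "open \<Omega>"
  obtains \<beta> where "\<beta> \<in> test_functions \<Omega>" "\<And>x. \<beta> x \<ge> 0" "\<And>x. x \<in> K \<Longrightarrow> \<beta> x > 0"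
proof -
  define \<B> where "\<B> = {(a, b). cbox a b \<subseteq> \<Omega>}"
  have "K \<subseteq> (\<Union>p\<in>\<B>. box (fst p) (snd p))"
  proof
    fix x assume "x \<in> K"
    then have "x \<in> \<Omega>" using assms by auto
    then obtain a b where "x \<in> box a b" "cbox a b \<subseteq> \<Omega>"
      using open_contains_cbox[of \<Omega> x] assms(3) by metis
    then show "x \<in> (\<Union>p\<in>\<B>. box (fst p) (snd p))" by (auto simp: \<B>_def)
  qed
  then obtain \<C> where C: "\<C> \<subseteq> \<B>" "finite \<C>" "K \<subseteq> (\<Union>p\<in>\<C>. box (fst p) (snd p))"
    by (rule compactE_image[OF assms(1), of \<B> "\<lambda>p. box (fst p) (snd p)", rotated]) auto
  have "\<exists>\<beta>\<in>test_functions \<Omega>. (\<forall>x. \<beta> x \<ge> 0) \<and> (\<forall>x\<in>(\<Union>p\<in>\<C>. box (fst p) (snd p)). \<beta> x > 0)"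
    using C(2,1)
  proof (induction \<C> rule: finite_induct)
    case empty
    have "(\<lambda>x. 0) \<in> test_functions \<Omega>"
      by (rule test_functionsI[where K = "{}"]) (auto intro: C_k_const)
    then show ?case by (intro bexI[of _ "\<lambda>x. 0"]) auto
  next
    case (insert p \<C>)
    then obtain \<beta> where b: "\<beta> \<in> test_functions \<Omega>" "\<forall>x. \<beta> x \<ge> 0" "\<forall>x\<in>(\<Union>p\<in>\<C>. box (fst p) (snd p)). \<beta> x > 0"
      by auto
    have "box_bump 1 (fst p) (snd p) \<in> test_functions \<Omega>"
      using insert by (intro box_bump_test_function) (auto simp: \<B>_def)
    moreover have "\<beta> x + box_bump 1 (fst p) (snd p) x > 0" if "x \<in> (\<Union>p\<in>insert p \<C>. box (fst p) (snd p))" for x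
    proof (cases "x \<in> box (fst p) (snd p)")
      case True
      then have "box_bump 1 (fst p) (snd p) x > 0" by (simp add: box_bump_pos_iff)
      with b(2) show ?thesis by (simp add: add_nonneg_pos)
    next
      case False
      with that b(3) have "\<beta> x > 0" by auto
      then show ?thesis by (simp add: add_pos_nonneg box_bump_bounds)
    qed
    ultimately show ?case
      using b(1,2) box_bump_bounds(1)[of 1 "fst p" "snd p"]
      by (intro bexI[of _ "\<lambda>x. \<beta> x + box_bump 1 (fst p) (snd p) x"] conjI allI ballI
          test_functions_add add_nonneg_nonneg) auto
  qed
  then obtain \<beta> where b: "\<beta> \<in> test_functions \<Omega>" "\<forall>x. \<beta> x \<ge> 0"
    "\<forall>x\<in>(\<Union>p\<in>\<C>. box (fst p) (snd p)). \<beta> x > 0" by blast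
  show ?thesis by (rule that[OF b(1)]) (use b(2,3) C(3) in auto)
qed

section \<open>The fundamental lemma and Borel representatives of weak derivatives\<close>

text \<open>Since \<open>ennreal\<close> truncates at 0, the two densities are the positive and the
  negative part of \<open>g\<close>. The resulting finite measures agree on boxes, a generator
  stable under intersection, so the two parts coincide almost everywhere; as one of them is always
  0, both vanish.\<close>

lemma integral_boxes_zero_imp_AE_zero:
  fixes g :: "'a::euclidean_space \<Rightarrow> real"
  assumes g: "integrable lborel g"
    and box: "\<And>a b. (\<integral>x. g x * indicator (box a b) x \<partial>lborel) = 0"
  shows "AE x in lborel. g x = 0"
proof -
  have m[measurable]: "g \<in> borel_measurable borel" using g by auto
  let ?M = "density lborel (\<lambda>x. ennreal (g x))" and ?N = "density lborel (\<lambda>x. ennreal (- g x))"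
  have fin: "(\<integral>\<^sup>+x. ennreal (\<bar>g x\<bar>) \<partial>lborel) < \<infinity>"
    using g by (simp add: integrable_iff_bounded)
  have eqbox: "emeasure ?M (box a b) = emeasure ?N (box a b)" for a b
  proof -
    let ?g = "\<lambda>x. g x * indicator (box a b) x"
    have i: "integrable lborel ?g"
      using integrable_mult_indicator[OF _ g, of "box a b"] by (simp add: mult.commute)
    have lt: "(\<integral>\<^sup>+x. ennreal (s * ?g x) \<partial>lborel) < \<infinity>" if "\<bar>s\<bar> = 1" for s
    proof -
      have "(\<integral>\<^sup>+x. ennreal (s * ?g x) \<partial>lborel) \<le> (\<integral>\<^sup>+x. ennreal (\<bar>g x\<bar>) \<partial>lborel)"
      proof (intro nn_integral_mono ennreal_leI)
        fix x show "s * ?g x \<le> \<bar>g x\<bar>" using that by (cases "s \<ge> 0") (auto simp: indicator_def)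
      qed
      with fin show ?thesis by simp
    qed
    have "0 = enn2real (\<integral>\<^sup>+x. ennreal (?g x) \<partial>lborel) - enn2real (\<integral>\<^sup>+x. ennreal (- ?g x) \<partial>lborel)"
      using real_lebesgue_integral_def[OF i] box[of a b] by simp
    then have "(\<integral>\<^sup>+x. ennreal (?g x) \<partial>lborel) = (\<integral>\<^sup>+x. ennreal (- ?g x) \<partial>lborel)"
      using lt[of 1] lt[of "-1"]
      by (metis (no_types, lifting) abs_1 abs_minus_cancel diff_eq_eq add_0 ennreal_enn2real_if infinity_ennreal_def
          less_irrefl mult_minus1 mult_1 nn_integral_cong)
    moreover have "emeasure ?M (box a b) = (\<integral>\<^sup>+x. ennreal (?g x) \<partial>lborel)"
      by (subst emeasure_density) (auto intro!: nn_integral_cong simp: indicator_def)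
    moreover have "emeasure ?N (box a b) = (\<integral>\<^sup>+x. ennreal (- ?g x) \<partial>lborel)"
      by (subst emeasure_density) (auto intro!: nn_integral_cong simp: indicator_def)
    ultimately show ?thesis by simp
  qed
  have "?M = ?N"
  proof (rule measure_eqI_generator_eq[where E = "range (\<lambda>(a, b). box a b)" and \<Omega> = UNIV and
        A = "\<lambda>n. box (- (real n *\<^sub>R One)) (real n *\<^sub>R One)"])
    show "Int_stable (range (\<lambda>(a, b). box a b :: 'a set))"
      by (auto simp: Int_stable_def box_Int_box)
    show "emeasure ?M X = emeasure ?N X" if "X \<in> range (\<lambda>(a, b). box a b)" for X
      using that eqbox by auto
    show "sets ?M = sigma_sets UNIV (range (\<lambda>(a, b). box a b))"
      "sets ?N = sigma_sets UNIV (range (\<lambda>(a, b). box a b))"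
      by (simp_all add: borel_eq_box)
    show "(\<Union>n. box (- (real n *\<^sub>R One)) (real n *\<^sub>R One)) = (UNIV :: 'a set)"
      by (rule UN_box_eq_UNIV)
    fix n
    have "emeasure ?M (box (- (real n *\<^sub>R One)) (real n *\<^sub>R One)) \<le> (\<integral>\<^sup>+x. ennreal (\<bar>g x\<bar>) \<partial>lborel)"
      by (subst emeasure_density) (auto intro!: nn_integral_mono ennreal_leI simp: indicator_def)
    with fin show "emeasure ?M (box (- (real n *\<^sub>R One)) (real n *\<^sub>R One)) \<noteq> \<infinity>"
      by (auto simp: top_unique)
  qed auto
  then have "AE x in lborel. ennreal (g x) = ennreal (- g x)"
    by (intro sigma_finite_measure.density_unique[OF sigma_finite_lborel]) auto
  then show ?thesis
  proof eventually_elim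
    case (elim x)
    then show ?case by (cases "g x \<ge> 0") (auto simp: ennreal_neg ennreal_eq_0_iff)
  qed
qed

text \<open>Dominated convergence replaces bumps by indicators, so \<open>g\<close> has integral 0
  over every box whose closure lies in \<Omega>. Inside one such box all sub-boxes are available and
  \<open>g\<close> vanishes almost everywhere; a countable cover by such boxes gives the claim on
  \<Omega>.\<close>

lemma fundamental_lemma:
  fixes g :: "real^'n::finite \<Rightarrow> real"
  assumes op: "open \<Omega>" and loc: "locally_integrable \<Omega> g"
    and zero: "\<And>\<phi>. \<phi> \<in> test_functions \<Omega> \<Longrightarrow> (\<integral>x. g x * \<phi> x \<partial>lebesgue_on \<Omega>) = 0"
  shows "AE x in lebesgue_on \<Omega>. g x = 0"
proof -
  have boxzero: "(\<integral>x. g x * indicator (box a b) x \<partial>lebesgue) = 0" if ab: "cbox a b \<subseteq> \<Omega>" for a b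
  proof -
    have i: "integrable lebesgue (\<lambda>x. indicator (cbox a b) x * g x)"
    proof -
      have "integrable (lebesgue_on (cbox a b)) g"
        using loc ab unfolding locally_integrable_def by auto
      then show ?thesis by (subst (asm) integrable_restrict_space) auto
    qed
    have m: "(\<lambda>x. g x * box_bump l a b x) \<in> borel_measurable lebesgue" if "l > 0" for l
    proof -
      have "(\<lambda>x. (indicator (cbox a b) x * g x) * box_bump l a b x) \<in> borel_measurable lebesgue"
      proof (rule borel_measurable_times)
        show "box_bump l a b \<in> borel_measurable lebesgue"
          using C_k_box_bump[of 0 l a b] by (auto intro!: measurable_completion borel_measurable_continuous_onI)
      qed (use i in auto)
      moreover have "(\<lambda>x. (indicator (cbox a b) x * g x) * box_bump l a b x) = (\<lambda>x. g x * box_bump l a b x)"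
        using box_bump_eq_0_iff[OF that, of a b] box_subset_cbox[of a b]
        by (auto simp: indicator_def fun_eq_iff)
      ultimately show ?thesis by simp
    qed
    have z: "(\<integral>x. g x * box_bump (real (Suc n)) a b x \<partial>lebesgue) = 0" for n
    proof -
      have "(\<integral>x. g x * box_bump (real (Suc n)) a b x \<partial>lebesgue_on \<Omega>) = 0"
        by (intro zero box_bump_test_function ab) auto
      then have "(\<integral>x. indicator \<Omega> x *\<^sub>R (g x * box_bump (real (Suc n)) a b x) \<partial>lebesgue) = 0"
        using op by (subst (asm) integral_restrict_space) auto
      moreover have "indicator \<Omega> x *\<^sub>R (g x * box_bump (real (Suc n)) a b x) = g x * box_bump (real (Suc n)) a b x" for x
        using box_bump_eq_0_iff[of "real (Suc n)" a b x] box_subset_cbox[of a b] ab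
        by (auto simp: indicator_def)
      ultimately show ?thesis by (simp only:)
    qed
    have "(\<lambda>n. \<integral>x. g x * box_bump (real (Suc n)) a b x \<partial>lebesgue) \<longlonglongrightarrow> (\<integral>x. g x * indicator (box a b) x \<partial>lebesgue)"
    proof (rule integral_dominated_convergence[where w = "\<lambda>x. \<bar>indicator (cbox a b) x * g x\<bar>"])
      show "(\<lambda>x. g x * indicator (box a b) x) \<in> borel_measurable lebesgue"
      proof -
        have "(\<lambda>x. (indicator (cbox a b) x * g x) * indicator (box a b) x) \<in> borel_measurable lebesgue"
          by (rule borel_measurable_times[OF borel_measurable_integrable[OF i]]) (auto intro!: borel_measurable_indicator)
        moreover have "(\<lambda>x. (indicator (cbox a b) x * g x) * indicator (box a b) x) = (\<lambda>x. g x * indicator (box a b) x)"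
          using box_subset_cbox[of a b] by (auto simp: indicator_def fun_eq_iff)
        ultimately show ?thesis by simp
      qed
      show "integrable lebesgue (\<lambda>x. \<bar>indicator (cbox a b) x * g x\<bar>)" using i by simp
      show "AE x in lebesgue. (\<lambda>n. g x * box_bump (real (Suc n)) a b x) \<longlonglongrightarrow> g x * indicator (box a b) x"
        by (intro AE_I2 tendsto_mult tendsto_const box_bump_tendsto_indicator)
      show "AE x in lebesgue. norm (g x * box_bump (real (Suc n)) a b x) \<le> \<bar>indicator (cbox a b) x * g x\<bar>" for n
      proof (rule AE_I2)
        fix x
        have "norm (g x * box_bump (real (Suc n)) a b x) \<le> \<bar>g x\<bar>"
          using box_bump_bounds[of "real (Suc n)" a b x] by (auto simp: abs_mult intro!: mult_left_le)
        moreover have "box_bump (real (Suc n)) a b x = 0" if "x \<notin> cbox a b"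
          using that box_subset_cbox[of a b] by (subst box_bump_eq_0_iff) auto
        ultimately show "norm (g x * box_bump (real (Suc n)) a b x) \<le> \<bar>indicator (cbox a b) x * g x\<bar>"
          by (cases "x \<in> cbox a b") auto
      qed
    qed (use m in auto)
    then have "(\<lambda>n. 0) \<longlonglongrightarrow> (\<integral>x. g x * indicator (box a b) x \<partial>lebesgue)" by (simp only: z)
    then show ?thesis by (simp add: LIMSEQ_const_iff)
  qed
  have boxAE: "AE x in lebesgue. x \<in> box a b \<longrightarrow> g x = 0" if ab: "cbox a b \<subseteq> \<Omega>" for a b
  proof -
    have i: "integrable lebesgue (\<lambda>x. indicator (cbox a b) x * g x)"
    proof -
      have "integrable (lebesgue_on (cbox a b)) g"
        using loc ab unfolding locally_integrable_def by auto
      then show ?thesis by (subst (asm) integrable_restrict_space) auto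
    qed
    have "integrable lebesgue (\<lambda>x. indicator (box a b) x *\<^sub>R (indicator (cbox a b) x * g x))"
      by (rule integrable_mult_indicator[OF _ i]) auto
    moreover have "(\<lambda>x. indicator (box a b) x *\<^sub>R (indicator (cbox a b) x * g x)) = (\<lambda>x. indicator (box a b) x * g x)"
      using box_subset_cbox[of a b] by (auto simp: indicator_def fun_eq_iff)
    ultimately have i': "integrable lebesgue (\<lambda>x. indicator (box a b) x * g x)" by simp
    \<comment> \<open>The lemma on boxes compares Borel measures, hence the change to a Borel
      version of \<open>g\<close> cut off to the box.\<close>
    then obtain g' where g': "g' \<in> borel_measurable lborel" "AE x in lborel. indicator (box a b) x * g x = g' x"
      using completion_ex_borel_measurable_real[of "\<lambda>x. indicator (box a b) x * g x" lborel] by auto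
    have ae: "AE x in lebesgue. indicator (box a b) x * g x = g' x" using g'(2) by (rule AE_completion)
    have "integrable lebesgue g'"
      using i' ae g'(1) by (intro integrable_cong_AE_imp[OF i']) (auto intro: measurable_completion)
    then have ig': "integrable lborel g'" using g'(1) by (simp add: integrable_completion)
    have "(\<integral>x. g' x * indicator (box c d) x \<partial>lborel) = 0" for c d
    proof -
      have "(\<integral>x. g' x * indicator (box c d) x \<partial>lborel) = (\<integral>x. g' x * indicator (box c d) x \<partial>lebesgue)"
        using g'(1) by (intro integral_completion[symmetric]) auto
      also have "\<dots> = (\<integral>x. (indicator (box a b) x * g x) * indicator (box c d) x \<partial>lebesgue)"
      proof (rule integral_cong_AE)
        show "(\<lambda>x. g' x * indicator (box c d) x) \<in> borel_measurable lebesgue"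
          using g'(1) by (auto intro!: measurable_completion)
        show "(\<lambda>x. (indicator (box a b) x * g x) * indicator (box c d) x) \<in> borel_measurable lebesgue"
          by (rule borel_measurable_times[OF borel_measurable_integrable[OF i']]) (auto intro!: borel_measurable_indicator)
        show "AE x in lebesgue. g' x * indicator (box c d) x = (indicator (box a b) x * g x) * indicator (box c d) x"
          using ae by eventually_elim simp
      qed
      also have "\<dots> = (\<integral>x. g x * indicator (box a b \<inter> box c d) x \<partial>lebesgue)"
        by (intro Bochner_Integration.integral_cong) (auto simp: indicator_def)
      also have "\<dots> = 0"
      proof (cases "box a b \<inter> box c d = {}")
        case False
        obtain e f where ef: "box a b \<inter> box c d = box e f" by (simp add: box_Int_box)
        have "cbox e f \<subseteq> cbox a b"
          using False ef by (metis closure_box closure_mono inf_le1 box_eq_empty(1) box_subset_cbox closure_minimal closed_cbox order_trans)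
        then have "cbox e f \<subseteq> \<Omega>" using ab by auto
        then show ?thesis unfolding ef by (rule boxzero)
      qed simp
      finally show ?thesis .
    qed
    then have "AE x in lborel. g' x = 0" by (intro integral_boxes_zero_imp_AE_zero ig')
    then have "AE x in lebesgue. g' x = 0" by (rule AE_completion)
    with ae show ?thesis by eventually_elim (auto simp: indicator_def)
  qed
  obtain \<E> where E: "countable \<E>" "\<E> \<subseteq> {box a b | a b. cbox a b \<subseteq> \<Omega>}" "\<Union>\<E> = \<Omega>"
  proof -
    let ?F = "{box a b | a b. cbox a b \<subseteq> \<Omega>}"
    have "\<Union>?F = \<Omega>"
    proof
      show "\<Union>?F \<subseteq> \<Omega>" using box_subset_cbox by blast
      show "\<Omega> \<subseteq> \<Union>?F"
      proof
        fix x assume "x \<in> \<Omega>"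
        then obtain a b where "x \<in> box a b" "cbox a b \<subseteq> \<Omega>"
          using open_contains_cbox[of \<Omega> x] op by metis
        then show "x \<in> \<Union>?F" by blast
      qed
    qed
    moreover obtain \<E> where "\<E> \<subseteq> ?F" "countable \<E>" "\<Union>\<E> = \<Union>?F"
      by (rule Lindelof[of ?F]) (auto simp: open_box)
    ultimately show ?thesis using that by auto
  qed
  have "AE x in lebesgue. \<forall>X\<in>\<E>. x \<in> X \<longrightarrow> g x = 0"
  proof (subst AE_ball_countable[OF E(1)], rule ballI)
    fix X assume "X \<in> \<E>"
    then obtain a b where "X = box a b" "cbox a b \<subseteq> \<Omega>" using E(2) by auto
    then show "AE x in lebesgue. x \<in> X \<longrightarrow> g x = 0" using boxAE by simp
  qed
  then have "AE x in lebesgue. x \<in> \<Omega> \<longrightarrow> g x = 0"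
    by eventually_elim (use E(3) in auto)
  then show ?thesis using op by (subst AE_restrict_space_iff) auto
qed


text \<open>The difference of the two candidates is orthogonal to all test functions. Splitting its
  integral requires \<open>v * \<phi>\<close> to be integrable, and local integrability gives this
  because \<phi> has compact support.\<close>

lemma weak_partial_unique:
  assumes op: "open \<Omega>" and v: "is_weak_partial \<Omega> i w v" and v': "is_weak_partial \<Omega> i w v'"
  shows "AE x in lebesgue_on \<Omega>. v x = v' x"
proof -
  have "AE x in lebesgue_on \<Omega>. v x - v' x = 0"
  proof (rule fundamental_lemma[OF op])
    show "locally_integrable \<Omega> (\<lambda>x. v x - v' x)"
      using v v' by (auto simp: is_weak_partial_def locally_integrable_def)
    fix \<phi> assume \<phi>: "\<phi> \<in> test_functions \<Omega>"
    let ?K = "closure {x. \<phi> x \<noteq> 0}"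
    have i: "integrable (lebesgue_on \<Omega>) (\<lambda>x. v x * \<phi> x)" if "locally_integrable \<Omega> v" for v
    proof -
      have "integrable (lebesgue_on ?K) v"
        using that test_functionsD(5,6)[OF \<phi>] by (auto simp: locally_integrable_def)
      then have i: "integrable lebesgue (\<lambda>x. indicator ?K x *\<^sub>R v x)"
        by (subst (asm) integrable_restrict_space) auto
      obtain B where B: "\<And>x. \<bar>\<phi> x\<bar> \<le> B" using test_functions_bounded[OF \<phi>] by auto
      have "integrable lebesgue (\<lambda>x. (indicator ?K x *\<^sub>R v x) * \<phi> x)"
      proof (rule Bochner_Integration.integrable_bound[where f = "\<lambda>x. B * (indicator ?K x *\<^sub>R v x)"])
        show "integrable lebesgue (\<lambda>x. B * (indicator ?K x *\<^sub>R v x))" using i by (rule integrable_mult_right)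
        show "(\<lambda>x. (indicator ?K x *\<^sub>R v x) * \<phi> x) \<in> borel_measurable lebesgue"
          using i test_functionsD(3)[OF \<phi>]
          by (intro borel_measurable_times) (auto intro!: measurable_completion borel_measurable_continuous_onI)
        show "AE x in lebesgue. norm ((indicator ?K x *\<^sub>R v x) * \<phi> x) \<le> norm (B * (indicator ?K x *\<^sub>R v x))"
        proof (rule AE_I2)
          fix x
          have "\<bar>v x\<bar> * \<bar>\<phi> x\<bar> \<le> \<bar>v x\<bar> * \<bar>B\<bar>" using B[of x] by (intro mult_left_mono) auto
          then show "norm ((indicator ?K x *\<^sub>R v x) * \<phi> x) \<le> norm (B * (indicator ?K x *\<^sub>R v x))"
            by (auto simp: indicator_def abs_mult mult.commute)
        qed
      qed
      moreover have "(\<lambda>x. (indicator ?K x *\<^sub>R v x) * \<phi> x) = (\<lambda>x. indicator \<Omega> x *\<^sub>R (v x * \<phi> x))"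
      proof
        fix x
        show "(indicator ?K x *\<^sub>R v x) * \<phi> x = indicator \<Omega> x *\<^sub>R (v x * \<phi> x)"
        proof (cases "x \<in> ?K")
          case True
          with test_functionsD(6)[OF \<phi>] have "x \<in> \<Omega>" by (rule subsetD)
          with True show ?thesis by (simp add: indicator_def)
        next
          case False
          then show ?thesis using test_functions_zero_outside(1)[OF \<phi> False] by simp
        qed
      qed
      ultimately show ?thesis using op by (subst integrable_restrict_space) auto
    qed
    have "(\<integral>x. (v x - v' x) * \<phi> x \<partial>lebesgue_on \<Omega>) = (\<integral>x. v x * \<phi> x \<partial>lebesgue_on \<Omega>) - (\<integral>x. v' x * \<phi> x \<partial>lebesgue_on \<Omega>)"
      using i[of v] i[of v'] v v' unfolding is_weak_partial_def left_diff_distrib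
      by (intro Bochner_Integration.integral_diff) auto
    also have "\<dots> = 0" using v v' \<phi> unfolding is_weak_partial_def by force
    finally show "(\<integral>x. (v x - v' x) * \<phi> x \<partial>lebesgue_on \<Omega>) = 0" .
  qed
  then show ?thesis by simp
qed

text \<open>Makes the choice in \<open>weak_partial\<close> harmless: a weak derivative found by
  hand agrees with the chosen one almost everywhere.\<close>

lemma weak_partial_AE_eq:
  assumes "open \<Omega>" "is_weak_partial \<Omega> i w v"
  shows "is_weak_partial \<Omega> i w (weak_partial \<Omega> i w)" "AE x in lebesgue_on \<Omega>. weak_partial \<Omega> i w x = v x"
proof -
  show *: "is_weak_partial \<Omega> i w (weak_partial \<Omega> i w)"
    unfolding weak_partial_def by (rule someI[of "is_weak_partial \<Omega> i w", OF assms(2)])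
  show "AE x in lebesgue_on \<Omega>. weak_partial \<Omega> i w x = v x"
    by (rule weak_partial_unique[OF assms(1) * assms(2)])
qed

text \<open>Both functions are Borel and integrable on the whole space, but only their values in \<open>\<Omega>\<close> matter.\<close>

definition weak_deriv :: "(real^'n::finite) set \<Rightarrow> 'n \<Rightarrow> (real^'n \<Rightarrow> real) \<Rightarrow> (real^'n \<Rightarrow> real) \<Rightarrow> bool" where
  "weak_deriv \<Omega> j U V \<longleftrightarrow> integrable lborel U \<and> integrable lborel V \<and>
    (\<forall>\<phi>\<in>test_functions \<Omega>. (\<integral>x. U x * partial j \<phi> x \<partial>lborel) = - (\<integral>x. V x * \<phi> x \<partial>lborel))"

text \<open>Bridge from the completed measure on \<Omega> to \<open>lborel\<close>, where
  translation invariance and Fubini are used.\<close>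

lemma integral_lebesgue_on_supported:
  fixes g :: "real^'n::finite \<Rightarrow> real"
  assumes "open \<Omega>" "g \<in> borel_measurable borel" "\<And>x. x \<notin> \<Omega> \<Longrightarrow> g x = 0"
  shows "(\<integral>x. g x \<partial>lebesgue_on \<Omega>) = (\<integral>x. g x \<partial>lborel)"
proof -
  have "(\<integral>x. g x \<partial>lebesgue_on \<Omega>) = (\<integral>x. indicator \<Omega> x *\<^sub>R g x \<partial>lebesgue)"
    using assms(1) by (intro integral_restrict_space) auto
  also have "(\<lambda>x. indicator \<Omega> x *\<^sub>R g x) = g" using assms(3) by (auto simp: indicator_def fun_eq_iff)
  also have "(\<integral>x. g x \<partial>lebesgue) = (\<integral>x. g x \<partial>lborel)" using assms(2) by (intro integral_completion) auto
  finally show ?thesis .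
qed

lemma integrable_lborel_imp_lebesgue_on:
  fixes g :: "real^'n::finite \<Rightarrow> real"
  assumes "S \<in> sets lebesgue" "integrable lborel g"
  shows "integrable (lebesgue_on S) g"
proof -
  have "integrable lebesgue g" using assms(2) by (subst integrable_completion) auto
  then have "integrable lebesgue (\<lambda>x. indicator S x *\<^sub>R g x)" by (rule integrable_mult_indicator[OF assms(1)])
  then show ?thesis using assms(1) by (subst integrable_restrict_space) auto
qed

lemma test_functions_measurable:
  assumes "\<phi> \<in> test_functions \<Omega>"
  shows "\<phi> \<in> borel_measurable borel" "partial i \<phi> \<in> borel_measurable borel"
  using test_functionsD(3,4)[OF assms] by (auto intro!: borel_measurable_continuous_onI)

lemma weak_deriv_imp_is_weak_partial:
  assumes op: "open \<Omega>" and w: "weak_deriv \<Omega> j U V"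
  shows "is_weak_partial \<Omega> j U V"
proof -
  have m: "U \<in> borel_measurable borel" "V \<in> borel_measurable borel" using w by (auto simp: weak_deriv_def)
  have "(\<integral>x. U x * partial j \<phi> x \<partial>lebesgue_on \<Omega>) = - (\<integral>x. V x * \<phi> x \<partial>lebesgue_on \<Omega>)"
    if \<phi>: "\<phi> \<in> test_functions \<Omega>" for \<phi>
  proof -
    have z: "\<phi> x = 0" "partial j \<phi> x = 0" if "x \<notin> \<Omega>" for x
      using test_functions_zero_outside(1)[OF \<phi>, of x] test_functions_zero_outside(2)[OF \<phi>, of x]
        that test_functionsD(6)[OF \<phi>] by (meson subsetD)+
    show ?thesis
      using w \<phi> m test_functions_measurable(1)[OF \<phi>] test_functions_measurable(2)[OF \<phi>, of j] z unfolding weak_deriv_def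
      by (subst (1 2) integral_lebesgue_on_supported[OF op]) auto
  qed
  moreover have "locally_integrable \<Omega> U" "locally_integrable \<Omega> V"
    using w by (auto simp: weak_deriv_def locally_integrable_def intro!: integrable_lborel_imp_lebesgue_on lmeasurable_compact fmeasurableD)
  ultimately show ?thesis by (simp add: is_weak_partial_def)
qed

lemma weak_deriv_imp_W11:
  assumes op: "open \<Omega>" and w: "\<And>j. weak_deriv \<Omega> j W (Z j)"
  shows "W \<in> W11 \<Omega>" "AE x in lebesgue_on \<Omega>. weak_partial \<Omega> j W x = Z j x"
proof -
  note wp = weak_deriv_imp_is_weak_partial[OF op w]
  show ae: "AE x in lebesgue_on \<Omega>. weak_partial \<Omega> j W x = Z j x" for j
    by (rule weak_partial_AE_eq(2)[OF op wp])
  have "integrable (lebesgue_on \<Omega>) (weak_partial \<Omega> j W)" for j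
  proof -
    have iZ: "integrable (lebesgue_on \<Omega>) (Z j)"
      using w[of j] op by (auto simp: weak_deriv_def intro!: integrable_lborel_imp_lebesgue_on)
    \<comment> \<open>The chosen derivative is known only up to a null set; completeness of Lebesgue
      measure carries measurability over from \<open>Z j\<close>.\<close>
    have "(\<lambda>x. indicator \<Omega> x *\<^sub>R weak_partial \<Omega> j W x) \<in> borel_measurable lebesgue"
    proof (rule borel_measurable_AE[of "\<lambda>x. indicator \<Omega> x *\<^sub>R Z j x"])
      have "integrable lebesgue (\<lambda>x. indicator \<Omega> x *\<^sub>R Z j x)"
        using iZ op by (subst (asm) integrable_restrict_space) auto
      then show "(\<lambda>x. indicator \<Omega> x *\<^sub>R Z j x) \<in> borel_measurable lebesgue" by auto
      have "AE x in lebesgue. x \<in> \<Omega> \<longrightarrow> weak_partial \<Omega> j W x = Z j x"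
        using ae[of j] op by (subst (asm) AE_restrict_space_iff) auto
      then show "AE x in lebesgue. indicator \<Omega> x *\<^sub>R Z j x = indicator \<Omega> x *\<^sub>R weak_partial \<Omega> j W x"
        by eventually_elim (auto simp: indicator_def)
    qed
    then have "weak_partial \<Omega> j W \<in> borel_measurable (lebesgue_on \<Omega>)"
      using op by (subst borel_measurable_restrict_space_iff) auto
    then show ?thesis
      using ae[of j] by (intro integrable_cong_AE_imp[OF iZ]) (auto elim: eventually_mono)
  qed
  moreover have "integrable (lebesgue_on \<Omega>) W"
    using w[of undefined] op by (auto simp: weak_deriv_def intro!: integrable_lborel_imp_lebesgue_on)
  ultimately show "W \<in> W11 \<Omega>"
    using wp by (auto simp: W11_def)
qed

lemma lebesgue_on_borel_representative:
  fixes g :: "real^'n::finite \<Rightarrow> real"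
  assumes op: "open \<Omega>" and g: "integrable (lebesgue_on \<Omega>) g"
  obtains g' where "integrable lborel g'" "AE x in lebesgue_on \<Omega>. g x = g' x"
proof -
  have i: "integrable lebesgue (\<lambda>x. indicator \<Omega> x *\<^sub>R g x)"
    using g op by (subst (asm) integrable_restrict_space) auto
  then obtain g' where g': "g' \<in> borel_measurable lborel" "AE x in lborel. indicator \<Omega> x *\<^sub>R g x = g' x"
    using completion_ex_borel_measurable_real[of "\<lambda>x. indicator \<Omega> x *\<^sub>R g x" lborel] by auto
  have ae: "AE x in lebesgue. indicator \<Omega> x *\<^sub>R g x = g' x" using g'(2) by (rule AE_completion)
  have "integrable lebesgue g'"
    using ae g'(1) by (intro integrable_cong_AE_imp[OF i]) (auto intro: measurable_completion)
  then have "integrable lborel g'" using g'(1) by (simp add: integrable_completion)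
  moreover have "AE x in lebesgue_on \<Omega>. g x = g' x"
    using ae op by (subst AE_restrict_space_iff) (auto elim!: eventually_mono simp: indicator_def)
  ultimately show ?thesis by (rule that)
qed

lemma is_weak_partial_imp_weak_deriv:
  assumes op: "open \<Omega>" and wp: "is_weak_partial \<Omega> j u v"
    and U: "integrable lborel U" "AE x in lebesgue_on \<Omega>. u x = U x"
    and V: "integrable lborel V" "AE x in lebesgue_on \<Omega>. v x = V x"
    and m: "integrable (lebesgue_on \<Omega>) u" "integrable (lebesgue_on \<Omega>) v"
  shows "weak_deriv \<Omega> j U V"
proof -
  have "(\<integral>x. U x * partial j \<phi> x \<partial>lborel) = - (\<integral>x. V x * \<phi> x \<partial>lborel)" if \<phi>: "\<phi> \<in> test_functions \<Omega>" for \<phi>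
  proof -
    have z: "\<phi> x = 0" "partial j \<phi> x = 0" if "x \<notin> \<Omega>" for x
      using test_functions_zero_outside(1)[OF \<phi>, of x] test_functions_zero_outside(2)[OF \<phi>, of x]
        that test_functionsD(6)[OF \<phi>] by (meson subsetD)+
    have mm: "h \<in> borel_measurable (lebesgue_on \<Omega>)" if "h \<in> borel_measurable borel" for h :: "real^'a \<Rightarrow> real"
      using that by (intro measurable_restrict_space1 measurable_completion) auto
    have mu: "u \<in> borel_measurable (lebesgue_on \<Omega>)" "v \<in> borel_measurable (lebesgue_on \<Omega>)" using m by auto
    note ms = test_functions_measurable(1)[OF \<phi>] test_functions_measurable(2)[OF \<phi>, of j] borel_measurable_integrable[OF U(1)] borel_measurable_integrable[OF V(1)]
    have "(\<integral>x. U x * partial j \<phi> x \<partial>lborel) = (\<integral>x. U x * partial j \<phi> x \<partial>lebesgue_on \<Omega>)"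
      using z ms by (intro integral_lebesgue_on_supported[OF op, symmetric]) auto
    also have "\<dots> = (\<integral>x. u x * partial j \<phi> x \<partial>lebesgue_on \<Omega>)"
      using U(2) by (intro integral_cong_AE borel_measurable_times mm mu ms) (auto simp: ms[simplified])
    also have "\<dots> = - (\<integral>x. v x * \<phi> x \<partial>lebesgue_on \<Omega>)"
      using wp \<phi> by (auto simp: is_weak_partial_def)
    also have "(\<integral>x. v x * \<phi> x \<partial>lebesgue_on \<Omega>) = (\<integral>x. V x * \<phi> x \<partial>lebesgue_on \<Omega>)"
      using V(2) by (intro integral_cong_AE borel_measurable_times mm mu ms) (auto simp: ms[simplified])
    also have "\<dots> = (\<integral>x. V x * \<phi> x \<partial>lborel)"
      using z ms by (intro integral_lebesgue_on_supported[OF op]) auto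
    finally show ?thesis .
  qed
  with U V show ?thesis by (simp add: weak_deriv_def)
qed


section \<open>Minimality in terms of Borel representatives\<close>

lemma energy_eq_nn_integral:
  assumes op: "open \<Omega>" and f: "\<And>j. continuous_on UNIV (f j)"
    and Z: "\<And>j. integrable lborel (Z j)" "\<And>j. AE x in lebesgue_on \<Omega>. weak_partial \<Omega> j w x = Z j x"
  shows "energy (split_density f) \<Omega> w = (\<integral>\<^sup>+x\<in>\<Omega>. ennreal (\<Sum>j\<in>UNIV. f j (Z j x)) \<partial>lborel)"
proof -
  have "AE x in lebesgue_on \<Omega>. \<forall>j\<in>UNIV. weak_partial \<Omega> j w x = Z j x"
    using Z(2) by (intro AE_finite_allI) auto
  then have "energy (split_density f) \<Omega> w = (\<integral>\<^sup>+x. ennreal (\<Sum>j\<in>UNIV. f j (Z j x)) \<partial>lebesgue_on \<Omega>)"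
    unfolding energy_def split_density_def weak_gradient_def
    by (intro nn_integral_cong_AE) (auto elim!: eventually_mono)
  also have "\<dots> = (\<integral>\<^sup>+x\<in>\<Omega>. ennreal (\<Sum>j\<in>UNIV. f j (Z j x)) \<partial>lebesgue)"
    using op by (intro nn_integral_restrict_space) auto
  also have "\<dots> = (\<integral>\<^sup>+x\<in>\<Omega>. ennreal (\<Sum>j\<in>UNIV. f j (Z j x)) \<partial>lborel)"
    by (rule nn_integral_completion)
  finally show ?thesis .
qed

lemma ess_support_subset:
  assumes K: "closed K" and eq: "AE x in lebesgue_on \<Omega>. x \<notin> K \<longrightarrow> g x = 0" and op: "open \<Omega>"
  shows "ess_support \<Omega> g \<subseteq> K"
proof (rule subsetI, rule ccontr)
  fix x assume x: "x \<in> ess_support \<Omega> g" "x \<notin> K"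
  then obtain e where e: "e > 0" "ball x e \<inter> K = {}"
    using K by (metis ComplI disjoint_eq_subset_Compl open_Compl open_contains_ball)
  have "AE y in lebesgue. y \<in> \<Omega> \<longrightarrow> y \<notin> K \<longrightarrow> g y = 0"
    using eq op by (subst (asm) AE_restrict_space_iff) auto
  then have "AE y in lebesgue. y \<in> \<Omega> \<inter> ball x e \<longrightarrow> g y = 0"
    by eventually_elim (use e in auto)
  then have "AE y in lebesgue_on (\<Omega> \<inter> ball x e). g y = 0"
    using op by (subst AE_restrict_space_iff) auto
  with x e show False by (auto simp: ess_support_def)
qed

text \<open>Puts minimality into the form used from here on: competitors are Borel functions that
  differ from \<open>U\<close> only inside a compact \<open>K\<close>. The essential support ignores
  the null set where \<open>u\<close> and \<open>U\<close> differ, so it stays inside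
  \<open>K\<close>.\<close>

lemma local_minimizer_compare:
  assumes op: "open \<Omega>" and f: "\<And>j. continuous_on UNIV (f j)"
    and min: "local_minimizer (split_density f) \<Omega> u"
    and U: "AE x in lebesgue_on \<Omega>. u x = U x"
    and V: "\<And>j. integrable lborel (V j)" "\<And>j. AE x in lebesgue_on \<Omega>. weak_partial \<Omega> j u x = V j x"
    and W: "\<And>j. weak_deriv \<Omega> j W (Z j)" "compact K" "K \<subseteq> \<Omega>" "\<And>x. x \<notin> K \<Longrightarrow> W x = U x"
    and fin: "(\<integral>\<^sup>+x\<in>\<Omega>. ennreal (\<Sum>j\<in>UNIV. f j (Z j x)) \<partial>lborel) < \<infinity>"
  shows "(\<integral>\<^sup>+x\<in>\<Omega>. ennreal (\<Sum>j\<in>UNIV. f j (V j x)) \<partial>lborel) \<le> (\<integral>\<^sup>+x\<in>\<Omega>. ennreal (\<Sum>j\<in>UNIV. f j (Z j x)) \<partial>lborel)"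
proof -
  have Z: "\<And>j. integrable lborel (Z j)" using W(1) by (simp add: weak_deriv_def)
  have eW: "energy (split_density f) \<Omega> W = (\<integral>\<^sup>+x\<in>\<Omega>. ennreal (\<Sum>j\<in>UNIV. f j (Z j x)) \<partial>lborel)"
    by (rule energy_eq_nn_integral[OF op f Z weak_deriv_imp_W11(2)[OF op W(1)]])
  have eu: "energy (split_density f) \<Omega> u = (\<integral>\<^sup>+x\<in>\<Omega>. ennreal (\<Sum>j\<in>UNIV. f j (V j x)) \<partial>lborel)"
    by (rule energy_eq_nn_integral[OF op f V])
  have "W \<in> energy_class (split_density f) \<Omega>"
    using weak_deriv_imp_W11(1)[OF op W(1)] eW fin by (simp add: energy_class_def)
  moreover have "compactly_contained (ess_support \<Omega> (\<lambda>x. u x - W x)) \<Omega>"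
  proof -
    have "ess_support \<Omega> (\<lambda>x. u x - W x) \<subseteq> K"
      using W(2) U by (intro ess_support_subset op) (auto intro: compact_imp_closed elim!: eventually_mono simp: W(4))
    then have c: "closure (ess_support \<Omega> (\<lambda>x. u x - W x)) \<subseteq> K"
      using W(2) by (intro closure_minimal compact_imp_closed)
    then have "compact (closure (ess_support \<Omega> (\<lambda>x. u x - W x)))"
      using closed_Int_compact[OF closed_closure W(2), of "ess_support \<Omega> (\<lambda>x. u x - W x)"] by (simp add: Int_absorb2)
    with c W(3) show ?thesis by (auto simp: compactly_contained_def)
  qed
  ultimately show ?thesis using min eW eu unfolding local_minimizer_def by auto
qed

section \<open>Competitors and the difference inequality\<close>

lemma nn_integral_lborel_shift:
  fixes g :: "'a::euclidean_space \<Rightarrow> ennreal"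
  assumes "g \<in> borel_measurable borel"
  shows "(\<integral>\<^sup>+x. g (x + a) \<partial>lborel) = (\<integral>\<^sup>+x. g x \<partial>lborel)"
  using assms nn_integral_distr[of "(+) a" lborel borel g] by (simp add: lborel_distr_plus add.commute)

lemma integrable_lborel_shift_iff:
  fixes g :: "'a::euclidean_space \<Rightarrow> real"
  assumes "g \<in> borel_measurable borel"
  shows "integrable lborel (\<lambda>x. g (x + a)) \<longleftrightarrow> integrable lborel g"
  using assms integrable_distr_eq[of "(+) a" lborel borel g] by (simp add: lborel_distr_plus add.commute)

lemma integral_lborel_shift:
  fixes g :: "'a::euclidean_space \<Rightarrow> real"
  assumes "g \<in> borel_measurable borel"
  shows "(\<integral>x. g (x + a) \<partial>lborel) = (\<integral>x. g x \<partial>lborel)"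
  using assms integral_distr[of "(+) a" lborel borel g] by (simp add: lborel_distr_plus add.commute)

lemma integrable_mult_bounded:
  fixes U g :: "'a::euclidean_space \<Rightarrow> real"
  assumes "integrable lborel U" "g \<in> borel_measurable borel" "\<And>x. \<bar>g x\<bar> \<le> B"
  shows "integrable lborel (\<lambda>x. U x * g x)" "integrable lborel (\<lambda>x. g x * U x)"
proof -
  show "integrable lborel (\<lambda>x. U x * g x)"
  proof (rule Bochner_Integration.integrable_bound[OF integrable_mult_right[OF assms(1), of B]])
    show "AE x in lborel. norm (U x * g x) \<le> norm (B * U x)"
    proof (rule AE_I2)
      fix x
      have "\<bar>U x\<bar> * \<bar>g x\<bar> \<le> \<bar>U x\<bar> * \<bar>B\<bar>" using assms(3)[of x] by (intro mult_left_mono) auto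
      then show "norm (U x * g x) \<le> norm (B * U x)" by (simp add: abs_mult mult.commute)
    qed
  qed (use assms in auto)
  then show "integrable lborel (\<lambda>x. g x * U x)" by (simp add: mult.commute)
qed

text \<open>Product rule and translation in one step: the weak derivative of \<open>U\<close> is
  tested with \<open>\<zeta> * \<phi>\<close> translated back by \<open>a\<close>. Only the support
  of \<zeta> has to be moved into \<Omega>, so the translate of \<open>U\<close> may be used near
  the boundary as long as it is cut off.\<close>

lemma weak_deriv_mult_shift:
  assumes w: "weak_deriv \<Omega> j U V" and \<zeta>: "\<zeta> \<in> test_functions \<Omega>"
    and a: "\<And>x. x \<in> closure {x. \<zeta> x \<noteq> 0} \<Longrightarrow> x + a \<in> \<Omega>"
  shows "weak_deriv \<Omega> j (\<lambda>x. \<zeta> x * U (x + a)) (\<lambda>x. \<zeta> x * V (x + a) + partial j \<zeta> x * U (x + a))"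
proof -
  have iU: "integrable lborel U" and iV: "integrable lborel V" using w by (auto simp: weak_deriv_def)
  then have mU[measurable]: "U \<in> borel_measurable borel" and mV[measurable]: "V \<in> borel_measurable borel" by auto
  have iUa: "integrable lborel (\<lambda>x. U (x + a))" and iVa: "integrable lborel (\<lambda>x. V (x + a))"
    using iU iV by (simp_all add: integrable_lborel_shift_iff)
  obtain B where B: "\<And>x. \<bar>\<zeta> x\<bar> \<le> B" "\<And>x. \<bar>partial j \<zeta> x\<bar> \<le> B"
    using test_functions_bounded[OF \<zeta>] by blast
  have m\<zeta>[measurable]: "\<zeta> \<in> borel_measurable borel" "partial j \<zeta> \<in> borel_measurable borel"
    by (rule test_functions_measurable[OF \<zeta>])+
  have "(\<integral>x. \<zeta> x * U (x + a) * partial j \<phi> x \<partial>lborel) =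
      - (\<integral>x. (\<zeta> x * V (x + a) + partial j \<zeta> x * U (x + a)) * \<phi> x \<partial>lborel)"
    if \<phi>: "\<phi> \<in> test_functions \<Omega>" for \<phi>
  proof -
    obtain B' where B': "\<And>x. \<bar>\<phi> x\<bar> \<le> B'" "\<And>x. \<bar>partial j \<phi> x\<bar> \<le> B'"
      using test_functions_bounded[OF \<phi>] by blast
    have m\<phi>[measurable]: "\<phi> \<in> borel_measurable borel" "partial j \<phi> \<in> borel_measurable borel"
      by (rule test_functions_measurable[OF \<phi>])+
    define \<psi> where "\<psi> = (\<lambda>x. \<zeta> x * \<phi> x)"
    have \<psi>: "\<psi> \<in> test_functions \<Omega>"
      unfolding \<psi>_def by (rule test_functions_mult[OF \<zeta> test_functionsD(1)[OF \<phi>]])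
    have m\<psi>[measurable]: "\<psi> \<in> borel_measurable borel" "partial j \<psi> \<in> borel_measurable borel"
      by (rule test_functions_measurable[OF \<psi>])+
    obtain B'' where B'': "\<And>x. \<bar>\<psi> x\<bar> \<le> B''" "\<And>x. \<bar>partial j \<psi> x\<bar> \<le> B''"
      using test_functions_bounded[OF \<psi>] by blast
    have p\<psi>: "partial j \<psi> x = \<zeta> x * partial j \<phi> x + partial j \<zeta> x * \<phi> x" for x
      unfolding \<psi>_def by (rule partial_mult[OF test_functionsD(2)[OF \<zeta>] test_functionsD(2)[OF \<phi>]])
    have "closure {x. \<psi> x \<noteq> 0} \<subseteq> closure {x. \<zeta> x \<noteq> 0}"
      by (rule closure_mono) (auto simp: \<psi>_def)
    then have \<psi>': "(\<lambda>x. \<psi> (x + - a)) \<in> test_functions \<Omega>"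
      using a by (intro test_functions_shift[OF \<psi>]) auto
    have "(\<integral>x. U (x + a) * partial j \<psi> x \<partial>lborel) = (\<integral>x. U x * partial j \<psi> (x + - a) \<partial>lborel)"
      using integral_lborel_shift[of "\<lambda>x. U x * partial j \<psi> (x + - a)" a] by simp
    also have "\<dots> = (\<integral>x. U x * partial j (\<lambda>x. \<psi> (x + - a)) x \<partial>lborel)"
      by (simp only: partial_shift[OF test_functionsD(2)[OF \<psi>]])
    also have "\<dots> = - (\<integral>x. V x * \<psi> (x + - a) \<partial>lborel)"
      using w \<psi>' by (auto simp: weak_deriv_def)
    also have "(\<integral>x. V x * \<psi> (x + - a) \<partial>lborel) = (\<integral>x. V (x + a) * \<psi> x \<partial>lborel)"
      using integral_lborel_shift[of "\<lambda>x. V x * \<psi> (x + - a)" a] by simp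
    finally have main: "(\<integral>x. U (x + a) * partial j \<psi> x \<partial>lborel) = - (\<integral>x. V (x + a) * \<psi> x \<partial>lborel)" .
    have i1: "integrable lborel (\<lambda>x. U (x + a) * partial j \<psi> x)"
      by (rule integrable_mult_bounded[OF iUa m\<psi>(2) B''(2)])
    have i2: "integrable lborel (\<lambda>x. U (x + a) * (partial j \<zeta> x * \<phi> x))"
    proof (rule integrable_mult_bounded(1)[OF iUa])
      show "\<bar>partial j \<zeta> x * \<phi> x\<bar> \<le> B * B'" for x
        using B(2)[of x] B'(1)[of x] by (simp add: abs_mult mult_mono')
    qed measurable
    have i3: "integrable lborel (\<lambda>x. V (x + a) * \<psi> x)"
      by (rule integrable_mult_bounded[OF iVa m\<psi>(1) B''(1)])
    have "(\<integral>x. \<zeta> x * U (x + a) * partial j \<phi> x \<partial>lborel) =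
        (\<integral>x. U (x + a) * partial j \<psi> x - U (x + a) * (partial j \<zeta> x * \<phi> x) \<partial>lborel)"
      by (simp add: p\<psi> algebra_simps)
    also have "\<dots> = (\<integral>x. U (x + a) * partial j \<psi> x \<partial>lborel) - (\<integral>x. U (x + a) * (partial j \<zeta> x * \<phi> x) \<partial>lborel)"
      by (rule Bochner_Integration.integral_diff[OF i1 i2])
    also have "\<dots> = - ((\<integral>x. V (x + a) * \<psi> x \<partial>lborel) + (\<integral>x. U (x + a) * (partial j \<zeta> x * \<phi> x) \<partial>lborel))"
      by (simp add: main)
    also have "(\<integral>x. V (x + a) * \<psi> x \<partial>lborel) + (\<integral>x. U (x + a) * (partial j \<zeta> x * \<phi> x) \<partial>lborel) =
        (\<integral>x. V (x + a) * \<psi> x + U (x + a) * (partial j \<zeta> x * \<phi> x) \<partial>lborel)"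
      by (rule Bochner_Integration.integral_add[OF i3 i2, symmetric])
    also have "\<dots> = (\<integral>x. (\<zeta> x * V (x + a) + partial j \<zeta> x * U (x + a)) * \<phi> x \<partial>lborel)"
      by (simp add: \<psi>_def algebra_simps)
    finally show ?thesis .
  qed
  moreover have "integrable lborel (\<lambda>x. \<zeta> x * U (x + a))" "integrable lborel (\<lambda>x. \<zeta> x * V (x + a))"
    "integrable lborel (\<lambda>x. partial j \<zeta> x * U (x + a))"
    by (rule integrable_mult_bounded[OF iUa m\<zeta>(1) B(1)] integrable_mult_bounded[OF iVa m\<zeta>(1) B(1)]
        integrable_mult_bounded[OF iUa m\<zeta>(2) B(2)])+
  ultimately show ?thesis by (simp add: weak_deriv_def)
qed

lemma weak_deriv_lincomb:
  assumes "weak_deriv \<Omega> j U V" "weak_deriv \<Omega> j U' V'"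
  shows "weak_deriv \<Omega> j (\<lambda>x. U x + c * U' x) (\<lambda>x. V x + c * V' x)"
proof -
  have i: "integrable lborel U" "integrable lborel V" "integrable lborel U'" "integrable lborel V'"
    using assms by (auto simp: weak_deriv_def)
  have "(\<integral>x. (U x + c * U' x) * partial j \<phi> x \<partial>lborel) = - (\<integral>x. (V x + c * V' x) * \<phi> x \<partial>lborel)"
    if \<phi>: "\<phi> \<in> test_functions \<Omega>" for \<phi>
  proof -
    obtain B where B: "\<And>x. \<bar>\<phi> x\<bar> \<le> B" "\<And>x. \<bar>partial j \<phi> x\<bar> \<le> B"
      using test_functions_bounded[OF \<phi>] by blast
    note m = test_functions_measurable[OF \<phi>]
    have "(\<integral>x. (U x + c * U' x) * partial j \<phi> x \<partial>lborel) = (\<integral>x. U x * partial j \<phi> x + c * (U' x * partial j \<phi> x) \<partial>lborel)"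
      by (simp add: algebra_simps)
    also have "\<dots> = (\<integral>x. U x * partial j \<phi> x \<partial>lborel) + c * (\<integral>x. U' x * partial j \<phi> x \<partial>lborel)"
      using integrable_mult_bounded(1)[OF i(1) m(2) B(2)] integrable_mult_bounded(1)[OF i(3) m(2) B(2)] by simp
    also have "\<dots> = - (\<integral>x. V x * \<phi> x \<partial>lborel) - c * (\<integral>x. V' x * \<phi> x \<partial>lborel)"
      using assms \<phi> by (simp add: weak_deriv_def)
    also have "\<dots> = - (\<integral>x. V x * \<phi> x + c * (V' x * \<phi> x) \<partial>lborel)"
      using integrable_mult_bounded(1)[OF i(2) m(1) B(1)] integrable_mult_bounded(1)[OF i(4) m(1) B(1)] by simp
    also have "\<dots> = - (\<integral>x. (V x + c * V' x) * \<phi> x \<partial>lborel)"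
      by (simp add: algebra_simps)
    finally show ?thesis .
  qed
  with i show ?thesis by (simp add: weak_deriv_def)
qed

lemma weak_deriv_competitor:
  assumes w: "weak_deriv \<Omega> j U V" and \<zeta>: "\<zeta> \<in> test_functions \<Omega>"
    and a: "\<And>x. x \<in> closure {x. \<zeta> x \<noteq> 0} \<Longrightarrow> x + a \<in> \<Omega>"
  shows "weak_deriv \<Omega> j (\<lambda>x. U x + \<tau> * (\<zeta> x * (U (x + a) - U x)))
    (\<lambda>x. V x + \<tau> * (\<zeta> x * (V (x + a) - V x) + partial j \<zeta> x * (U (x + a) - U x)))"
proof -
  have "weak_deriv \<Omega> j (\<lambda>x. \<zeta> x * U (x + 0)) (\<lambda>x. \<zeta> x * V (x + 0) + partial j \<zeta> x * U (x + 0))"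
    using test_functionsD(6)[OF \<zeta>] by (intro weak_deriv_mult_shift[OF w \<zeta>]) auto
  from weak_deriv_lincomb[OF weak_deriv_lincomb[OF w weak_deriv_mult_shift[OF w \<zeta> a], of \<tau>] this, of "- \<tau>"]
  show ?thesis by (simp add: algebra_simps)
qed

text \<open>\<open>f_perturb\<close> has the shape of a competitor's gradient: a convex combination
  of a derivative and its translate, plus an error bounded by \<open>2 * M\<close> times a bound for
  the gradient of the cutoff. It is what makes the energies of the competitors finite.\<close>

locale convex_densities =
  fixes f F :: "'n::finite \<Rightarrow> real \<Rightarrow> real"
  assumes f_nonneg: "\<And>j t. f j t \<ge> 0"
    and f_deriv: "\<And>j t. (f j has_real_derivative F j t) (at t)"
    and F_mono: "\<And>j s t. s \<le> t \<Longrightarrow> F j s \<le> F j t"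
    and F_cont: "\<And>j. continuous_on UNIV (F j)"
    and f_perturb: "\<And>j E. \<exists>C. \<forall>a b t e. 0 \<le> t \<longrightarrow> t \<le> 1 \<longrightarrow> \<bar>e\<bar> \<le> E \<longrightarrow>
        f j ((1 - t) * a + t * b + e) \<le> C * (1 + f j a + f j b)"
begin

lemma f_cont: "continuous_on UNIV (f j)"
  using f_deriv by (meson DERIV_isCont continuous_at_imp_continuous_on)

lemma f_measurable[measurable]: "f j \<in> borel_measurable borel"
  by (rule borel_measurable_continuous_onI[OF f_cont])

lemma F_measurable[measurable]: "F j \<in> borel_measurable borel"
  by (rule borel_measurable_continuous_onI[OF F_cont])

lemma f_convex: "convex_on UNIV (f j)"
  by (rule convex_on_realI[of UNIV "f j" "F j"]) (use f_deriv F_mono in auto)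

text \<open>Difference quotients of a convex function increase with the step; step 1 provides the
  integrable majorant for Fatou's lemma.\<close>

lemma f_quotient_le:
  assumes "0 < \<tau>" "\<tau> \<le> 1"
  shows "(f j (x + \<tau> * c) - f j x) / \<tau> \<le> f j (x + c) - f j x"
proof -
  have "f j ((1 - \<tau>) *\<^sub>R x + \<tau> *\<^sub>R (x + c)) \<le> (1 - \<tau>) * f j x + \<tau> * f j (x + c)"
    using assms by (intro convex_onD[OF f_convex]) auto
  moreover have "(1 - \<tau>) *\<^sub>R x + \<tau> *\<^sub>R (x + c) = x + \<tau> * c" by (simp add: algebra_simps)
  ultimately show ?thesis using assms by (simp add: field_simps)
qed

lemma f_quotient_tendsto: "(\<lambda>n. (f j (x + inverse (real (Suc n)) * c) - f j x) / inverse (real (Suc n))) \<longlonglongrightarrow> F j x * c"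
proof (cases "c = 0")
  case False
  have "((\<lambda>h. (f j (x + h) - f j x) / h) \<longlongrightarrow> F j x) (at 0)"
    using f_deriv[of j x] by (simp add: DERIV_def)
  moreover have "filterlim (\<lambda>n. inverse (real (Suc n)) * c) (at 0) sequentially"
    using False LIMSEQ_inverse_real_of_nat tendsto_mult_left_zero[of _ sequentially c]
    by (auto simp: filterlim_at)
  ultimately have "(\<lambda>n. (f j (x + inverse (real (Suc n)) * c) - f j x) / (inverse (real (Suc n)) * c)) \<longlonglongrightarrow> F j x"
    by (rule filterlim_compose)
  then have "(\<lambda>n. (f j (x + inverse (real (Suc n)) * c) - f j x) / (inverse (real (Suc n)) * c) * c) \<longlonglongrightarrow> F j x * c"
    by (intro tendsto_intros)
  moreover have "A / (i * c) * c = A / i" for A i :: real using False by simp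
  ultimately show ?thesis by (simp only:)
qed simp

end


text \<open>The bound on \<open>U\<close> is required at every point, not almost everywhere;
  truncating the Borel representative achieves this.\<close>

locale bounded_minimizer = convex_densities f F for f F :: "'n::finite \<Rightarrow> real \<Rightarrow> real" +
  fixes \<Omega> :: "(real^'n) set" and U :: "real^'n \<Rightarrow> real" and V :: "'n \<Rightarrow> real^'n \<Rightarrow> real" and M :: real
  assumes open_domain: "open \<Omega>"
    and weak: "\<And>j. weak_deriv \<Omega> j U (V j)"
    and U_bound: "\<And>x. \<bar>U x\<bar> \<le> M" and M_pos: "M > 0"
    and finite_energy: "(\<integral>\<^sup>+x\<in>\<Omega>. ennreal (\<Sum>j\<in>UNIV. f j (V j x)) \<partial>lborel) < \<infinity>"
    and minimal: "\<And>W Z K. (\<And>j. weak_deriv \<Omega> j W (Z j)) \<Longrightarrow> compact K \<Longrightarrow> K \<subseteq> \<Omega> \<Longrightarrow>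
      (\<And>x. x \<notin> K \<Longrightarrow> W x = U x) \<Longrightarrow>
      (\<integral>\<^sup>+x\<in>\<Omega>. ennreal (\<Sum>j\<in>UNIV. f j (Z j x)) \<partial>lborel) < \<infinity> \<Longrightarrow>
      (\<integral>\<^sup>+x\<in>\<Omega>. ennreal (\<Sum>j\<in>UNIV. f j (V j x)) \<partial>lborel) \<le> (\<integral>\<^sup>+x\<in>\<Omega>. ennreal (\<Sum>j\<in>UNIV. f j (Z j x)) \<partial>lborel)"
begin

lemma U_measurable[measurable]: "U \<in> borel_measurable borel"
  and V_measurable[measurable]: "V j \<in> borel_measurable borel"
  and V_integrable: "integrable lborel (V j)"
proof -
  have iU: "integrable lborel U" using weak[of j] by (simp add: weak_deriv_def)
  show iV: "integrable lborel (V j)" using weak[of j] by (simp add: weak_deriv_def)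
  show "U \<in> borel_measurable borel" "V j \<in> borel_measurable borel"
    using borel_measurable_integrable[OF iU] borel_measurable_integrable[OF iV] by auto
qed

lemma domain_sets[measurable]: "\<Omega> \<in> sets borel"
  using open_domain by auto

text \<open>This is the derivative in \<tau> of the j-th weak derivative of the competitor
  \<open>U x + \<tau> * (\<zeta> x * (U (x + a) - U x))\<close>.\<close>

definition variation :: "(real^'n \<Rightarrow> real) \<Rightarrow> real^'n \<Rightarrow> 'n \<Rightarrow> real^'n \<Rightarrow> real" where
  "variation \<zeta> a j x = \<zeta> x * (V j (x + a) - V j x) + partial j \<zeta> x * (U (x + a) - U x)"

lemma variation_measurable:
  assumes "\<zeta> \<in> test_functions \<Omega>"
  shows "variation \<zeta> a j \<in> borel_measurable borel"
proof -
  note [measurable] = test_functions_measurable[OF assms]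
  show ?thesis unfolding variation_def by measurable
qed

lemma variation_outside:
  assumes "\<zeta> \<in> test_functions \<Omega>" "x \<notin> closure {x. \<zeta> x \<noteq> 0}"
  shows "variation \<zeta> a j x = 0"
  using test_functions_zero_outside(1)[OF assms] test_functions_zero_outside(2)[OF assms, of j]
  by (simp add: variation_def)

lemma energy_density_integrable: "integrable lborel (\<lambda>x. indicator \<Omega> x * (\<Sum>j\<in>UNIV. f j (V j x)))"
proof (rule integrableI_nonneg)
  have "(\<integral>\<^sup>+x. ennreal (indicator \<Omega> x * (\<Sum>j\<in>UNIV. f j (V j x))) \<partial>lborel) =
      (\<integral>\<^sup>+x\<in>\<Omega>. ennreal (\<Sum>j\<in>UNIV. f j (V j x)) \<partial>lborel)"
    by (intro nn_integral_cong) (auto simp: indicator_def)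
  then show "(\<integral>\<^sup>+x. ennreal (indicator \<Omega> x * (\<Sum>j\<in>UNIV. f j (V j x))) \<partial>lborel) < \<infinity>"
    using finite_energy by simp
qed (auto intro!: sum_nonneg mult_nonneg_nonneg f_nonneg)

lemma f_V_integrable:
  assumes "K \<in> sets borel" "\<And>x. x \<in> K \<Longrightarrow> x + a \<in> \<Omega>"
  shows "integrable lborel (\<lambda>x. indicator K x * f j (V j (x + a)))"
proof (rule Bochner_Integration.integrable_bound)
  show "integrable lborel (\<lambda>x. indicator \<Omega> (x + a) * (\<Sum>j\<in>UNIV. f j (V j (x + a))))"
    using energy_density_integrable by (subst integrable_lborel_shift_iff) auto
  show "(\<lambda>x. indicator K x * f j (V j (x + a))) \<in> borel_measurable lborel"
    using assms(1) by measurable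
  show "AE x in lborel. norm (indicator K x * f j (V j (x + a))) \<le> norm (indicator \<Omega> (x + a) * (\<Sum>j\<in>UNIV. f j (V j (x + a))))"
  proof (rule AE_I2)
    fix x
    have "f j (V j (x + a)) \<le> (\<Sum>j\<in>UNIV. f j (V j (x + a)))"
      by (rule member_le_sum) (auto simp: f_nonneg)
    then show "norm (indicator K x * f j (V j (x + a))) \<le> norm (indicator \<Omega> (x + a) * (\<Sum>j\<in>UNIV. f j (V j (x + a))))"
      using assms(2)[of x] f_nonneg by (auto simp: indicator_def sum_nonneg)
  qed
qed

text \<open>Minimality compares energies in [0, infinity]. Once the competitor's energy is known to
  be finite, both energies are real integrals and may be subtracted.\<close>

lemma first_variation:
  assumes \<zeta>: "\<zeta> \<in> test_functions \<Omega>" "\<And>x. 0 \<le> \<zeta> x" "\<And>x. \<zeta> x \<le> 1"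
    and a: "\<And>x. x \<in> closure {x. \<zeta> x \<noteq> 0} \<Longrightarrow> x + a \<in> \<Omega>"
    and \<tau>: "0 \<le> \<tau>" "\<tau> \<le> 1"
  defines "g \<equiv> \<lambda>x. \<Sum>j\<in>UNIV. f j (V j x + \<tau> * variation \<zeta> a j x) - f j (V j x)"
  shows "integrable lborel g" "(\<integral>x. g x \<partial>lborel) \<ge> 0"
proof -
  let ?K = "closure {x. \<zeta> x \<noteq> 0}"
  have K: "compact ?K" "?K \<subseteq> \<Omega>" using test_functionsD[OF \<zeta>(1)] by auto
  note [measurable] = variation_measurable[OF \<zeta>(1)]
  define Z where "Z j x = V j x + \<tau> * variation \<zeta> a j x" for j x
  have [measurable]: "Z j \<in> borel_measurable borel" for j unfolding Z_def by measurable
  obtain B where B: "B > 0" "\<And>j x. \<bar>partial j \<zeta> x\<bar> \<le> B"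
    using test_functions_bounded[OF \<zeta>(1)] by blast
  obtain C where C: "\<And>j a b t e. 0 \<le> t \<Longrightarrow> t \<le> 1 \<Longrightarrow> \<bar>e\<bar> \<le> B * (2 * M) \<Longrightarrow>
      f j ((1 - t) * a + t * b + e) \<le> C j * (1 + f j a + f j b)"
    using f_perturb[where E = "B * (2 * M)"] by metis
  have bound: "f j (Z j x) \<le> C j * (1 + f j (V j x) + f j (V j (x + a)))" for j x
  proof -
    let ?e = "\<tau> * (partial j \<zeta> x * (U (x + a) - U x))"
    have "Z j x = (1 - \<tau> * \<zeta> x) * V j x + (\<tau> * \<zeta> x) * V j (x + a) + ?e"
      by (simp add: Z_def variation_def algebra_simps)
    moreover have "\<bar>?e\<bar> \<le> B * (2 * M)"
    proof -
      have "\<bar>U (x + a) - U x\<bar> \<le> 2 * M" using U_bound[of x] U_bound[of "x + a"] by linarith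
      then have "\<bar>partial j \<zeta> x\<bar> * \<bar>U (x + a) - U x\<bar> \<le> B * (2 * M)"
        using B by (intro mult_mono) auto
      moreover have "\<bar>\<tau>\<bar> * (\<bar>partial j \<zeta> x\<bar> * \<bar>U (x + a) - U x\<bar>) \<le> 1 * (\<bar>partial j \<zeta> x\<bar> * \<bar>U (x + a) - U x\<bar>)"
        using \<tau> by (intro mult_right_mono) auto
      ultimately show ?thesis by (simp add: abs_mult)
    qed
    moreover have "0 \<le> \<tau> * \<zeta> x" "\<tau> * \<zeta> x \<le> 1" using \<tau> \<zeta>(2,3)[of x] by (auto intro: mult_le_one)
    ultimately show ?thesis using C by simp
  qed
  let ?A = "\<lambda>x. indicator \<Omega> x * (\<Sum>j\<in>UNIV. f j (V j x))"
  let ?S = "\<lambda>x. indicator \<Omega> x * (\<Sum>j\<in>UNIV. f j (Z j x))"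
  let ?R = "\<lambda>x. ?A x + (\<Sum>j\<in>UNIV. \<bar>C j\<bar> * (indicator ?K x + indicator ?K x * f j (V j (x + 0)) + indicator ?K x * f j (V j (x + a))))"
  have SR: "?S x \<le> ?R x" for x
  proof (cases "x \<in> ?K")
    case True
    have "f j (Z j x) \<le> \<bar>C j\<bar> * (1 + f j (V j (x + 0)) + f j (V j (x + a)))" for j
      using bound[of j x] mult_right_mono[OF abs_ge_self[of "C j"], of "1 + f j (V j x) + f j (V j (x + a))"] f_nonneg[of j]
      by (simp add: add_nonneg_nonneg)
    then have "(\<Sum>j\<in>UNIV. f j (Z j x)) \<le> (\<Sum>j\<in>UNIV. \<bar>C j\<bar> * (1 + f j (V j (x + 0)) + f j (V j (x + a))))"
      by (rule sum_mono)
    moreover have "0 \<le> (\<Sum>j\<in>UNIV. f j (V j x))" by (intro sum_nonneg f_nonneg)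
    moreover have "x \<in> \<Omega>" using K(2) True by (rule subsetD)
    ultimately show ?thesis using True by (simp add: indicator_def)
  next
    case False
    then have "Z j x = V j x" for j using variation_outside[OF \<zeta>(1) False] by (simp add: Z_def)
    with False show ?thesis by (simp add: indicator_def)
  qed
  have iK: "integrable lborel (\<lambda>x. indicator ?K x :: real)"
    using K(1) emeasure_compact_finite[OF K(1)] by (intro integrable_real_indicator) auto
  have iR: "integrable lborel ?R"
    by (intro Bochner_Integration.integrable_add energy_density_integrable Bochner_Integration.integrable_sum
        integrable_mult_right f_V_integrable iK) (use K a in auto)
  have iS: "integrable lborel ?S"
  proof (rule Bochner_Integration.integrable_bound[OF iR])
    show "AE x in lborel. norm (?S x) \<le> norm (?R x)"
    proof (rule AE_I2)
      fix x
      have "0 \<le> ?S x" by (intro mult_nonneg_nonneg sum_nonneg f_nonneg) auto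
      with SR[of x] show "norm (?S x) \<le> norm (?R x)" by simp
    qed
  qed measurable
  have nnS: "(\<integral>\<^sup>+x\<in>\<Omega>. ennreal (\<Sum>j\<in>UNIV. f j (Z j x)) \<partial>lborel) = ennreal (\<integral>x. ?S x \<partial>lborel)"
  proof -
    have "(\<integral>\<^sup>+x\<in>\<Omega>. ennreal (\<Sum>j\<in>UNIV. f j (Z j x)) \<partial>lborel) = (\<integral>\<^sup>+x. ennreal (?S x) \<partial>lborel)"
      by (intro nn_integral_cong) (auto simp: indicator_def)
    also have "\<dots> = ennreal (\<integral>x. ?S x \<partial>lborel)"
      by (intro nn_integral_eq_integral iS AE_I2 mult_nonneg_nonneg sum_nonneg f_nonneg) auto
    finally show ?thesis .
  qed
  have nnA: "(\<integral>\<^sup>+x\<in>\<Omega>. ennreal (\<Sum>j\<in>UNIV. f j (V j x)) \<partial>lborel) = ennreal (\<integral>x. ?A x \<partial>lborel)"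
  proof -
    have "(\<integral>\<^sup>+x\<in>\<Omega>. ennreal (\<Sum>j\<in>UNIV. f j (V j x)) \<partial>lborel) = (\<integral>\<^sup>+x. ennreal (?A x) \<partial>lborel)"
      by (intro nn_integral_cong) (auto simp: indicator_def)
    also have "\<dots> = ennreal (\<integral>x. ?A x \<partial>lborel)"
      by (intro nn_integral_eq_integral energy_density_integrable AE_I2 mult_nonneg_nonneg sum_nonneg f_nonneg) auto
    finally show ?thesis .
  qed
  have "(\<integral>\<^sup>+x\<in>\<Omega>. ennreal (\<Sum>j\<in>UNIV. f j (V j x)) \<partial>lborel) \<le> (\<integral>\<^sup>+x\<in>\<Omega>. ennreal (\<Sum>j\<in>UNIV. f j (Z j x)) \<partial>lborel)"
  proof (rule minimal[OF _ K])
    show "weak_deriv \<Omega> j (\<lambda>x. U x + \<tau> * (\<zeta> x * (U (x + a) - U x))) (Z j)" for j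
      unfolding Z_def variation_def by (rule weak_deriv_competitor[OF weak \<zeta>(1) a])
    show "U x + \<tau> * (\<zeta> x * (U (x + a) - U x)) = U x" if "x \<notin> ?K" for x
      using test_functions_zero_outside(1)[OF \<zeta>(1) that] by simp
  qed (simp add: nnS)
  then have le: "(\<integral>x. ?A x \<partial>lborel) \<le> (\<integral>x. ?S x \<partial>lborel)"
    unfolding nnS nnA
    by (subst (asm) ennreal_le_iff) (auto intro!: integral_nonneg_AE AE_I2 mult_nonneg_nonneg sum_nonneg f_nonneg)
  have g: "g = (\<lambda>x. ?S x - ?A x)"
  proof
    fix x
    show "g x = ?S x - ?A x"
    proof (cases "x \<in> \<Omega>")
      case False
      then have "x \<notin> ?K" using K(2) by blast
      from variation_outside[OF \<zeta>(1) this] False show ?thesis by (simp add: g_def)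
    qed (simp add: g_def Z_def sum_subtractf)
  qed
  show "integrable lborel g" unfolding g
    by (rule Bochner_Integration.integrable_diff[OF iS energy_density_integrable])
  show "(\<integral>x. g x \<partial>lborel) \<ge> 0"
    unfolding g using le by (subst Bochner_Integration.integral_diff[OF iS energy_density_integrable]) simp
qed

text \<open>Two first variations are added before the limit: the one at \<open>U\<close> with step
  \<open>a\<close>, and the one with the translated cutoff and step \<open>- a\<close>, read at
  \<open>x + a\<close>. The summed quotients decrease as \<tau> decreases to 0 and lie below their
  value at \<tau> = 1, so Fatou's lemma yields both the integrability of the limit and the sign of
  its integral. No integrability of \<open>F j (V j x)\<close> times the variation alone is
  required.\<close>

lemma difference_equation:
  assumes \<zeta>: "\<zeta> \<in> test_functions \<Omega>" "\<And>x. 0 \<le> \<zeta> x" "\<And>x. \<zeta> x \<le> 1"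
    and a: "\<And>x. x \<in> closure {x. \<zeta> x \<noteq> 0} \<Longrightarrow> x + a \<in> \<Omega>"
  defines "I \<equiv> \<lambda>x. \<Sum>j\<in>UNIV. (F j (V j (x + a)) - F j (V j x)) * variation \<zeta> a j x"
  shows "integrable lborel I" "(\<integral>x. I x \<partial>lborel) \<le> 0"
proof -
  note [measurable] = variation_measurable[OF \<zeta>(1)]
  define \<zeta>' where "\<zeta>' = (\<lambda>x. \<zeta> (x + - a))"
  have \<zeta>': "\<zeta>' \<in> test_functions \<Omega>"
    unfolding \<zeta>'_def using a by (intro test_functions_shift[OF \<zeta>(1)]) auto
  have supp': "x - a \<in> closure {x. \<zeta> x \<noteq> 0}" if "x \<in> closure {x. \<zeta>' x \<noteq> 0}" for x
  proof -
    let ?S = "(\<lambda>x. x + a) ` closure {x. \<zeta> x \<noteq> 0}"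
    have "closed ?S"
      by (intro compact_imp_closed compact_continuous_image continuous_intros test_functionsD(5)[OF \<zeta>(1)])
    moreover have "{x. \<zeta>' x \<noteq> 0} \<subseteq> ?S"
    proof
      fix y assume "y \<in> {x. \<zeta>' x \<noteq> 0}"
      then have "y - a \<in> {x. \<zeta> x \<noteq> 0}" by (simp add: \<zeta>'_def)
      then have "y - a \<in> closure {x. \<zeta> x \<noteq> 0}" by (rule closure_subset[THEN subsetD])
      then show "y \<in> ?S" by (intro image_eqI[of _ _ "y - a"]) auto
    qed
    ultimately have "closure {x. \<zeta>' x \<noteq> 0} \<subseteq> ?S" by (rule closure_minimal[rotated])
    with that show ?thesis by auto
  qed
  have a': "x + - a \<in> \<Omega>" if "x \<in> closure {x. \<zeta>' x \<noteq> 0}" for x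
    using supp'[OF that] test_functionsD(6)[OF \<zeta>(1)] by auto
  \<comment> \<open>The variation of the second competitor, read at \<open>x + a\<close>, is the
    negative of the first one; this produces the increment of \<open>F j\<close>.\<close>
  have var': "variation \<zeta>' (- a) j (x + a) = - variation \<zeta> a j x" for j x
    using partial_shift[OF test_functionsD(2)[OF \<zeta>(1)], where x = "x + a" and a = "- a" and i = j]
    by (simp add: variation_def \<zeta>'_def algebra_simps)
  \<comment> \<open>The sequence starts with \<open>\<tau> 0 = 1\<close>, so \<open>Q 0\<close> is
    the majorant provided by \<open>f_quotient_le\<close>.\<close>
  define \<tau> :: "nat \<Rightarrow> real" where "\<tau> n = inverse (real (Suc n))" for n
  have \<tau>: "0 < \<tau> n" "\<tau> n \<le> 1" for n by (auto simp: \<tau>_def field_simps)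
  define g1 where "g1 n x = (\<Sum>j\<in>UNIV. f j (V j x + \<tau> n * variation \<zeta> a j x) - f j (V j x))" for n x
  define g2 where "g2 n x = (\<Sum>j\<in>UNIV. f j (V j x + \<tau> n * variation \<zeta>' (- a) j x) - f j (V j x))" for n x
  have g1: "integrable lborel (g1 n)" "(\<integral>x. g1 n x \<partial>lborel) \<ge> 0" for n
    using first_variation[OF \<zeta> a, of "\<tau> n"] \<tau>[of n] unfolding g1_def by auto
  have g2: "integrable lborel (g2 n)" "(\<integral>x. g2 n x \<partial>lborel) \<ge> 0" for n
    using first_variation[OF \<zeta>' _ _ a', of "\<tau> n"] \<tau>[of n] \<zeta>(2,3) unfolding g2_def by (auto simp: \<zeta>'_def)
  have g2': "integrable lborel (\<lambda>x. g2 n (x + a))" "(\<integral>x. g2 n (x + a) \<partial>lborel) \<ge> 0" for n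
    using g2[of n] by (simp_all add: integrable_lborel_shift_iff integral_lborel_shift)
  define Q where "Q n x = (g1 n x + g2 n (x + a)) / \<tau> n" for n x
  have iQ: "integrable lborel (Q n)" for n
    unfolding Q_def by (intro integrable_divide Bochner_Integration.integrable_add g1 g2')
  have Qint: "(\<integral>x. Q n x \<partial>lborel) \<ge> 0" for n
    unfolding Q_def using g1[of n] g2'[of n] \<tau>[of n] by simp
  have Q: "Q n x = (\<Sum>j\<in>UNIV. (f j (V j x + \<tau> n * variation \<zeta> a j x) - f j (V j x)) / \<tau> n +
      (f j (V j (x + a) + \<tau> n * (- variation \<zeta> a j x)) - f j (V j (x + a))) / \<tau> n)" for n x
    by (simp add: Q_def g1_def g2_def var' sum.distrib sum_subtractf add_divide_distrib diff_divide_distrib sum_divide_distrib)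
  have Q0: "Q 0 x = (\<Sum>j\<in>UNIV. (f j (V j x + variation \<zeta> a j x) - f j (V j x)) +
      (f j (V j (x + a) + - variation \<zeta> a j x) - f j (V j (x + a))))" for x
    by (simp add: Q \<tau>_def)
  have le: "Q n x \<le> Q 0 x" for n x
    unfolding Q0 Q[of n] by (intro sum_mono add_mono f_quotient_le[OF \<tau>])
  have lim: "(\<lambda>n. Q n x) \<longlonglongrightarrow> - I x" for x
  proof -
    have "(\<lambda>n. Q n x) \<longlonglongrightarrow> (\<Sum>j\<in>UNIV. F j (V j x) * variation \<zeta> a j x + F j (V j (x + a)) * (- variation \<zeta> a j x))"
      unfolding Q \<tau>_def by (intro tendsto_sum tendsto_add f_quotient_tendsto)
    also have "(\<Sum>j\<in>UNIV. F j (V j x) * variation \<zeta> a j x + F j (V j (x + a)) * (- variation \<zeta> a j x)) = - I x"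
      by (simp add: I_def sum_negf[symmetric] algebra_simps)
    finally show ?thesis .
  qed
  have mI[measurable]: "I \<in> borel_measurable borel" unfolding I_def by measurable
  have mQ[measurable]: "Q n \<in> borel_measurable borel" for n using borel_measurable_integrable[OF iQ[of n]] by simp
  have nonneg: "Q 0 x + I x \<ge> 0" for x
    using LIMSEQ_le_const2[OF lim[of x], of "Q 0 x"] le by fastforce
  have "(\<integral>\<^sup>+x. ennreal (Q 0 x + I x) \<partial>lborel) = (\<integral>\<^sup>+x. liminf (\<lambda>n. ennreal (Q 0 x - Q n x)) \<partial>lborel)"
  proof (rule nn_integral_cong)
    fix x
    have "(\<lambda>n. ennreal (Q 0 x - Q n x)) \<longlonglongrightarrow> ennreal (Q 0 x - - I x)"
      by (intro tendsto_ennrealI tendsto_diff tendsto_const lim)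
    then show "ennreal (Q 0 x + I x) = liminf (\<lambda>n. ennreal (Q 0 x - Q n x))"
      by (simp add: lim_imp_Liminf)
  qed
  also have "\<dots> \<le> liminf (\<lambda>n. \<integral>\<^sup>+x. ennreal (Q 0 x - Q n x) \<partial>lborel)"
    by (rule nn_integral_liminf) measurable
  also have "\<dots> \<le> liminf (\<lambda>n. ennreal (\<integral>x. Q 0 x \<partial>lborel))"
  proof (rule Liminf_mono, rule always_eventually, rule allI)
    fix n
    have "(\<integral>\<^sup>+x. ennreal (Q 0 x - Q n x) \<partial>lborel) = ennreal (\<integral>x. Q 0 x - Q n x \<partial>lborel)"
      using le by (intro nn_integral_eq_integral Bochner_Integration.integrable_diff iQ) auto
    also have "\<dots> \<le> ennreal (\<integral>x. Q 0 x \<partial>lborel)"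
      using Qint[of n] iQ by (intro ennreal_leI) simp
    finally show "(\<integral>\<^sup>+x. ennreal (Q 0 x - Q n x) \<partial>lborel) \<le> ennreal (\<integral>x. Q 0 x \<partial>lborel)" .
  qed
  also have "\<dots> = ennreal (\<integral>x. Q 0 x \<partial>lborel)" by (simp add: Liminf_const)
  finally have fatou: "(\<integral>\<^sup>+x. ennreal (Q 0 x + I x) \<partial>lborel) \<le> ennreal (\<integral>x. Q 0 x \<partial>lborel)" .
  have iQI: "integrable lborel (\<lambda>x. Q 0 x + I x)"
    using fatou nonneg by (intro integrableI_nonneg) (auto simp: order_le_less_trans)
  then have "integrable lborel (\<lambda>x. (Q 0 x + I x) - Q 0 x)"
    by (intro Bochner_Integration.integrable_diff iQ)
  then show iI: "integrable lborel I" by simp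
  have "ennreal (\<integral>x. Q 0 x + I x \<partial>lborel) \<le> ennreal (\<integral>x. Q 0 x \<partial>lborel)"
    using fatou nonneg by (subst (asm) nn_integral_eq_integral[OF iQI]) auto
  then have "(\<integral>x. Q 0 x + I x \<partial>lborel) \<le> (\<integral>x. Q 0 x \<partial>lborel)"
    using Qint[of 0] by (simp add: ennreal_le_iff)
  then show "(\<integral>x. I x \<partial>lborel) \<le> 0" using iQ iI by simp
qed

end

section \<open>Weak derivatives along lines\<close>

text \<open>Every slice in \<open>t\<close> has norm at most \<open>B\<close> times the L1 norm of
  \<open>V\<close>, uniformly in \<open>t\<close>. With \<open>g = 1\<close> this gives means over
  segments for almost every \<open>x\<close>; with a test function it justifies Fubini.\<close>

lemma line_average_integrable:
  fixes V :: "'a::euclidean_space \<Rightarrow> real"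
  assumes V: "integrable lborel V" and g: "g \<in> borel_measurable borel" "\<And>x. \<bar>g x\<bar> \<le> B"
  shows "integrable (lborel \<Otimes>\<^sub>M lborel) (\<lambda>(t::real, x). indicator {0..1} t * (V (x + t *\<^sub>R a) * g x))"
proof (rule lborel_pair.Fubini_integrable)
  have [measurable]: "V \<in> borel_measurable borel" using V by auto
  note [measurable] = g(1)
  show "(\<lambda>(t::real, x). indicator {0..1} t * (V (x + t *\<^sub>R a) * g x)) \<in> borel_measurable (lborel \<Otimes>\<^sub>M lborel)"
    by measurable
  have i: "integrable lborel (\<lambda>x. V (x + t *\<^sub>R a) * g x)" for t :: real
    using V by (intro integrable_mult_bounded[OF _ g]) (simp add: integrable_lborel_shift_iff)
  show "AE t in lborel. integrable lborel (\<lambda>x. case (t, x) of (t::real, x) \<Rightarrow> indicator {0..1} t * (V (x + t *\<^sub>R a) * g x))"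
    using i by (intro AE_I2) (simp add: integrable_mult_right)
  have "integrable lborel (\<lambda>t::real. \<integral>x. norm (indicator {0..1} t * (V (x + t *\<^sub>R a) * g x)) \<partial>lborel)"
  proof (rule Bochner_Integration.integrable_bound[where f = "\<lambda>t. indicator {0..1} t * (\<integral>x. B * \<bar>V x\<bar> \<partial>lborel)"])
    show "integrable lborel (\<lambda>t::real. indicator {0..1} t * (\<integral>x. B * \<bar>V x\<bar> \<partial>lborel))"
      by (intro integrable_mult_left integrable_real_indicator) auto
    show "AE t in lborel. norm (\<integral>x. norm (indicator {0..1} t * (V (x + t *\<^sub>R a) * g x)) \<partial>lborel)
        \<le> norm (indicator {0..1} t * (\<integral>x. B * \<bar>V x\<bar> \<partial>lborel))"
    proof (rule AE_I2)
      fix t :: real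
      have B: "B \<ge> 0" using g(2)[of undefined] by simp
      have "(\<integral>x. \<bar>V (x + t *\<^sub>R a) * g x\<bar> \<partial>lborel) \<le> (\<integral>x. B * \<bar>V (x + t *\<^sub>R a)\<bar> \<partial>lborel)"
      proof (rule integral_mono)
        show "integrable lborel (\<lambda>x. \<bar>V (x + t *\<^sub>R a) * g x\<bar>)" using i by simp
        show "integrable lborel (\<lambda>x. B * \<bar>V (x + t *\<^sub>R a)\<bar>)"
          using V by (intro integrable_mult_right integrable_abs) (simp add: integrable_lborel_shift_iff)
        fix x show "\<bar>V (x + t *\<^sub>R a) * g x\<bar> \<le> B * \<bar>V (x + t *\<^sub>R a)\<bar>"
          using g(2)[of x] by (simp add: abs_mult mult.commute[of _ "\<bar>g x\<bar>"] mult_right_mono)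
      qed
      also have "\<dots> = (\<integral>x. B * \<bar>V x\<bar> \<partial>lborel)"
        using integral_lborel_shift[of "\<lambda>x. B * \<bar>V x\<bar>" "t *\<^sub>R a"] by simp
      finally show "norm (\<integral>x. norm (indicator {0..1} t * (V (x + t *\<^sub>R a) * g x)) \<partial>lborel)
        \<le> norm (indicator {0..1} t * (\<integral>x. B * \<bar>V x\<bar> \<partial>lborel))"
        using B by (cases "t \<in> {0..1}") auto
    qed
  qed measurable
  then show "integrable lborel (\<lambda>t. \<integral>x. norm (case (t, x) of (t::real, x) \<Rightarrow> indicator {0..1} t * (V (x + t *\<^sub>R a) * g x)) \<partial>lborel)"
    by simp
qed

lemma partial_line_integral:
  assumes \<phi>: "\<phi> \<in> test_functions \<Omega>"
  shows "(\<integral>t. indicator {0..1} t * partial i \<phi> (x + t *\<^sub>R (- (h *\<^sub>R axis i 1))) \<partial>lborel) * (- h) = \<phi> (x - h *\<^sub>R axis i 1) - \<phi> x"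
proof -
  let ?a = "- (h *\<^sub>R axis i (1::real))"
  have D: "((\<lambda>t. \<phi> (x + t *\<^sub>R ?a)) has_vector_derivative (- h * partial i \<phi> (x + t *\<^sub>R ?a))) (at t within {0..1})" for t
  proof -
    let ?L = "frechet_derivative \<phi> (at (x + t *\<^sub>R ?a))"
    have L: "(\<phi> has_derivative ?L) (at (x + t *\<^sub>R ?a))"
      using test_functionsD(2)[OF \<phi>] by (simp add: frechet_derivative_works[symmetric])
    have "((\<lambda>t. x + t *\<^sub>R ?a) has_derivative (\<lambda>s. s *\<^sub>R ?a)) (at t within {0..1})"
      by (auto intro!: derivative_eq_intros)
    from has_derivative_compose[OF this L]
    have "((\<lambda>t. \<phi> (x + t *\<^sub>R ?a)) has_derivative (\<lambda>s. ?L (s *\<^sub>R ?a))) (at t within {0..1})" .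
    moreover have "?L (s *\<^sub>R ?a) = s *\<^sub>R (- h * partial i \<phi> (x + t *\<^sub>R ?a))" for s
    proof -
      have lin: "linear ?L" using L by (rule has_derivative_linear)
      have "?L (s *\<^sub>R ?a) = ?L ((- (s * h)) *\<^sub>R axis i 1)" by simp
      also have "\<dots> = - (s * h) * ?L (axis i 1)" using linear_scale[OF lin, of "- (s * h)"] by simp
      finally show ?thesis by (simp add: partial_def)
    qed
    ultimately show ?thesis by (simp add: has_vector_derivative_def)
  qed
  have "continuous_on {0..1} (\<lambda>t. - h * partial i \<phi> (x + t *\<^sub>R ?a))"
    by (intro continuous_intros continuous_on_compose2[OF test_functionsD(4)[OF \<phi>]]) auto
  from integral_FTC_atLeastAtMost[OF _ D this]
  have "(\<integral>t. indicator {0..1} t *\<^sub>R (- h * partial i \<phi> (x + t *\<^sub>R ?a)) \<partial>lborel) = \<phi> (x + 1 *\<^sub>R ?a) - \<phi> (x + 0 *\<^sub>R ?a)"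
    by simp
  moreover have "(\<integral>t. indicator {0..1} t *\<^sub>R (- h * partial i \<phi> (x + t *\<^sub>R ?a)) \<partial>lborel) =
      (\<integral>t. (indicator {0..1} t * partial i \<phi> (x + t *\<^sub>R ?a)) * (- h) \<partial>lborel)"
    by (simp add: mult_ac)
  moreover have "\<dots> = (\<integral>t. indicator {0..1} t * partial i \<phi> (x + t *\<^sub>R ?a) \<partial>lborel) * (- h)"
    by (rule integral_mult_left_zero)
  ultimately show ?thesis by simp
qed

text \<open>Proved in tested form. The increment is moved from \<open>U\<close> to \<phi>, where the
  classical formula \<open>partial_line_integral\<close> holds; the weak derivative is used for each
  \<open>t\<close> separately, and Fubini restores the mean. The exceptional null set depends on
  \<open>h\<close>.\<close>

lemma weak_deriv_line_integral:
  assumes w: "weak_deriv \<Omega> i U V" and op: "open S"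
    and S: "\<And>x t. x \<in> S \<Longrightarrow> 0 \<le> t \<Longrightarrow> t \<le> 1 \<Longrightarrow> x + t *\<^sub>R (h *\<^sub>R axis i 1) \<in> \<Omega>"
  shows "AE x in lborel. x \<in> S \<longrightarrow>
    U (x + h *\<^sub>R axis i 1) - U x = h * (\<integral>t. indicator {0..1} t * V (x + t *\<^sub>R (h *\<^sub>R axis i 1)) \<partial>lborel)"
proof -
  let ?a = "h *\<^sub>R axis i (1::real)"
  have iU: "integrable lborel U" and iV: "integrable lborel V" using w by (auto simp: weak_deriv_def)
  then have [measurable]: "U \<in> borel_measurable borel" "V \<in> borel_measurable borel" by auto
  define G where "G x = (\<integral>t. indicator {0..1} t * V (x + t *\<^sub>R ?a) \<partial>lborel)" for x
  have iG: "integrable lborel G"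
    using lborel_pair.integrable_snd[OF line_average_integrable[OF iV, of "\<lambda>x. 1" 1 ?a]] by (simp add: G_def[abs_def])
  define g where "g x = U (x + ?a) - U x - h * G x" for x
  have ig: "integrable lborel g"
    unfolding g_def using iU iG by (intro Bochner_Integration.integrable_diff integrable_mult_right) (simp_all add: integrable_lborel_shift_iff)
  then have [measurable]: "g \<in> borel_measurable borel" by auto
  have "AE x in lebesgue_on S. g x = 0"
  proof (rule fundamental_lemma[OF op])
    show "locally_integrable S g"
      using ig by (auto simp: locally_integrable_def intro!: integrable_lborel_imp_lebesgue_on lmeasurable_compact fmeasurableD)
    fix \<phi> assume \<phi>: "\<phi> \<in> test_functions S"
    note [measurable] = test_functions_measurable[OF \<phi>]
    obtain B where B: "\<And>x. \<bar>\<phi> x\<bar> \<le> B" "\<And>x. \<bar>partial i \<phi> x\<bar> \<le> B"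
      using test_functions_bounded[OF \<phi>] by blast
    have z: "\<phi> x = 0" if "x \<notin> S" for x
      using test_functions_zero_outside(1)[OF \<phi>, of x] that test_functionsD(6)[OF \<phi>] by (meson subsetD)
    have iUp: "integrable lborel (\<lambda>x. U (x + ?a) * \<phi> x)" "integrable lborel (\<lambda>x. U x * \<phi> x)"
      "integrable lborel (\<lambda>x. U x * \<phi> (x - ?a))" "integrable lborel (\<lambda>x. G x * \<phi> x)"
      using iU iG B(1) by (auto intro!: integrable_mult_bounded(1)[where B = B] simp: integrable_lborel_shift_iff)
    have step: "(\<integral>x. U x * partial i \<phi> (x + t *\<^sub>R (- ?a)) \<partial>lborel) = - (\<integral>x. V (x + t *\<^sub>R ?a) * \<phi> x \<partial>lborel)"
      if t: "0 \<le> t" "t \<le> 1" for t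
    proof -
      have \<psi>: "(\<lambda>x. \<phi> (x + t *\<^sub>R (- ?a))) \<in> test_functions \<Omega>"
        using S t test_functionsD(6)[OF \<phi>] by (intro test_functions_shift[OF \<phi>]) auto
      have "(\<integral>x. U x * partial i \<phi> (x + t *\<^sub>R (- ?a)) \<partial>lborel) = (\<integral>x. U x * partial i (\<lambda>x. \<phi> (x + t *\<^sub>R (- ?a))) x \<partial>lborel)"
        by (simp only: partial_shift[OF test_functionsD(2)[OF \<phi>]])
      also have "\<dots> = - (\<integral>x. V x * \<phi> (x + t *\<^sub>R (- ?a)) \<partial>lborel)"
        using w \<psi> by (simp add: weak_deriv_def)
      also have "(\<integral>x. V x * \<phi> (x + t *\<^sub>R (- ?a)) \<partial>lborel) = (\<integral>x. V (x + t *\<^sub>R ?a) * \<phi> x \<partial>lborel)"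
        using integral_lborel_shift[of "\<lambda>x. V x * \<phi> (x + t *\<^sub>R (- ?a))" "t *\<^sub>R ?a"] by simp
      finally show ?thesis .
    qed
    have iP: "integrable (lborel \<Otimes>\<^sub>M lborel) (\<lambda>(t::real, x). indicator {0..1} t * (U x * partial i \<phi> (x + t *\<^sub>R (- ?a))))"
    proof (rule Bochner_Integration.integrable_bound)
      show "integrable (lborel \<Otimes>\<^sub>M lborel) (\<lambda>(t::real, x). indicator {0..1} t * (U (x + t *\<^sub>R 0) * B))"
        by (rule line_average_integrable[OF iU, of _ "\<bar>B\<bar>"]) auto
      show "(\<lambda>(t::real, x). indicator {0..1} t * (U x * partial i \<phi> (x + t *\<^sub>R (- ?a)))) \<in> borel_measurable (lborel \<Otimes>\<^sub>M lborel)"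
        by measurable
      show "AE z in lborel \<Otimes>\<^sub>M lborel. norm (case z of (t::real, x) \<Rightarrow> indicator {0..1} t * (U x * partial i \<phi> (x + t *\<^sub>R (- ?a))))
          \<le> norm (case z of (t::real, x) \<Rightarrow> indicator {0..1} t * (U (x + t *\<^sub>R 0) * B))"
      proof (rule AE_I2)
        fix z :: "real \<times> (real^'a)"
        obtain t x where zz: "z = (t, x)" by (cases z)
        have "\<bar>U x\<bar> * \<bar>partial i \<phi> (x + t *\<^sub>R (- ?a))\<bar> \<le> \<bar>U x\<bar> * \<bar>B\<bar>"
          using B(2)[of "x + t *\<^sub>R (- ?a)"] by (intro mult_left_mono) auto
        then show "norm (case z of (t::real, x) \<Rightarrow> indicator {0..1} t * (U x * partial i \<phi> (x + t *\<^sub>R (- ?a))))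
          \<le> norm (case z of (t::real, x) \<Rightarrow> indicator {0..1} t * (U (x + t *\<^sub>R 0) * B))"
          by (simp add: zz abs_mult indicator_def)
      qed
    qed
    have iQ: "integrable (lborel \<Otimes>\<^sub>M lborel) (\<lambda>(t::real, x). indicator {0..1} t * (V (x + t *\<^sub>R ?a) * \<phi> x))"
      by (rule line_average_integrable[OF iV _ B(1)]) measurable
    have "(\<integral>x. U (x + ?a) * \<phi> x \<partial>lborel) - (\<integral>x. U x * \<phi> x \<partial>lborel) =
        (\<integral>x. U x * \<phi> (x - ?a) \<partial>lborel) - (\<integral>x. U x * \<phi> x \<partial>lborel)"
      using integral_lborel_shift[of "\<lambda>x. U x * \<phi> (x - ?a)" ?a] by simp
    also have "\<dots> = (\<integral>x. U x * (\<phi> (x - ?a) - \<phi> x) \<partial>lborel)"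
      using iUp by (simp add: right_diff_distrib)
    also have "\<dots> = (\<integral>x. (- h) * (\<integral>t. indicator {0..1} t * (U x * partial i \<phi> (x + t *\<^sub>R (- ?a))) \<partial>lborel) \<partial>lborel)"
    proof (rule Bochner_Integration.integral_cong)
      fix x
      have "(\<integral>t. indicator {0..1} t * (U x * partial i \<phi> (x + t *\<^sub>R (- ?a))) \<partial>lborel) =
          (\<integral>t. U x * (indicator {0..1} t * partial i \<phi> (x + t *\<^sub>R (- ?a))) \<partial>lborel)"
        by (simp add: mult_ac)
      also have "\<dots> = U x * (\<integral>t. indicator {0..1} t * partial i \<phi> (x + t *\<^sub>R (- ?a)) \<partial>lborel)"
        by (rule integral_mult_right_zero)
      finally show "U x * (\<phi> (x - ?a) - \<phi> x) = (- h) * (\<integral>t. indicator {0..1} t * (U x * partial i \<phi> (x + t *\<^sub>R (- ?a))) \<partial>lborel)"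
        unfolding partial_line_integral[OF \<phi>, of i x h, symmetric] by (simp add: mult_ac)
    qed simp
    also have "\<dots> = (- h) * (\<integral>x. (\<integral>t. indicator {0..1} t * (U x * partial i \<phi> (x + t *\<^sub>R (- ?a))) \<partial>lborel) \<partial>lborel)"
      by (rule integral_mult_right_zero)
    also have "(\<integral>x. (\<integral>t. indicator {0..1} t * (U x * partial i \<phi> (x + t *\<^sub>R (- ?a))) \<partial>lborel) \<partial>lborel) =
        (\<integral>t. (\<integral>x. indicator {0..1} t * (U x * partial i \<phi> (x + t *\<^sub>R (- ?a))) \<partial>lborel) \<partial>lborel)"
      by (rule lborel_pair.Fubini_integral[OF iP])
    also have "\<dots> = (\<integral>t. (\<integral>x. - (indicator {0..1} t * (V (x + t *\<^sub>R ?a) * \<phi> x)) \<partial>lborel) \<partial>lborel)"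
    proof (rule Bochner_Integration.integral_cong)
      fix t :: real
      show "(\<integral>x. indicator {0..1} t * (U x * partial i \<phi> (x + t *\<^sub>R (- ?a))) \<partial>lborel) =
          (\<integral>x. - (indicator {0..1} t * (V (x + t *\<^sub>R ?a) * \<phi> x)) \<partial>lborel)"
        using step[of t] by (cases "t \<in> {0..1}") auto
    qed simp
    also have "\<dots> = - (\<integral>t. (\<integral>x. indicator {0..1} t * (V (x + t *\<^sub>R ?a) * \<phi> x) \<partial>lborel) \<partial>lborel)"
      by simp
    also have "(\<integral>t. (\<integral>x. indicator {0..1} t * (V (x + t *\<^sub>R ?a) * \<phi> x) \<partial>lborel) \<partial>lborel) =
        (\<integral>x. (\<integral>t. indicator {0..1} t * (V (x + t *\<^sub>R ?a) * \<phi> x) \<partial>lborel) \<partial>lborel)"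
      by (rule lborel_pair.Fubini_integral[OF iQ, symmetric])
    also have "\<dots> = (\<integral>x. G x * \<phi> x \<partial>lborel)"
    proof (rule Bochner_Integration.integral_cong)
      fix x
      have "(\<integral>t. indicator {0..1} t * (V (x + t *\<^sub>R ?a) * \<phi> x) \<partial>lborel) = (\<integral>t. (indicator {0..1} t * V (x + t *\<^sub>R ?a)) * \<phi> x \<partial>lborel)"
        by (simp add: mult_ac)
      then show "(\<integral>t. indicator {0..1} t * (V (x + t *\<^sub>R ?a) * \<phi> x) \<partial>lborel) = G x * \<phi> x"
        by (simp only: G_def integral_mult_left_zero)
    qed simp
    finally have eq: "(\<integral>x. U (x + ?a) * \<phi> x \<partial>lborel) - (\<integral>x. U x * \<phi> x \<partial>lborel) = h * (\<integral>x. G x * \<phi> x \<partial>lborel)" by simp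
    have "(\<integral>x. g x * \<phi> x \<partial>lebesgue_on S) = (\<integral>x. g x * \<phi> x \<partial>lborel)"
      using z by (intro integral_lebesgue_on_supported[OF op]) auto
    also have "\<dots> = (\<integral>x. (U (x + ?a) * \<phi> x - U x * \<phi> x) - h * (G x * \<phi> x) \<partial>lborel)"
      by (simp add: g_def algebra_simps)
    also have "\<dots> = ((\<integral>x. U (x + ?a) * \<phi> x \<partial>lborel) - (\<integral>x. U x * \<phi> x \<partial>lborel)) - h * (\<integral>x. G x * \<phi> x \<partial>lborel)"
      using iUp by simp
    finally show "(\<integral>x. g x * \<phi> x \<partial>lebesgue_on S) = 0" using eq by simp
  qed
  then have "AE x in lebesgue. x \<in> S \<longrightarrow> g x = 0"
    using op by (subst (asm) AE_restrict_space_iff) auto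
  then have "AE x in lborel. x \<in> S \<longrightarrow> g x = 0" by (simp add: AE_completion_iff)
  then show ?thesis by eventually_elim (auto simp: g_def G_def)
qed

section \<open>Two-sided power growth\<close>

text \<open>Covers both signs of \<open>r\<close>: the exponents q - 2 of the second derivatives may
  be negative.\<close>

lemma powr_comparable:
  fixes x y k r :: real
  assumes "k \<ge> 1" "y > 0" "y / k \<le> x" "x \<le> k * y"
  shows "k powr (- \<bar>r\<bar>) * y powr r \<le> x powr r" "x powr r \<le> k powr \<bar>r\<bar> * y powr r"
proof -
  have x: "x > 0" using assms by (meson divide_pos_pos less_le_trans zero_less_one)
  have "k powr (- \<bar>r\<bar>) * y powr r \<le> x powr r \<and> x powr r \<le> k powr \<bar>r\<bar> * y powr r"
  proof (cases "r \<ge> 0")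
    case True
    have "(y / k) powr r \<le> x powr r" "x powr r \<le> (k * y) powr r"
      using assms x True by (auto intro!: powr_mono2)
    then show ?thesis using assms True by (simp add: powr_mult powr_divide powr_minus_divide)
  next
    case False
    have "(k * y) powr r \<le> x powr r" "x powr r \<le> (y / k) powr r"
      using assms x False by (auto intro!: powr_mono2')
    then show ?thesis using assms False by (simp add: powr_mult powr_divide powr_minus_divide)
  qed
  then show "k powr (- \<bar>r\<bar>) * y powr r \<le> x powr r" "x powr r \<le> k powr \<bar>r\<bar> * y powr r" by auto
qed

text \<open>From the threshold \<open>X0\<close> on, \<open>k * X powr (q - 1)\<close> exceeds
  \<open>D\<close>; below it the left side is at most \<open>D * X0\<close>.\<close>

lemma superlinear_absorb:
  fixes q k D :: real
  assumes "q > 1" "k > 0" "D \<ge> 0"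
  shows "\<exists>K\<ge>0. \<forall>X\<ge>1. D * X \<le> k * X powr q + K"
proof -
  define X0 where "X0 = (D / k) powr (1 / (q - 1))"
  have "D * X \<le> k * X powr q + D * X0" if "X \<ge> 1" for X
  proof (cases "X \<ge> X0")
    case True
    have "D / k = X0 powr (q - 1)" using assms by (simp add: X0_def powr_powr)
    also have "\<dots> \<le> X powr (q - 1)" using assms True by (intro powr_mono2) (auto simp: X0_def)
    finally have "D \<le> k * X powr (q - 1)" using assms by (simp add: field_simps)
    then have "D * X \<le> k * X powr (q - 1) * X" using that by (intro mult_right_mono) auto
    also have "\<dots> = k * X powr q" using that by (simp add: powr_diff)
    finally show ?thesis using assms by (simp add: X0_def add_increasing2)
  next
    case False
    then show ?thesis using assms by (intro order_trans[OF mult_left_mono[of X X0 D]]) auto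
  qed
  then show ?thesis using assms by (intro exI[of _ "D * X0"]) (auto simp: X0_def)
qed

text \<open>\<open>A\<close> and \<open>B\<close> are the first and the second primitive of (1 +
  t)^(q - 2). Integrating the bounds on \<open>G\<close> twice compares \<open>f\<close> with
  \<open>c * B\<close> and \<open>C * B\<close> up to affine terms of unknown sign. In the lower
  bound these are absorbed because q > 1.\<close>

lemma half_line_growth:
  fixes f F G :: "real \<Rightarrow> real"
  assumes q: "q > 1" and c: "c > 0"
    and f: "\<And>t. f t \<ge> 0" "\<And>t. (f has_real_derivative F t) (at t)" "\<And>t. (F has_real_derivative G t) (at t)"
    and G: "\<And>t. t \<ge> 0 \<Longrightarrow> c * (1 + t) powr (q - 2) \<le> G t" "\<And>t. t \<ge> 0 \<Longrightarrow> G t \<le> C * (1 + t) powr (q - 2)"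
  shows "\<exists>K>0. \<forall>t\<ge>0. f t \<le> K * (1 + t) powr q \<and> (1 + t) powr q \<le> K * (1 + f t)"
proof -
  define A where "A t = (1 + t) powr (q - 1) / (q - 1)" for t
  define B where "B t = (1 + t) powr q / (q * (q - 1))" for t
  have dp: "((\<lambda>t. (1 + t) powr r) has_real_derivative r * (1 + t) powr (r - 1)) (at t)" if "t \<ge> 0" for r t :: real
  proof -
    have "((\<lambda>z. z powr r) has_real_derivative r * (1 + t) powr (r - 1)) (at (1 + t))"
      by (rule has_real_derivative_powr) (use that in simp)
    moreover have "((\<lambda>t::real. 1 + t) has_real_derivative 1) (at t)" by (auto intro!: derivative_eq_intros)
    ultimately show ?thesis
      using DERIV_chain2[of "\<lambda>z. z powr r" _ "\<lambda>t. 1 + t" t 1 UNIV] by simp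
  qed
  have dA: "(A has_real_derivative (1 + t) powr (q - 2)) (at t)" if "t \<ge> 0" for t
    using DERIV_cdivide[OF dp[OF that, of "q - 1"], of "q - 1"] q by (simp add: A_def[abs_def])
  have dB: "(B has_real_derivative A t) (at t)" if "t \<ge> 0" for t
    using DERIV_cdivide[OF dp[OF that, of q], of "q * (q - 1)"] q by (simp add: A_def[abs_def] B_def[abs_def])
  have A0: "A 0 \<ge> 0" "B 0 \<ge> 0" using q by (auto simp: A_def B_def)
  have C: "C > 0"
  proof -
    have "c \<le> C" using order_trans[OF G(1)[of 0] G(2)[of 0]] by simp
    with c show ?thesis by linarith
  qed
  have mono: "g 0 \<le> g t" if "t \<ge> 0" "\<And>s. s \<ge> 0 \<Longrightarrow> (g has_real_derivative g' s) (at s)" "\<And>s. s \<ge> 0 \<Longrightarrow> g' s \<ge> 0"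
    for g g' :: "real \<Rightarrow> real" and t
    by (rule DERIV_nonneg_imp_nondecreasing[OF that(1)]) (use that(2,3) in blast)
  have F_up: "F t - F 0 \<le> C * (A t - A 0)" if "t \<ge> 0" for t
  proof -
    have "(\<lambda>s. C * A s - F s) 0 \<le> (\<lambda>s. C * A s - F s) t"
      by (rule mono[OF that, of _ "\<lambda>s. C * (1 + s) powr (q - 2) - G s"])
        (auto intro!: DERIV_diff DERIV_cmult dA f(3) simp: G(2))
    then show ?thesis by (simp add: algebra_simps)
  qed
  have F_lo: "F t - F 0 \<ge> c * (A t - A 0)" if "t \<ge> 0" for t
  proof -
    have "(\<lambda>s. F s - c * A s) 0 \<le> (\<lambda>s. F s - c * A s) t"
      by (rule mono[OF that, of _ "\<lambda>s. G s - c * (1 + s) powr (q - 2)"])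
        (auto intro!: DERIV_diff DERIV_cmult dA f(3) simp: G(1))
    then show ?thesis by (simp add: algebra_simps)
  qed
  have f_up: "f t \<le> f 0 + F 0 * t + C * (B t - B 0 - A 0 * t)" if "t \<ge> 0" for t
  proof -
    have "(\<lambda>s. F 0 * s + C * (B s - A 0 * s) - f s) 0 \<le> (\<lambda>s. F 0 * s + C * (B s - A 0 * s) - f s) t"
    proof (rule mono[OF that, of _ "\<lambda>s. F 0 + C * (A s - A 0) - F s"])
      show "((\<lambda>s. F 0 * s + C * (B s - A 0 * s) - f s) has_real_derivative F 0 + C * (A s - A 0) - F s) (at s)" if "s \<ge> 0" for s
        using dB[OF that] f(2)[of s] by (auto intro!: derivative_eq_intros)
      show "F 0 + C * (A s - A 0) - F s \<ge> 0" if "s \<ge> 0" for s using F_up[OF that] by simp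
    qed
    then show ?thesis by (simp add: algebra_simps)
  qed
  have f_lo: "f t \<ge> f 0 + F 0 * t + c * (B t - B 0 - A 0 * t)" if "t \<ge> 0" for t
  proof -
    have "(\<lambda>s. f s - F 0 * s - c * (B s - A 0 * s)) 0 \<le> (\<lambda>s. f s - F 0 * s - c * (B s - A 0 * s)) t"
    proof (rule mono[OF that, of _ "\<lambda>s. F s - F 0 - c * (A s - A 0)"])
      show "((\<lambda>s. f s - F 0 * s - c * (B s - A 0 * s)) has_real_derivative F s - F 0 - c * (A s - A 0)) (at s)" if "s \<ge> 0" for s
        using dB[OF that] f(2)[of s] by (auto intro!: derivative_eq_intros)
      show "F s - F 0 - c * (A s - A 0) \<ge> 0" if "s \<ge> 0" for s using F_lo[OF that] by simp
    qed
    then show ?thesis by (simp add: algebra_simps)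
  qed
  define k where "k = c / (q * (q - 1))"
  have k: "k > 0" using c q by (simp add: k_def)
  define D where "D = c * B 0 + \<bar>F 0\<bar> + c * A 0"
  have D: "D \<ge> 0" using A0 c by (simp add: D_def)
  obtain K where K: "K \<ge> 0" "\<And>X. X \<ge> 1 \<Longrightarrow> D * X \<le> k / 2 * X powr q + K"
    using superlinear_absorb[OF q, of "k / 2" D] k D by auto
  define K1 where "K1 = f 0 + \<bar>F 0\<bar> + C / (q * (q - 1))"
  define K2 where "K2 = 2 / k * (1 + K)"
  have K1: "K1 \<ge> 0" unfolding K1_def using f(1)[of 0] C q by simp
  have K2: "K2 > 0" unfolding K2_def using k K by simp
  have up: "f t \<le> K1 * (1 + t) powr q" if "t \<ge> 0" for t
  proof -
    have one: "1 \<le> (1 + t) powr q" using that q by (simp add: ge_one_powr_ge_zero)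
    have lin: "t \<le> (1 + t) powr q"
    proof -
      have "(1 + t) powr 1 \<le> (1 + t) powr q" using that q by (intro powr_mono) auto
      with that show ?thesis by simp
    qed
    have "f t \<le> f 0 + F 0 * t + C * B t"
    proof -
      have "C * B 0 + C * (A 0 * t) \<ge> 0" using C A0 that by simp
      with f_up[OF that] show ?thesis by (simp add: algebra_simps)
    qed
    also have "\<dots> \<le> f 0 * (1 + t) powr q + \<bar>F 0\<bar> * (1 + t) powr q + C / (q * (q - 1)) * (1 + t) powr q"
    proof (intro add_mono)
      show "f 0 \<le> f 0 * (1 + t) powr q" using mult_left_mono[OF one f(1)[of 0]] by simp
      have "F 0 * t \<le> \<bar>F 0\<bar> * t" using that by (intro mult_right_mono) auto
      also have "\<dots> \<le> \<bar>F 0\<bar> * (1 + t) powr q" using lin by (intro mult_left_mono) auto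
      finally show "F 0 * t \<le> \<bar>F 0\<bar> * (1 + t) powr q" .
    qed (simp add: B_def)
    finally show ?thesis by (simp add: K1_def algebra_simps)
  qed
  have lo: "(1 + t) powr q \<le> K2 * (1 + f t)" if "t \<ge> 0" for t
  proof -
    have "k * (1 + t) powr q = c * B t" by (simp add: k_def B_def)
    also have "\<dots> \<le> f t + D * (1 + t)"
    proof -
      have "- F 0 * t \<le> \<bar>F 0\<bar> * t" using that by (intro mult_right_mono) auto
      moreover have "c * B 0 * t \<ge> 0" "\<bar>F 0\<bar> \<ge> 0" "c * A 0 \<ge> 0" using c A0 that by auto
      ultimately show ?thesis
        using f_lo[OF that] f(1)[of 0] by (simp add: D_def algebra_simps)
    qed
    also have "D * (1 + t) \<le> k / 2 * (1 + t) powr q + K" using that by (intro K(2)) auto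
    finally have "k / 2 * (1 + t) powr q \<le> f t + K" by simp
    also have "\<dots> \<le> (1 + K) * (1 + f t)" using K(1) f(1)[of t] by (simp add: algebra_simps)
    finally show ?thesis using k by (simp add: K2_def field_simps)
  qed
  show ?thesis
  proof (intro exI[of _ "max K1 K2"] conjI allI impI)
    show "max K1 K2 > 0" using K2 by simp
    fix t :: real assume t: "t \<ge> 0"
    show "f t \<le> max K1 K2 * (1 + t) powr q"
      using up[OF t] by (rule order_trans) (intro mult_right_mono, auto)
    show "(1 + t) powr q \<le> max K1 K2 * (1 + f t)"
      using lo[OF t] by (rule order_trans) (intro mult_right_mono, auto simp: f(1) add_nonneg_nonneg)
  qed
qed

section \<open>Densities with different exponents on the two half-lines\<close>

definition side :: "real \<Rightarrow> real \<Rightarrow> real \<Rightarrow> real" where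
  "side p m t = (if 0 \<le> t then p else m)"

text \<open>Up to a constant a majorant of f'', made monotone: for an exponent below 2, where f''
  may decay, the weight is 1. So it is nondecreasing in the modulus of \<open>t\<close> on each
  half-line.\<close>

definition weight :: "real \<Rightarrow> real \<Rightarrow> real \<Rightarrow> real" where
  "weight p m t = (1 + \<bar>t\<bar>) powr max 0 (side p m t - 2)"

lemma weight_ge_1: "weight p m t \<ge> 1"
  by (simp add: weight_def ge_one_powr_ge_zero)

locale two_sided_growth =
  fixes f F G :: "real \<Rightarrow> real" and p m c C :: real
  assumes exponents: "p > 1" "m > 1" and c_pos: "c > 0"
    and f_nonneg: "\<And>t. f t \<ge> 0"
    and f_deriv: "\<And>t. (f has_real_derivative F t) (at t)"
    and F_deriv: "\<And>t. (F has_real_derivative G t) (at t)"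
    and G_lower: "\<And>t. c * (1 + \<bar>t\<bar>) powr (side p m t - 2) \<le> G t"
    and G_upper: "\<And>t. G t \<le> C * (1 + \<bar>t\<bar>) powr (side p m t - 2)"
begin

lemma G_pos: "G t > 0"
  using G_lower[of t] c_pos by (smt (verit) mult_pos_pos powr_gt_zero abs_ge_zero)

lemma C_pos: "C > 0"
  using G_upper[of 0] G_pos[of 0] by simp

lemma F_strict_mono: "s < t \<Longrightarrow> F s < F t"
  using DERIV_pos_imp_increasing[of s t F] F_deriv G_pos by blast

lemma F_mono: "s \<le> t \<Longrightarrow> F s \<le> F t"
  using F_strict_mono[of s t] by (cases "s = t") auto

lemma F_mvt: "s < t \<Longrightarrow> \<exists>z. s < z \<and> z < t \<and> F t - F s = (t - s) * G z"
  using MVT2[of s t F G] F_deriv by blast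

lemma f_convex: "convex_on UNIV f"
  by (rule convex_on_realI[of UNIV f F]) (use f_deriv F_mono in auto)

lemma growth_bounds:
  "\<exists>K>0. \<forall>t. f t \<le> K * (1 + \<bar>t\<bar>) powr side p m t \<and> (1 + \<bar>t\<bar>) powr side p m t \<le> K * (1 + f t)"
proof -
  obtain K1 where K1: "K1 > 0" "\<And>t. t \<ge> 0 \<Longrightarrow> f t \<le> K1 * (1 + t) powr p \<and> (1 + t) powr p \<le> K1 * (1 + f t)"
    using half_line_growth[OF exponents(1) c_pos f_nonneg f_deriv F_deriv, of C] G_lower G_upper
    by (metis (no_types, lifting) abs_of_nonneg side_def)
  have d1: "((\<lambda>t. f (- t)) has_real_derivative - F (- t)) (at t)" for t
    using DERIV_chain2[OF f_deriv DERIV_minus[OF DERIV_ident]] by simp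
  have d2: "((\<lambda>t. - F (- t)) has_real_derivative G (- t)) (at t)" for t
    using DERIV_minus[OF DERIV_chain2[OF F_deriv DERIV_minus[OF DERIV_ident]], of t UNIV] by simp
  obtain K2 where K2: "K2 > 0" "\<And>t. t \<ge> 0 \<Longrightarrow> f (- t) \<le> K2 * (1 + t) powr m \<and> (1 + t) powr m \<le> K2 * (1 + f (- t))"
  proof -
    have "\<exists>K>0. \<forall>t\<ge>0. f (- t) \<le> K * (1 + t) powr m \<and> (1 + t) powr m \<le> K * (1 + f (- t))"
    proof (rule half_line_growth[OF exponents(2) c_pos f_nonneg d1 d2])
      fix t :: real assume t: "t \<ge> 0"
      show "c * (1 + t) powr (m - 2) \<le> G (- t)"
        using t G_lower[of "- t"] by (cases "t = 0") (auto simp: side_def)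
      show "G (- t) \<le> C * (1 + t) powr (m - 2)"
        using t G_upper[of "- t"] by (cases "t = 0") (auto simp: side_def)
    qed
    then show ?thesis using that by blast
  qed
  show ?thesis
  proof (intro exI[of _ "max K1 K2"] conjI allI)
    show "max K1 K2 > 0" using K1 by simp
    fix t :: real
    let ?X = "(1 + \<bar>t\<bar>) powr side p m t"
    have *: "f t \<le> K1 * ?X \<and> ?X \<le> K1 * (1 + f t) \<or> f t \<le> K2 * ?X \<and> ?X \<le> K2 * (1 + f t)"
      using K1(2)[of t] K2(2)[of "- t"] by (cases "t \<ge> 0") (auto simp: side_def)
    have "K1 * ?X \<le> max K1 K2 * ?X" "K2 * ?X \<le> max K1 K2 * ?X"
      by (auto intro!: mult_right_mono)
    moreover have "K1 * (1 + f t) \<le> max K1 K2 * (1 + f t)" "K2 * (1 + f t) \<le> max K1 K2 * (1 + f t)"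
      using f_nonneg[of t] by (auto intro!: mult_right_mono)
    ultimately show "f t \<le> max K1 K2 * ?X" "?X \<le> max K1 K2 * (1 + f t)" using * by linarith+
  qed
qed

lemma f_le_endpoints:
  assumes "lo \<le> x" "x \<le> hi"
  shows "f x \<le> f lo + f hi"
proof (cases "lo = hi")
  case True
  then show ?thesis using assms f_nonneg[of lo] by simp
next
  case False
  define t where "t = (x - lo) / (hi - lo)"
  have t: "0 \<le> t" "t \<le> 1" using assms False by (auto simp: t_def field_simps)
  have "t * (hi - lo) = x - lo" using False by (simp add: t_def)
  then have "x = (1 - t) *\<^sub>R lo + t *\<^sub>R hi" by (simp add: algebra_simps)
  then have "f x \<le> (1 - t) * f lo + t * f hi"
    using convex_onD[OF f_convex t, of lo hi] by simp
  also have "\<dots> \<le> 1 * f lo + 1 * f hi" using t f_nonneg by (intro add_mono mult_right_mono) auto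
  finally show ?thesis by simp
qed

text \<open>A bounded shift that keeps the sign changes the power by a constant factor. If the sign
  changes, the shifted point has modulus at most that of \<open>E\<close>, so the different
  exponents do no harm. Convexity reduces a convex combination plus error to the two shifted
  endpoints.\<close>

lemma perturb: "\<exists>K. \<forall>a b t e. 0 \<le> t \<longrightarrow> t \<le> 1 \<longrightarrow> \<bar>e\<bar> \<le> E \<longrightarrow> f ((1 - t) * a + t * b + e) \<le> K * (1 + f a + f b)"
proof -
  obtain K where K: "K > 0" "\<And>t. f t \<le> K * (1 + \<bar>t\<bar>) powr side p m t" "\<And>t. (1 + \<bar>t\<bar>) powr side p m t \<le> K * (1 + f t)"
    using growth_bounds by auto
  define D where "D = (1 + \<bar>E\<bar>) powr (p + m)"
  have shift: "f s \<le> K * (D * (K * (1 + f a)))" if "\<bar>s - a\<bar> \<le> \<bar>E\<bar>" for s a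
  proof -
    let ?q = "side p m s"
    have q: "0 \<le> ?q" "?q \<le> p + m" using exponents by (auto simp: side_def)
    have "(1 + \<bar>s\<bar>) powr ?q \<le> D * (1 + \<bar>a\<bar>) powr side p m a"
    proof (cases "(0 \<le> s) = (0 \<le> a)")
      case True
      have "0 \<le> \<bar>E\<bar> * \<bar>a\<bar>" by simp
      moreover have "\<bar>s\<bar> \<le> \<bar>a\<bar> + \<bar>E\<bar>" using that by linarith
      ultimately have "1 + \<bar>s\<bar> \<le> (1 + \<bar>E\<bar>) * (1 + \<bar>a\<bar>)" unfolding distrib_left distrib_right by linarith
      then have "(1 + \<bar>s\<bar>) powr ?q \<le> ((1 + \<bar>E\<bar>) * (1 + \<bar>a\<bar>)) powr ?q" using q by (intro powr_mono2) auto
      also have "\<dots> = (1 + \<bar>E\<bar>) powr ?q * (1 + \<bar>a\<bar>) powr ?q" by (simp add: powr_mult)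
      also have "\<dots> \<le> D * (1 + \<bar>a\<bar>) powr ?q" unfolding D_def using q by (intro mult_right_mono powr_mono) auto
      finally show ?thesis using True by (simp add: side_def)
    next
      case False
      then have "\<bar>s\<bar> \<le> \<bar>E\<bar>" using that by (auto split: if_splits)
      then have "(1 + \<bar>s\<bar>) powr ?q \<le> (1 + \<bar>E\<bar>) powr ?q" using q by (intro powr_mono2) auto
      also have "\<dots> \<le> D" unfolding D_def using q by (intro powr_mono) auto
      also have "\<dots> \<le> D * (1 + \<bar>a\<bar>) powr side p m a"
        using exponents by (intro mult_le_cancel_left1[THEN iffD2]) (auto simp: D_def side_def ge_one_powr_ge_zero)
      finally show ?thesis .
    qed
    also have "\<dots> \<le> D * (K * (1 + f a))" using K(3)[of a] by (intro mult_left_mono) (auto simp: D_def)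
    finally have "K * (1 + \<bar>s\<bar>) powr ?q \<le> K * (D * (K * (1 + f a)))" using K(1) by (intro mult_left_mono) auto
    with K(2)[of s] show ?thesis by linarith
  qed
  define H where "H = K * (D * K)"
  have H: "H \<ge> 0" using K(1) by (simp add: H_def D_def)
  have shift': "f s \<le> H * (1 + f a)" if "\<bar>s - a\<bar> \<le> \<bar>E\<bar>" for s a
    using shift[OF that] by (simp add: H_def mult_ac)
  have "f ((1 - t) * a + t * b + e) \<le> (2 * H) * (1 + f a + f b)" if t: "0 \<le> t" "t \<le> 1" "\<bar>e\<bar> \<le> E" for a b t e
  proof -
    have cvx: "min a b \<le> (1 - t) * a + t * b" "(1 - t) * a + t * b \<le> max a b"
    proof -
      have "(1 - t) * min a b + t * min a b \<le> (1 - t) * a + t * b" using t by (intro add_mono mult_left_mono) auto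
      then show "min a b \<le> (1 - t) * a + t * b" by (simp add: algebra_simps)
      have "(1 - t) * a + t * b \<le> (1 - t) * max a b + t * max a b" using t by (intro add_mono mult_left_mono) auto
      then show "(1 - t) * a + t * b \<le> max a b" by (simp add: algebra_simps)
    qed
    have "f ((1 - t) * a + t * b + e) \<le> f (min a b - \<bar>E\<bar>) + f (max a b + \<bar>E\<bar>)"
      using cvx t by (intro f_le_endpoints) linarith+
    also have "f (min a b - \<bar>E\<bar>) \<le> H * (1 + f a + f b)"
    proof -
      have "f (min a b - \<bar>E\<bar>) \<le> H * (1 + f (min a b))" by (rule shift') simp
      also have "\<dots> \<le> H * (1 + f a + f b)" using H f_nonneg[of a] f_nonneg[of b] by (intro mult_left_mono) (auto simp: min_def)
      finally show ?thesis .
    qed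
    also have "f (max a b + \<bar>E\<bar>) \<le> H * (1 + f a + f b)"
    proof -
      have "f (max a b + \<bar>E\<bar>) \<le> H * (1 + f (max a b))" by (rule shift') simp
      also have "\<dots> \<le> H * (1 + f a + f b)" using H f_nonneg[of a] f_nonneg[of b] by (intro mult_left_mono) (auto simp: max_def)
      finally show ?thesis .
    qed
    finally show ?thesis by (simp add: algebra_simps)
  qed
  then show ?thesis by blast
qed

text \<open>Mean value theorem. The intermediate point lies between 0 and the endpoint on its own
  side, or beyond neither, so the weight of that endpoint dominates.\<close>

lemma F_lipschitz: "\<bar>F b - F a\<bar> \<le> C * (weight p m a + weight p m b) * \<bar>b - a\<bar>"
proof -
  have *: "F b - F a \<le> C * (weight p m a + weight p m b) * (b - a)" if ab: "a < b" for a b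
  proof -
    obtain z where z: "a < z" "z < b" "F b - F a = (b - a) * G z" using F_mvt[OF ab] by auto
    have "(1 + \<bar>z\<bar>) powr (side p m z - 2) \<le> weight p m z"
      unfolding weight_def by (intro powr_mono) auto
    also have "weight p m z \<le> weight p m a + weight p m b"
    proof (cases "z \<ge> 0")
      case True
      then have "weight p m z \<le> weight p m b" using z unfolding weight_def by (auto simp: side_def intro!: powr_mono2)
      then show ?thesis using weight_ge_1[of p m a] by linarith
    next
      case False
      then have "weight p m z \<le> weight p m a" using z unfolding weight_def by (auto simp: side_def intro!: powr_mono2)
      then show ?thesis using weight_ge_1[of p m b] by linarith
    qed
    finally have "C * (1 + \<bar>z\<bar>) powr (side p m z - 2) \<le> C * (weight p m a + weight p m b)" using C_pos by simp
    with G_upper[of z] have "G z \<le> C * (weight p m a + weight p m b)" by linarith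
    then show ?thesis using z(3) ab by (simp add: mult.commute mult_left_mono)
  qed
  consider "a < b" | "b < a" | "a = b" by linarith
  then show ?thesis
  proof cases
    case 1
    then show ?thesis using *[OF 1] F_mono[of a b] by simp
  next
    case 2
    then show ?thesis using *[OF 2] F_mono[of b a] by (simp add: add.commute)
  qed simp
qed

text \<open>On the segment between a/2 and a the second derivative is comparable to its size at a;
  monotonicity of \<open>F\<close> extends the bound to every y beyond a/2. Since y may have either
  sign, only the exponent on the side of a enters.\<close>

lemma F_gap: "\<exists>k>0. (\<forall>a\<ge>1. \<forall>y\<le>a/2. k * (1 + a) powr (p - 1) \<le> F a - F y) \<and>
   (\<forall>a\<le>-1. \<forall>y\<ge>a/2. k * (1 + \<bar>a\<bar>) powr (m - 1) \<le> F y - F a)"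
proof -
  define k where "k r = c / 4 * 2 powr (- \<bar>r - 2\<bar>)" for r :: real
  have k: "k r > 0" for r using c_pos by (simp add: k_def)
  have main: "k r * (1 + a) powr (r - 1) \<le> (a / 2) * g" if "a \<ge> 1" "a / 2 \<le> z" "z \<le> a" "c * (1 + z) powr (r - 2) \<le> g" for a z g r :: real
  proof -
    have "2 powr (- \<bar>r - 2\<bar>) * (1 + a) powr (r - 2) \<le> (1 + z) powr (r - 2)"
      by (rule powr_comparable) (use that in auto)
    then have "c * (2 powr (- \<bar>r - 2\<bar>) * (1 + a) powr (r - 2)) \<le> g"
      using that(4) c_pos by (meson mult_left_mono less_imp_le order_trans)
    then have "((1 + a) / 4) * (c * (2 powr (- \<bar>r - 2\<bar>) * (1 + a) powr (r - 2))) \<le> (a / 2) * g"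
      using that c_pos by (intro mult_mono) auto
    moreover have "((1 + a) / 4) * (c * (2 powr (- \<bar>r - 2\<bar>) * (1 + a) powr (r - 2))) = k r * (1 + a) powr (r - 1)"
      using that powr_mult_base[of "1 + a" "r - 2"] by (simp add: k_def)
    ultimately show ?thesis by (simp only:)
  qed
  have 1: "min (k p) (k m) * (1 + a) powr (p - 1) \<le> F a - F y" if a: "a \<ge> 1" and y: "y \<le> a / 2" for a y
  proof -
    obtain z where z: "a / 2 < z" "z < a" "F a - F (a / 2) = (a - a / 2) * G z" using F_mvt[of "a / 2" a] a by auto
    have "k p * (1 + a) powr (p - 1) \<le> (a / 2) * G z"
      using G_lower[of z] z a by (intro main[of a z]) (auto simp: side_def)
    also have "\<dots> = F a - F (a / 2)" using z(3) by simp
    also have "\<dots> \<le> F a - F y" using F_mono[OF y] by simp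
    finally have "k p * (1 + a) powr (p - 1) \<le> F a - F y" .
    moreover have "min (k p) (k m) * (1 + a) powr (p - 1) \<le> k p * (1 + a) powr (p - 1)" by (intro mult_right_mono) auto
    ultimately show ?thesis by linarith
  qed
  have 2: "min (k p) (k m) * (1 + \<bar>a\<bar>) powr (m - 1) \<le> F y - F a" if a: "a \<le> -1" and y: "y \<ge> a / 2" for a y
  proof -
    obtain z where z: "a < z" "z < a / 2" "F (a / 2) - F a = (a / 2 - a) * G z" using F_mvt[of a "a / 2"] a by auto
    have "k m * (1 + \<bar>a\<bar>) powr (m - 1) \<le> (\<bar>a\<bar> / 2) * G z"
      using G_lower[of z] z a by (intro main[of "\<bar>a\<bar>" "\<bar>z\<bar>"]) (auto simp: side_def)
    also have "\<dots> = F (a / 2) - F a" using z(3) a by simp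
    also have "\<dots> \<le> F y - F a" using F_mono[OF y] by simp
    finally have "k m * (1 + \<bar>a\<bar>) powr (m - 1) \<le> F y - F a" .
    moreover have "min (k p) (k m) * (1 + \<bar>a\<bar>) powr (m - 1) \<le> k m * (1 + \<bar>a\<bar>) powr (m - 1)" by (intro mult_right_mono) auto
    ultimately show ?thesis by linarith
  qed
  show ?thesis using k[of p] k[of m] 1 2 by (intro exI[of _ "min (k p) (k m)"]) auto
qed

lemma F_gap_signed: "\<exists>k>0. \<forall>s\<in>{1, -1}. \<forall>a y. 1 \<le> s * a \<longrightarrow> s * y \<le> s * a / 2 \<longrightarrow>
   k * (1 + \<bar>a\<bar>) powr (side p m a - 1) \<le> s * (F a - F y)"
proof -
  obtain k where k: "k > 0" "\<forall>a\<ge>1. \<forall>y\<le>a/2. k * (1 + a) powr (p - 1) \<le> F a - F y"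
    "\<forall>a\<le>-1. \<forall>y\<ge>a/2. k * (1 + \<bar>a\<bar>) powr (m - 1) \<le> F y - F a" using F_gap by blast
  show ?thesis
  proof (intro exI[of _ k] conjI ballI allI impI)
    fix s a y :: real assume "s \<in> {1, -1}" and a: "1 \<le> s * a" "s * y \<le> s * a / 2"
    then consider "s = 1" | "s = -1" by auto
    then show "k * (1 + \<bar>a\<bar>) powr (side p m a - 1) \<le> s * (F a - F y)"
    proof cases
      case 1
      with a k(2) show ?thesis by (auto simp: side_def)
    next
      case 2
      with a have "a \<le> -1" "y \<ge> a / 2" by auto
      with k(3) have "k * (1 + \<bar>a\<bar>) powr (m - 1) \<le> F y - F a" by blast
      with \<open>a \<le> -1\<close> 2 show ?thesis by (auto simp: side_def)
    qed
  qed (rule k(1))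
qed

end

text \<open>Outside [-1, 1], \<open>Gam\<close> is comparable to the square of 1 + |t|. Inside, f''
  attains a positive minimum and a maximum by continuity and the positivity of h, while powers of 1
  + |t| stay between 1/K and K.\<close>

lemma two_sided_growthI:
  fixes f h H :: "real \<Rightarrow> real"
  assumes "qp > 1" "qm > 1" "al > 0" "au > 0" and hpos: "\<And>t. h t > 0"
    and "\<And>t. t < -1 \<Longrightarrow> al * Gam \<bar>t\<bar> powr ((qm - 2) / 2) \<le> h t"
    and "\<And>t. t < -1 \<Longrightarrow> H t \<le> au * Gam \<bar>t\<bar> powr ((qm - 2) / 2)"
    and "\<And>t. t > 1 \<Longrightarrow> al * Gam \<bar>t\<bar> powr ((qp - 2) / 2) \<le> h t"
    and "\<And>t. t > 1 \<Longrightarrow> H t \<le> au * Gam \<bar>t\<bar> powr ((qp - 2) / 2)"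
    and "\<And>t. f t \<ge> 0" and C2: "C2_real f"
    and hl: "\<And>t. h t \<le> deriv (deriv f) t" and hu: "\<And>t. deriv (deriv f) t \<le> H t"
  shows "\<exists>c C. two_sided_growth f (deriv f) (deriv (deriv f)) qp qm c C"
proof -
  let ?G = "deriv (deriv f)"
  let ?X = "\<lambda>t. (1 + \<bar>t\<bar>) powr (side qp qm t - 2)"
  define r where "r = \<bar>qp - 2\<bar> + \<bar>qm - 2\<bar>"
  define K where "K = 2 powr r"
  have r: "\<bar>side qp qm t - 2\<bar> \<le> r" for t by (auto simp: side_def r_def)
  have K: "K \<ge> 1" unfolding K_def r_def by (simp add: ge_one_powr_ge_zero)
  have X: "?X t > 0" for t by (auto simp: powr_gt_zero)
  have cont: "continuous_on UNIV ?G" using C2 by (simp add: C2_real_def)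
  have Gpos: "?G t > 0" for t using hpos[of t] hl[of t] by linarith
  obtain t0 where t0: "\<forall>t\<in>{-1..1}. ?G t0 \<le> ?G t"
    using continuous_attains_inf[of "{-1..1::real}" ?G, OF _ _ continuous_on_subset[OF cont]] by auto
  obtain t1 where t1: "\<forall>t\<in>{-1..1}. ?G t \<le> ?G t1"
    using continuous_attains_sup[of "{-1..1::real}" ?G, OF _ _ continuous_on_subset[OF cont]] by auto
  have near: "1 / K \<le> ?X t" "?X t \<le> K" if "\<bar>t\<bar> \<le> 1" for t
  proof -
    let ?s = "side qp qm t - 2"
    have "2 powr (- \<bar>?s\<bar>) * 1 powr ?s \<le> (1 + \<bar>t\<bar>) powr ?s" "(1 + \<bar>t\<bar>) powr ?s \<le> 2 powr \<bar>?s\<bar> * 1 powr ?s"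
      using powr_comparable[of 2 1 "1 + \<bar>t\<bar>" ?s] that by simp_all
    moreover have "1 / K \<le> 2 powr (- \<bar>?s\<bar>)"
      unfolding K_def powr_minus_divide[symmetric] using r[of t] by (intro powr_mono) auto
    moreover have "2 powr \<bar>?s\<bar> \<le> K" unfolding K_def using r[of t] by (intro powr_mono) auto
    ultimately show "1 / K \<le> ?X t" "?X t \<le> K" by auto
  qed
  have far: "1 / K * ?X t \<le> Gam \<bar>t\<bar> powr ((side qp qm t - 2) / 2)" "Gam \<bar>t\<bar> powr ((side qp qm t - 2) / 2) \<le> K * ?X t" for t
  proof -
    let ?s = "(side qp qm t - 2) / 2"
    have eq: "((1 + \<bar>t\<bar>)\<^sup>2) powr ?s = ?X t"
    proof -
      have "(1 + \<bar>t\<bar>)\<^sup>2 = (1 + \<bar>t\<bar>) powr 2" by (simp add: powr_numeral)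
      then have "((1 + \<bar>t\<bar>)\<^sup>2) powr ?s = (1 + \<bar>t\<bar>) powr (2 * ?s)" by (simp only: powr_powr)
      moreover have "2 * ?s = side qp qm t - 2" by simp
      ultimately show ?thesis by (simp only:)
    qed
    \<comment> \<open>This square gives 2 |t| <= 1 + t^2, which is the lower comparison of
      \<open>Gam\<close>.\<close>
    have "0 \<le> (1 - \<bar>t\<bar>)\<^sup>2" by simp
    then have b: "(1 + \<bar>t\<bar>)\<^sup>2 / 2 \<le> Gam \<bar>t\<bar>" "Gam \<bar>t\<bar> \<le> 2 * (1 + \<bar>t\<bar>)\<^sup>2"
      by (auto simp: Gam_def power2_eq_square algebra_simps)
    have "2 powr (- \<bar>?s\<bar>) * ((1 + \<bar>t\<bar>)\<^sup>2) powr ?s \<le> Gam \<bar>t\<bar> powr ?s" "Gam \<bar>t\<bar> powr ?s \<le> 2 powr \<bar>?s\<bar> * ((1 + \<bar>t\<bar>)\<^sup>2) powr ?s"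
      by (rule powr_comparable; use b in \<open>simp add: zero_less_power\<close>)+
    moreover have "1 / K \<le> 2 powr (- \<bar>?s\<bar>)"
      unfolding K_def powr_minus_divide[symmetric] using r[of t] by (intro powr_mono) auto
    moreover have "2 powr \<bar>?s\<bar> \<le> K" unfolding K_def using r[of t] by (intro powr_mono) auto
    ultimately show "1 / K * ?X t \<le> Gam \<bar>t\<bar> powr ?s" "Gam \<bar>t\<bar> powr ?s \<le> K * ?X t"
      unfolding eq using X[of t] by (meson less_imp_le mult_right_mono order_trans)+
  qed
  define c where "c = min (?G t0 / K) (al / K)"
  define C where "C = max (?G t1 * K) (au * K)"
  have "c > 0" using Gpos[of t0] K assms(3) by (simp add: c_def)
  have lower: "c * ?X t \<le> ?G t" for t
  proof (cases "\<bar>t\<bar> \<le> 1")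
    case True
    have "c * ?X t \<le> (?G t0 / K) * K" using near[OF True] Gpos[of t0] K \<open>c > 0\<close> X[of t]
      by (intro mult_mono) (auto simp: c_def)
    also have "\<dots> = ?G t0" using K by simp
    also have "\<dots> \<le> ?G t" by (rule bspec[OF t0]) (use True in auto)
    finally show ?thesis .
  next
    case False
    have "c * ?X t \<le> (al / K) * ?X t" using X[of t] by (intro mult_right_mono) (auto simp: c_def)
    also have "\<dots> = al * (1 / K * ?X t)" by simp
    also have "\<dots> \<le> al * Gam \<bar>t\<bar> powr ((side qp qm t - 2) / 2)" using far(1)[of t] assms(3) by (intro mult_left_mono) auto
    also have "\<dots> \<le> h t" using False assms(6)[of t] assms(8)[of t] by (auto simp: side_def split: if_splits)
    finally show ?thesis using hl[of t] by linarith
  qed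
  have upper: "?G t \<le> C * ?X t" for t
  proof (cases "\<bar>t\<bar> \<le> 1")
    case True
    have "?G t \<le> ?G t1" by (rule bspec[OF t1]) (use True in auto)
    also have "\<dots> = (?G t1 * K) * (1 / K)" using K by simp
    also have "\<dots> \<le> C * ?X t" using near[OF True] Gpos[of t1] K
      by (intro mult_mono) (auto simp: C_def le_max_iff_disj)
    finally show ?thesis .
  next
    case False
    have "?G t \<le> H t" by (rule hu)
    also have "\<dots> \<le> au * Gam \<bar>t\<bar> powr ((side qp qm t - 2) / 2)" using False assms(7)[of t] assms(9)[of t] by (auto simp: side_def split: if_splits)
    also have "\<dots> \<le> au * (K * ?X t)" using far(2)[of t] assms(4) by (intro mult_left_mono) auto
    also have "\<dots> = (au * K) * ?X t" by simp
    also have "\<dots> \<le> C * ?X t" using X[of t] by (intro mult_right_mono) (auto simp: C_def)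
    finally show ?thesis .
  qed
  have d1: "(f has_real_derivative deriv f t) (at t)" for t
    using C2 by (auto simp: C2_real_def field_differentiable_derivI)
  have d2: "(deriv f has_real_derivative ?G t) (at t)" for t
    using C2 by (auto simp: C2_real_def field_differentiable_derivI)
  have "two_sided_growth f (deriv f) ?G qp qm c C"
    by unfold_locales (use assms(1,2,10) \<open>c > 0\<close> d1 d2 lower upper in auto)
  then show ?thesis by blast
qed

section \<open>Averages and local integrability\<close>

lemma compact_neighbourhood:
  fixes K :: "'a::euclidean_space set"
  assumes "compact K" "K \<subseteq> \<Omega>" "open \<Omega>"
  obtains K' r where "compact K'" "K' \<subseteq> \<Omega>" "r > 0" "\<And>x d. x \<in> K \<Longrightarrow> norm d \<le> r \<Longrightarrow> x + d \<in> K'"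
proof -
  obtain r where r: "r > 0" "(\<Union>x\<in>K. cball x r) \<subseteq> \<Omega>"
    using compact_subset_open_imp_cball_epsilon_subset[OF assms(1,3,2)] by auto
  show ?thesis
  proof (rule that[OF _ r(2,1)])
    show "compact (\<Union>x\<in>K. cball x r)" by (rule compact_minkowski_sum_cball[OF assms(1)])
    show "x + d \<in> (\<Union>x\<in>K. cball x r)" if "x \<in> K" "norm d \<le> r" for x d
      using that by (intro UN_I[of x]) (auto simp: dist_norm)
  qed
qed

lemma set_nn_integral_shift_le:
  fixes g :: "'a::euclidean_space \<Rightarrow> ennreal"
  assumes [measurable]: "g \<in> borel_measurable borel" "K' \<in> sets borel" and "\<And>x. x \<in> K \<Longrightarrow> x + a \<in> K'"
  shows "(\<integral>\<^sup>+x\<in>K. g (x + a) \<partial>lborel) \<le> (\<integral>\<^sup>+x\<in>K'. g x \<partial>lborel)"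
proof -
  have "(\<integral>\<^sup>+x\<in>K. g (x + a) \<partial>lborel) \<le> (\<integral>\<^sup>+x. g (x + a) * indicator K' (x + a) \<partial>lborel)"
    using assms(3) by (intro nn_integral_mono) (auto simp: indicator_def)
  also have "\<dots> = (\<integral>\<^sup>+x\<in>K'. g x \<partial>lborel)"
    by (intro nn_integral_lborel_shift[of "\<lambda>x. g x * indicator K' x"]) measurable
  finally show ?thesis .
qed

lemma set_nn_integral_average_le:
  fixes g :: "real \<Rightarrow> 'a::euclidean_space \<Rightarrow> ennreal"
  assumes m: "(\<lambda>(t, x). g t x) \<in> borel_measurable (borel \<Otimes>\<^sub>M borel)" and K[measurable]: "K \<in> sets borel"
    and le: "\<And>t. 0 \<le> t \<Longrightarrow> t \<le> 1 \<Longrightarrow> (\<integral>\<^sup>+x\<in>K. g t x \<partial>lborel) \<le> B"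
  shows "(\<integral>\<^sup>+x\<in>K. (\<integral>\<^sup>+t\<in>{0..1}. g t x \<partial>lborel) \<partial>lborel) \<le> B"
proof -
  have [measurable]: "(\<lambda>z. g (fst z) (snd z)) \<in> borel_measurable (borel \<Otimes>\<^sub>M borel)"
    using m by (simp add: case_prod_beta)
  have "(\<integral>\<^sup>+x\<in>K. (\<integral>\<^sup>+t\<in>{0..1}. g t x \<partial>lborel) \<partial>lborel) =
      (\<integral>\<^sup>+x. (\<integral>\<^sup>+t. g t x * indicator {0..1} t * indicator K x \<partial>lborel) \<partial>lborel)"
  proof (intro nn_integral_cong nn_integral_multc[symmetric])
    fix x
    have "(\<lambda>t. (\<lambda>z. g (fst z) (snd z)) (t, x)) \<in> borel_measurable lborel" by measurable
    then have [measurable]: "(\<lambda>t. g t x) \<in> borel_measurable lborel" by simp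
    show "(\<lambda>t. g t x * indicator {0..1} t) \<in> borel_measurable lborel" by measurable
  qed
  also have "\<dots> = (\<integral>\<^sup>+t. (\<integral>\<^sup>+x. g t x * indicator {0..1} t * indicator K x \<partial>lborel) \<partial>lborel)"
  proof (rule lborel_pair.Fubini')
    have "(\<lambda>(t, x). g t x * indicator {0..1} t * indicator K x) = 
       (\<lambda>z. g (fst z) (snd z) * indicator {0..1} (fst z) * indicator K (snd z))" by auto
    also have "\<dots> \<in> borel_measurable (lborel \<Otimes>\<^sub>M lborel)" by measurable
    finally show "(\<lambda>(t, x). g t x * indicator {0..1} t * indicator K x) \<in> borel_measurable (lborel \<Otimes>\<^sub>M lborel)" .
  qed
  also have "\<dots> \<le> (\<integral>\<^sup>+t. B * indicator {0..1} (t::real) \<partial>lborel)"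
  proof (rule nn_integral_mono)
    fix t :: real
    show "(\<integral>\<^sup>+x. g t x * indicator {0..1} t * indicator K x \<partial>lborel) \<le> B * indicator {0..1} t"
      using le[of t] by (cases "t \<in> {0..1}") auto
  qed
  also have "\<dots> = B" by (simp add: nn_integral_cmult_indicator)
  finally show ?thesis .
qed

text \<open>For integrable \<open>g\<close> the negative part is dropped; otherwise the left
  integral is 0 by convention.\<close>

lemma ennreal_integral_le: "ennreal (\<integral>x. g x \<partial>M) \<le> (\<integral>\<^sup>+x. ennreal (g x) \<partial>M)"
proof (cases "integrable M g")
  case True
  have "(\<integral>x. g x \<partial>M) \<le> enn2real (\<integral>\<^sup>+x. ennreal (g x) \<partial>M)"
    by (simp add: real_lebesgue_integral_def[OF True])
  then have "ennreal (\<integral>x. g x \<partial>M) \<le> ennreal (enn2real (\<integral>\<^sup>+x. ennreal (g x) \<partial>M))" by (rule ennreal_leI)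
  also have "\<dots> \<le> (\<integral>\<^sup>+x. ennreal (g x) \<partial>M)" by (simp add: ennreal_enn2real_if)
  finally show ?thesis .
qed (simp add: not_integrable_integral_eq)

section \<open>Convexity inequalities of Jensen and Young type\<close>

lemma powr_tangent:
  fixes m s p :: real
  assumes "p \<ge> 1" "m \<ge> 0" "s \<ge> 0"
  shows "(1 + m) powr p + p * (1 + m) powr (p - 1) * s \<le> (1 + s) powr p + p * (1 + m) powr (p - 1) * m"
proof -
  have d: "((\<lambda>x. x powr p) has_real_derivative p * x powr (p - 1)) (at x)" if "x > 0" for x :: real
    by (rule has_real_derivative_powr[OF that])
  have "convex_on {0<..} (\<lambda>x::real. x powr p)"
    by (rule convex_on_realI[where f' = "\<lambda>x. p * x powr (p - 1)"]) (use assms d in \<open>auto intro!: mult_left_mono powr_mono2\<close>)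
  moreover have "((\<lambda>x. x powr p) has_real_derivative p * (1 + m) powr (p - 1)) (at (1 + m) within {0<..})"
    using assms by (intro DERIV_subset[OF d]) auto
  ultimately have "(1 + s) powr p - (1 + m) powr p \<ge> p * (1 + m) powr (p - 1) * ((1 + s) - (1 + m))"
    using assms by (intro convex_on_imp_above_tangent[of "{0<..}"]) (auto simp: interior_open)
  then show ?thesis by (simp add: algebra_simps)
qed

text \<open>Jensen's inequality through the tangent at 1 + m. A lower bound \<open>m\<close> for the
  mean of the positive part suffices because the power is increasing. The finite term
  \<open>k * m\<close> is added on both sides and cancelled at the end, which avoids subtraction in
  [0, infinity].\<close>

lemma powr_jensen:
  fixes y :: "real \<Rightarrow> real"
  assumes [measurable]: "y \<in> borel_measurable borel" and p: "p \<ge> 1" and m: "m \<ge> 0"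
    and le: "ennreal m \<le> (\<integral>\<^sup>+t\<in>{0..1}. ennreal (y t) \<partial>lborel)"
  shows "ennreal ((1 + m) powr p) \<le> (\<integral>\<^sup>+t\<in>{0..1}. ennreal ((1 + max 0 (y t)) powr p) \<partial>lborel)"
proof -
  define k where "k = p * (1 + m) powr (p - 1)"
  have k: "k \<ge> 0" using p by (simp add: k_def)
  have one: "(\<integral>\<^sup>+t. ennreal c * indicator {0..1} (t::real) \<partial>lborel) = ennreal c" for c
    by (simp add: nn_integral_cmult_indicator)
  have "ennreal ((1 + m) powr p) + ennreal (k * m) \<le>
      ennreal ((1 + m) powr p) + ennreal k * (\<integral>\<^sup>+t\<in>{0..1}. ennreal (y t) \<partial>lborel)"
    using le k m by (intro add_mono) (auto simp: ennreal_mult intro: mult_left_mono)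
  also have "ennreal k * (\<integral>\<^sup>+t\<in>{0..1}. ennreal (y t) \<partial>lborel) = (\<integral>\<^sup>+t. ennreal k * (ennreal (y t) * indicator {0..1} t) \<partial>lborel)"
    by (rule nn_integral_cmult[symmetric]) measurable
  also have "ennreal ((1 + m) powr p) + \<dots> =
      (\<integral>\<^sup>+t. ennreal ((1 + m) powr p) * indicator {0..1} t + ennreal k * (ennreal (y t) * indicator {0..1} t) \<partial>lborel)"
    by (subst nn_integral_add) (auto simp: one)
  also have "\<dots> \<le> (\<integral>\<^sup>+t. ennreal ((1 + max 0 (y t)) powr p) * indicator {0..1} t + ennreal (k * m) * indicator {0..1} t \<partial>lborel)"
  proof (rule nn_integral_mono)
    fix t
    have "ennreal ((1 + m) powr p) + ennreal k * ennreal (y t) = ennreal ((1 + m) powr p + k * max 0 (y t))"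
      using k by (subst ennreal_plus) (auto simp: ennreal_mult' max_def ennreal_neg)
    also have "\<dots> \<le> ennreal ((1 + max 0 (y t)) powr p + k * m)"
      using powr_tangent[OF p m, of "max 0 (y t)"] by (intro ennreal_leI) (simp add: k_def)
    also have "\<dots> = ennreal ((1 + max 0 (y t)) powr p) + ennreal (k * m)"
      using k m by (intro ennreal_plus) auto
    finally show "ennreal ((1 + m) powr p) * indicator {0..1} t + ennreal k * (ennreal (y t) * indicator {0..1} t) \<le>
        ennreal ((1 + max 0 (y t)) powr p) * indicator {0..1} t + ennreal (k * m) * indicator {0..1} t"
      by (auto simp: indicator_def)
  qed
  also have "\<dots> = (\<integral>\<^sup>+t\<in>{0..1}. ennreal ((1 + max 0 (y t)) powr p) \<partial>lborel) + ennreal (k * m)"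
    by (subst nn_integral_add) (auto simp: one)
  finally show ?thesis
    by (simp add: add.commute[of _ "ennreal (k * m)"] ennreal_add_left_cancel_le)
qed

text \<open>Both factors are bounded by powers of \<open>X\<close>, the larger of the two terms on
  the right, with total exponent at most 1. As \<open>X\<close> is at least 1, an inequality between
  the exponents replaces conjugacy. This is why all masses are powers of 1 + |.|.\<close>

lemma young_powr:
  fixes A B a b \<alpha> \<beta> :: real
  assumes "A \<ge> 1" "B \<ge> 1" "a \<ge> 0" "b \<ge> 0" "\<alpha> > 0" "\<beta> > 0" "a / \<alpha> + b / \<beta> \<le> 1"
  shows "A powr a * B powr b \<le> A powr \<alpha> + B powr \<beta>"
proof -
  define X where "X = max (A powr \<alpha>) (B powr \<beta>)"
  have X: "X \<ge> 1" using assms by (simp add: X_def ge_one_powr_ge_zero le_max_iff_disj)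
  have "A powr a = (A powr \<alpha>) powr (a / \<alpha>)" using assms by (simp add: powr_powr)
  also have "\<dots> \<le> X powr (a / \<alpha>)" using assms by (intro powr_mono2) (auto simp: X_def)
  finally have 1: "A powr a \<le> X powr (a / \<alpha>)" .
  have "B powr b = (B powr \<beta>) powr (b / \<beta>)" using assms by (simp add: powr_powr)
  also have "\<dots> \<le> X powr (b / \<beta>)" using assms by (intro powr_mono2) (auto simp: X_def)
  finally have 2: "B powr b \<le> X powr (b / \<beta>)" .
  have "A powr a * B powr b \<le> X powr (a / \<alpha>) * X powr (b / \<beta>)" using 1 2 by (intro mult_mono) auto
  also have "\<dots> = X powr (a / \<alpha> + b / \<beta>)" by (simp add: powr_add)
  also have "\<dots> \<le> X powr 1" using X assms by (intro powr_mono) auto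
  also have "\<dots> \<le> A powr \<alpha> + B powr \<beta>" using X by (auto simp: X_def max_def)
  finally show ?thesis .
qed

section \<open>Scales of local integrability and of decay\<close>

lemma side_measurable[measurable]: "side p m \<in> borel_measurable borel"
  unfolding side_def by measurable

locale splitting_minimizer = bounded_minimizer f F \<Omega> U V M
  for f F :: "'n::finite \<Rightarrow> real \<Rightarrow> real" and \<Omega> U V M +
  fixes G :: "'n \<Rightarrow> real \<Rightarrow> real" and qp qm c C :: "'n \<Rightarrow> real"
  assumes growth: "\<And>j. two_sided_growth (f j) (F j) (G j) (qp j) (qm j) (c j) (C j)"
begin

lemma exponents: "qp j > 1" "qm j > 1"
  using two_sided_growth.exponents[OF growth] by auto

text \<open>By \<open>growth_bounds\<close>, over bounded sets this is as integrable as f_j(v) (1 +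
  |v|)^\<tau> for the j-th derivative v. As a pure power it fits Young's inequality
  directly.\<close>

definition mass :: "'n \<Rightarrow> real \<Rightarrow> real^'n \<Rightarrow> real" where
  "mass j \<tau> x = (1 + \<bar>V j x\<bar>) powr (side (qp j) (qm j) (V j x) + \<tau>)"

definition loc_int :: "'n \<Rightarrow> real \<Rightarrow> bool" where
  "loc_int j \<tau> \<longleftrightarrow> (\<forall>K. compact K \<longrightarrow> K \<subseteq> \<Omega> \<longrightarrow> (\<integral>\<^sup>+x\<in>K. ennreal (mass j \<tau> x) \<partial>lborel) < \<infinity>)"

abbreviation dir :: "'n \<Rightarrow> real^'n" where "dir i \<equiv> axis i 1"

definition good :: "'n \<Rightarrow> real \<Rightarrow> real^'n \<Rightarrow> real" where
  "good i h x = (F i (V i (x + h *\<^sub>R dir i)) - F i (V i x)) * (V i (x + h *\<^sub>R dir i) - V i x)"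

text \<open>A Nikolskii-type condition of order \<sigma> on the i-th derivative in its own
  direction, measured by the monotonicity product instead of a norm.\<close>

definition decay :: "'n \<Rightarrow> real \<Rightarrow> bool" where
  "decay i \<sigma> \<longleftrightarrow> (\<forall>K. compact K \<longrightarrow> K \<subseteq> \<Omega> \<longrightarrow> (\<exists>A\<ge>0. \<exists>h0>0. \<forall>h. 0 < h \<longrightarrow> h \<le> h0 \<longrightarrow>
      (\<integral>\<^sup>+x\<in>K. ennreal (good i h x) \<partial>lborel) \<le> ennreal (A * h powr \<sigma>)))"

lemma mass_measurable[measurable]: "mass j \<tau> \<in> borel_measurable borel"
  unfolding mass_def by measurable

lemma good_measurable[measurable]: "good i h \<in> borel_measurable borel"
  unfolding good_def by measurable

lemma mass_ge_1: "\<tau> \<ge> 0 \<Longrightarrow> mass j \<tau> x \<ge> 1"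
  using exponents[of j] unfolding mass_def by (auto simp: side_def intro!: ge_one_powr_ge_zero)

lemma F_product_nonneg: "(F j b - F j a) * (b - a) \<ge> 0"
  using F_mono[of a b j] F_mono[of b a j] by (cases "a \<le> b") (auto intro: mult_nonneg_nonneg mult_nonpos_nonpos)

lemma good_nonneg: "good i h x \<ge> 0"
  unfolding good_def by (rule F_product_nonneg)

lemma good_0: "good i 0 x = 0"
  by (simp add: good_def)

text \<open>Starting point of the iteration: finite energy and the lower growth bound, on a set of
  finite measure.\<close>

lemma loc_int_0: "loc_int j 0"
  unfolding loc_int_def
proof (intro allI impI)
  fix K :: "(real^'n) set" assume K: "compact K" "K \<subseteq> \<Omega>"
  then have [measurable]: "K \<in> sets borel" by (simp add: borel_compact)
  obtain A where A: "A > 0" "\<And>t. (1 + \<bar>t\<bar>) powr side (qp j) (qm j) t \<le> A * (1 + f j t)"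
    using two_sided_growth.growth_bounds[OF growth[of j]] by blast
  have i: "integrable lborel (\<lambda>x. indicator K x * f j (V j (x + 0)))"
    by (rule f_V_integrable) (use K in auto)
  have iK: "integrable lborel (\<lambda>x. indicator K x :: real)"
    using emeasure_compact_finite[OF K(1)] by (intro integrable_real_indicator) auto
  have "(\<integral>\<^sup>+x\<in>K. ennreal (mass j 0 x) \<partial>lborel) \<le> (\<integral>\<^sup>+x. ennreal (A * (indicator K x + indicator K x * f j (V j (x + 0)))) \<partial>lborel)"
    using A(2) by (intro nn_integral_mono) (auto simp: mass_def indicator_def intro!: ennreal_leI)
  also have "\<dots> < \<infinity>"
  proof -
    have "integrable lborel (\<lambda>x. A * (indicator K x + indicator K x * f j (V j (x + 0))))"
      by (intro integrable_mult_right Bochner_Integration.integrable_add i iK)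
    from integrableD(2)[OF this] show ?thesis
      using A(1) f_nonneg by (simp add: less_top[symmetric])
  qed
  finally show "(\<integral>\<^sup>+x\<in>K. ennreal (mass j 0 x) \<partial>lborel) < \<infinity>" .
qed

text \<open>Integrability is stated with the identity because the Bochner integral of a
  non-integrable function is 0 by default. The null set depends on \<open>h\<close>, so later
  arguments fix \<open>h\<close> before integrating over \<open>x\<close>.\<close>

lemma line_identity:
  assumes K: "compact K" "K \<subseteq> \<Omega>"
  obtains h0 where "h0 > 0" "\<And>h. 0 < h \<Longrightarrow> h \<le> h0 \<Longrightarrow> AE x in lborel. x \<in> K \<longrightarrow>
    integrable lborel (\<lambda>t. indicator {0..1} t * V i (x + (t * h) *\<^sub>R dir i)) \<and>
    U (x + h *\<^sub>R dir i) - U x = h * (\<integral>t. indicator {0..1} t * V i (x + (t * h) *\<^sub>R dir i) \<partial>lborel)"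
proof -
  obtain K' r where r: "compact K'" "K' \<subseteq> \<Omega>" "r > 0" "\<And>x d. x \<in> K \<Longrightarrow> norm d \<le> r \<Longrightarrow> x + d \<in> K'"
    using compact_neighbourhood[OF K open_domain] by blast
  let ?S = "\<Union>x\<in>K. ball x (r / 2)"
  show ?thesis
  proof (rule that[of "r / 2"])
    fix h :: real assume h: "0 < h" "h \<le> r / 2"
    have "AE x in lborel. x \<in> ?S \<longrightarrow>
      U (x + h *\<^sub>R dir i) - U x = h * (\<integral>t. indicator {0..1} t * V i (x + t *\<^sub>R (h *\<^sub>R dir i)) \<partial>lborel)"
    proof (rule weak_deriv_line_integral[OF weak])
      fix x t assume x: "x \<in> ?S" and t: "0 \<le> t" "t \<le> (1::real)"
      then obtain y where y: "y \<in> K" "dist y x < r / 2" by auto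
      have "t * h \<le> 1 * (r / 2)" using t h by (intro mult_mono) auto
      then have "norm (t *\<^sub>R (h *\<^sub>R dir i)) \<le> r / 2" using t h by (simp add: abs_mult)
      then have "norm ((x - y) + t *\<^sub>R (h *\<^sub>R dir i)) \<le> r"
        using y(2) norm_triangle_ineq[of "x - y" "t *\<^sub>R (h *\<^sub>R dir i)"] by (simp add: dist_norm norm_minus_commute)
      from r(4)[OF y(1) this] r(2) show "x + t *\<^sub>R (h *\<^sub>R dir i) \<in> \<Omega>" by (auto simp: algebra_simps)
    qed auto
    moreover have "AE x in lborel. integrable lborel (\<lambda>t. indicator {0..1} t * (V i (x + t *\<^sub>R (h *\<^sub>R dir i)) * 1))"
      using lborel_pair.AE_integrable_snd[OF line_average_integrable[OF V_integrable, of "\<lambda>x. 1" 1 i "h *\<^sub>R dir i"]] by simp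
    ultimately show "AE x in lborel. x \<in> K \<longrightarrow>
      integrable lborel (\<lambda>t. indicator {0..1} t * V i (x + (t * h) *\<^sub>R dir i)) \<and>
      U (x + h *\<^sub>R dir i) - U x = h * (\<integral>t. indicator {0..1} t * V i (x + (t * h) *\<^sub>R dir i) \<partial>lborel)"
    proof eventually_elim
      case (elim x)
      have "x \<in> ?S" if "x \<in> K" using that r(3) by (intro UN_I[of x]) auto
      with elim show ?case by simp
    qed
  qed (use r in auto)
qed

end

section \<open>From decay of increments to higher integrability\<close>

lemma AE_lborel_shift:
  fixes a :: "'a::euclidean_space"
  assumes "AE x in lborel. P x"
  shows "AE x in lborel. P (x + a)"
proof -
  have "AE x in distr lborel borel ((+) a). P x" by (subst lborel_distr_plus) (rule assms)
  from AE_distrD[OF _ this] show ?thesis by (simp add: add.commute)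
qed

context splitting_minimizer
begin

text \<open>The monotonicity product is at least A (|a|/2 - s z), an affine function of z. Where
  this is negative the product is still nonnegative; elsewhere z lies beyond a/2 and
  \<open>k\<close> applies. Averaging an affine bound involves only the mean of \<open>y\<close>,
  which is at most |a|/4 in modulus, so A |a|/4 remains.\<close>

lemma level_pointwise:
  fixes y :: "real \<Rightarrow> real"
  assumes k: "k > 0" "\<And>s a y. s \<in> {1, -1} \<Longrightarrow> 1 \<le> s * a \<Longrightarrow> s * y \<le> s * a / 2 \<Longrightarrow>
      k * (1 + \<bar>a\<bar>) powr (side (qp i) (qm i) a - 1) \<le> s * (F i a - F i y)"
    and y: "integrable lborel (\<lambda>t. indicator {0..1} t * y t)"
    and D: "\<bar>\<integral>t. indicator {0..1} t * y t \<partial>lborel\<bar> \<le> \<bar>a\<bar> / 4" and a: "\<bar>a\<bar> \<ge> 1"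
  shows "ennreal (k / 8 * (1 + \<bar>a\<bar>) powr side (qp i) (qm i) a) \<le>
    (\<integral>\<^sup>+t\<in>{0..1}. ennreal ((F i (y t) - F i a) * (y t - a)) \<partial>lborel)"
proof -
  define s where "s = (if a \<ge> 0 then 1 else -1 :: real)"
  have s: "s \<in> {1, -1}" "s * a = \<bar>a\<bar>" "s * s = 1" "\<bar>s\<bar> = 1" by (auto simp: s_def)
  define A where "A = k * (1 + \<bar>a\<bar>) powr (side (qp i) (qm i) a - 1)"
  have A: "A > 0" using k a by (simp add: A_def)
  have pw: "A * (\<bar>a\<bar> / 2 - s * z) \<le> (F i z - F i a) * (z - a)" for z
  proof (cases "s * z \<le> s * a / 2")
    case True
    have "A \<le> s * (F i a - F i z)" unfolding A_def using k(2)[OF s(1) _ True] s a by simp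
    moreover have "0 \<le> \<bar>a\<bar> / 2 - s * z" "\<bar>a\<bar> / 2 - s * z \<le> s * (a - z)" using True s by (auto simp: right_diff_distrib)
    ultimately have "A * (\<bar>a\<bar> / 2 - s * z) \<le> (s * (F i a - F i z)) * (s * (a - z))"
      using A by (intro mult_mono) auto
    also have "\<dots> = (s * s) * ((F i z - F i a) * (z - a))" by (simp add: algebra_simps)
    finally show ?thesis using s by simp
  next
    case False
    then have "A * (\<bar>a\<bar> / 2 - s * z) \<le> 0" using A s by (intro mult_nonneg_nonpos) auto
    with F_product_nonneg[of i z a] show ?thesis by linarith
  qed
  let ?D = "\<integral>t. indicator {0..1} t * y t \<partial>lborel"
  have i1: "integrable lborel (\<lambda>t::real. indicator {0..1} t * (A * \<bar>a\<bar> / 2))"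
    by (intro integrable_mult_left integrable_real_indicator) auto
  have i2: "integrable lborel (\<lambda>t. (A * s) * (indicator {0..1} t * y t))"
    using y by (rule integrable_mult_right)
  have eq: "(\<integral>t. indicator {0..1} t * (A * (\<bar>a\<bar> / 2 - s * y t)) \<partial>lborel) = A * (\<bar>a\<bar> / 2 - s * ?D)"
  proof -
    have "(\<integral>t. indicator {0..1} t * (A * (\<bar>a\<bar> / 2 - s * y t)) \<partial>lborel) =
        (\<integral>t. indicator {0..1} t * (A * \<bar>a\<bar> / 2) - (A * s) * (indicator {0..1} t * y t) \<partial>lborel)"
      by (simp add: algebra_simps)
    also have "\<dots> = (\<integral>t. indicator {0..1::real} t * (A * \<bar>a\<bar> / 2) \<partial>lborel) - (A * s) * ?D"
      by (subst Bochner_Integration.integral_diff[OF i1 i2]) (simp only: integral_mult_right_zero)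
    also have "(\<integral>t. indicator {0..1::real} t * (A * \<bar>a\<bar> / 2) \<partial>lborel) = A * \<bar>a\<bar> / 2"
      by simp
    finally show ?thesis by (simp add: algebra_simps)
  qed
  have "k / 8 * (1 + \<bar>a\<bar>) powr side (qp i) (qm i) a \<le> A * (\<bar>a\<bar> / 4)"
  proof -
    have "(1 + \<bar>a\<bar>) powr side (qp i) (qm i) a = (1 + \<bar>a\<bar>) powr (side (qp i) (qm i) a - 1) * (1 + \<bar>a\<bar>)"
      using powr_mult_base[of "1 + \<bar>a\<bar>" "side (qp i) (qm i) a - 1"] by (simp add: mult.commute)
    then have "k / 8 * (1 + \<bar>a\<bar>) powr side (qp i) (qm i) a = A * ((1 + \<bar>a\<bar>) / 8)" by (simp add: A_def)
    also have "\<dots> \<le> A * (\<bar>a\<bar> / 4)" using A a by (intro mult_left_mono) auto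
    finally show ?thesis .
  qed
  also have "\<dots> \<le> A * (\<bar>a\<bar> / 2 - s * ?D)"
  proof -
    have "s * ?D \<le> \<bar>a\<bar> / 4" using D s by (auto simp: abs_le_iff)
    then show ?thesis using A by (intro mult_left_mono) auto
  qed
  finally have "ennreal (k / 8 * (1 + \<bar>a\<bar>) powr side (qp i) (qm i) a) \<le> ennreal (\<integral>t. indicator {0..1} t * (A * (\<bar>a\<bar> / 2 - s * y t)) \<partial>lborel)"
    unfolding eq by (rule ennreal_leI)
  also have "\<dots> \<le> (\<integral>\<^sup>+t. ennreal (indicator {0..1} t * (A * (\<bar>a\<bar> / 2 - s * y t))) \<partial>lborel)"
    by (rule ennreal_integral_le)
  also have "\<dots> \<le> (\<integral>\<^sup>+t\<in>{0..1}. ennreal ((F i (y t) - F i a) * (y t - a)) \<partial>lborel)"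
    using pw by (intro nn_integral_mono) (auto simp: indicator_def intro!: ennreal_leI)
  finally show ?thesis .
qed

text \<open>If \<open>\<bar>V i x\<bar> > L = 8 M / h\<close>, then boundedness of \<open>U\<close> makes the mean of \<open>V i\<close> over the segment from
  \<open>x + h e\<^sub>i\<close> to \<open>x + 2 h e\<^sub>i\<close> much smaller than \<open>V i x\<close>, so that \<open>good\<close> must be large for steps in
  \<open>[h, 2h]\<close>.\<close>

lemma level_estimate:
  assumes dec: "decay i \<sigma>" and \<sigma>: "\<sigma> \<ge> 0" and K: "compact K" "K \<subseteq> \<Omega>"
  obtains A L0 where "A \<ge> 0" "L0 \<ge> 1" "\<And>L. L \<ge> L0 \<Longrightarrow>
    (\<integral>\<^sup>+x\<in>K. ennreal (mass i 0 x) * indicator {x. \<bar>V i x\<bar> > L} x \<partial>lborel) \<le> ennreal (A * L powr (- \<sigma>))"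
proof -
  obtain K' r where r: "compact K'" "K' \<subseteq> \<Omega>" "r > 0" "\<And>x d. x \<in> K \<Longrightarrow> norm d \<le> r \<Longrightarrow> x + d \<in> K'"
    using compact_neighbourhood[OF K open_domain] by blast
  obtain h0 where h0: "h0 > 0" "\<And>h. 0 < h \<Longrightarrow> h \<le> h0 \<Longrightarrow> AE x in lborel. x \<in> K' \<longrightarrow>
    integrable lborel (\<lambda>t. indicator {0..1} t * V i (x + (t * h) *\<^sub>R dir i)) \<and>
    U (x + h *\<^sub>R dir i) - U x = h * (\<integral>t. indicator {0..1} t * V i (x + (t * h) *\<^sub>R dir i) \<partial>lborel)"
    using line_identity[OF r(1,2), of i] by blast
  obtain A1 h1 where A1: "A1 \<ge> 0" "h1 > 0" "\<And>h. 0 < h \<Longrightarrow> h \<le> h1 \<Longrightarrow>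
      (\<integral>\<^sup>+x\<in>K. ennreal (good i h x) \<partial>lborel) \<le> ennreal (A1 * h powr \<sigma>)"
    using dec K unfolding decay_def by blast
  obtain k where k: "k > 0" "\<And>s a y. s \<in> {1, -1} \<Longrightarrow> 1 \<le> s * a \<Longrightarrow> s * y \<le> s * a / 2 \<Longrightarrow>
      k * (1 + \<bar>a\<bar>) powr (side (qp i) (qm i) a - 1) \<le> s * (F i a - F i y)"
    using two_sided_growth.F_gap_signed[OF growth[of i]] by blast
  have [measurable]: "K \<in> sets borel" using K by (simp add: borel_compact)
  \<comment> \<open>Steps up to 2 h will occur, hence \<open>h1 / 2\<close>; \<open>L0\<close> below
    expresses h <= hm through the level.\<close>
  define hm where "hm = min (min r h0) (h1 / 2)"
  have hm: "hm > 0" using r h0 A1 by (simp add: hm_def)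
  define L0 where "L0 = max 1 (8 * M / hm)"
  show ?thesis
  proof (rule that[of "8 / k * A1 * (16 * M) powr \<sigma>" L0])
    show "8 / k * A1 * (16 * M) powr \<sigma> \<ge> 0" using k A1 by simp
    show "L0 \<ge> 1" by (simp add: L0_def)
    fix L assume L: "L \<ge> L0"
    then have L1: "L \<ge> 1" by (simp add: L0_def)
    define h where "h = 8 * M / L"
    have h: "h > 0" using M_pos L1 by (simp add: h_def)
    have "8 * M / hm \<le> L" using L by (simp add: L0_def)
    then have "h \<le> hm" using hm L1 by (simp add: h_def field_simps)
    then have hle: "h \<le> r" "h \<le> h0" "2 * h \<le> h1" by (auto simp: hm_def)
    have "AE x in lborel. x + h *\<^sub>R dir i \<in> K' \<longrightarrow>
      integrable lborel (\<lambda>t. indicator {0..1} t * V i (x + h *\<^sub>R dir i + (t * h) *\<^sub>R dir i)) \<and>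
      U (x + h *\<^sub>R dir i + h *\<^sub>R dir i) - U (x + h *\<^sub>R dir i) =
        h * (\<integral>t. indicator {0..1} t * V i (x + h *\<^sub>R dir i + (t * h) *\<^sub>R dir i) \<partial>lborel)"
      by (rule AE_lborel_shift[OF h0(2)[OF h hle(2)]])
    then have ae: "AE x in lborel. ennreal (mass i 0 x) * indicator {x. \<bar>V i x\<bar> > L} x * indicator K x \<le>
        ennreal (8 / k) * ((\<integral>\<^sup>+t\<in>{0..1}. ennreal (good i ((1 + t) * h) x) \<partial>lborel) * indicator K x)"
    proof eventually_elim
      case (elim x)
      show ?case
      proof (cases "x \<in> K \<and> \<bar>V i x\<bar> > L")
        case True
        let ?y = "\<lambda>t. V i (x + h *\<^sub>R dir i + (t * h) *\<^sub>R dir i)"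
        have "x + h *\<^sub>R dir i \<in> K'" using True h hle by (intro r(4)) auto
        with elim have y: "integrable lborel (\<lambda>t. indicator {0..1} t * ?y t)"
          and u: "U (x + h *\<^sub>R dir i + h *\<^sub>R dir i) - U (x + h *\<^sub>R dir i) = h * (\<integral>t. indicator {0..1} t * ?y t \<partial>lborel)" by auto
        have "\<bar>h * (\<integral>t. indicator {0..1} t * ?y t \<partial>lborel)\<bar> \<le> 2 * M"
          unfolding u[symmetric] using U_bound[of "x + h *\<^sub>R dir i + h *\<^sub>R dir i"] U_bound[of "x + h *\<^sub>R dir i"] by linarith
        then have "h * \<bar>\<integral>t. indicator {0..1} t * ?y t \<partial>lborel\<bar> \<le> h * (L / 4)"
        proof -
          have "2 * M = h * (L / 4)" using L1 by (simp add: h_def)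
          moreover have "\<bar>h * D\<bar> = h * \<bar>D\<bar>" for D using h by (simp add: abs_mult)
          ultimately show ?thesis using \<open>\<bar>h * _\<bar> \<le> 2 * M\<close> by (simp only:)
        qed
        then have "\<bar>\<integral>t. indicator {0..1} t * ?y t \<partial>lborel\<bar> \<le> \<bar>V i x\<bar> / 4"
          using h True by (simp add: mult_le_cancel_left)
        then have lp: "ennreal (k / 8 * (1 + \<bar>V i x\<bar>) powr side (qp i) (qm i) (V i x)) \<le>
            (\<integral>\<^sup>+t\<in>{0..1}. ennreal ((F i (?y t) - F i (V i x)) * (?y t - V i x)) \<partial>lborel)"
          using True L1 by (intro level_pointwise[OF k y]) auto
        have gd: "(F i (?y t) - F i (V i x)) * (?y t - V i x) = good i ((1 + t) * h) x" for t
          by (simp add: good_def algebra_simps)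
        have "ennreal (mass i 0 x) = ennreal (8 / k) * ennreal (k / 8 * (1 + \<bar>V i x\<bar>) powr side (qp i) (qm i) (V i x))"
          using k(1) by (simp add: mass_def ennreal_mult[symmetric])
        also have "\<dots> \<le> ennreal (8 / k) * (\<integral>\<^sup>+t\<in>{0..1}. ennreal (good i ((1 + t) * h) x) \<partial>lborel)"
          using lp unfolding gd by (intro mult_left_mono) auto
        finally show ?thesis using True by simp
      qed auto
    qed
    have mg: "(\<lambda>(t, x). ennreal (good i ((1 + t) * h) x)) \<in> borel_measurable (borel \<Otimes>\<^sub>M borel)"
      unfolding good_def by measurable
    have mg': "(\<lambda>x. \<integral>\<^sup>+t\<in>{0..1}. ennreal (good i ((1 + t) * h) x) \<partial>lborel) \<in> borel_measurable borel"
      unfolding good_def by measurable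
    have "(\<integral>\<^sup>+x\<in>K. ennreal (mass i 0 x) * indicator {x. \<bar>V i x\<bar> > L} x \<partial>lborel) \<le>
        (\<integral>\<^sup>+x. ennreal (8 / k) * ((\<integral>\<^sup>+t\<in>{0..1}. ennreal (good i ((1 + t) * h) x) \<partial>lborel) * indicator K x) \<partial>lborel)"
      by (rule nn_integral_mono_AE[OF ae])
    also have "\<dots> = ennreal (8 / k) * (\<integral>\<^sup>+x\<in>K. (\<integral>\<^sup>+t\<in>{0..1}. ennreal (good i ((1 + t) * h) x) \<partial>lborel) \<partial>lborel)"
      by (intro nn_integral_cmult borel_measurable_times_ennreal) (use mg' in auto)
    also have "\<dots> \<le> ennreal (8 / k) * ennreal (A1 * (2 * h) powr \<sigma>)"
    proof (intro mult_left_mono set_nn_integral_average_le[OF mg])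
      fix t :: real assume t: "0 \<le> t" "t \<le> 1"
      have th: "0 < (1 + t) * h" "(1 + t) * h \<le> 2 * h" using t h by auto
      have "(\<integral>\<^sup>+x\<in>K. ennreal (good i ((1 + t) * h) x) \<partial>lborel) \<le> ennreal (A1 * ((1 + t) * h) powr \<sigma>)"
        using th hle by (intro A1(3)) auto
      also have "\<dots> \<le> ennreal (A1 * (2 * h) powr \<sigma>)"
        using th A1 \<sigma> by (intro ennreal_leI mult_left_mono powr_mono2) auto
      finally show "(\<integral>\<^sup>+x\<in>K. ennreal (good i ((1 + t) * h) x) \<partial>lborel) \<le> ennreal (A1 * (2 * h) powr \<sigma>)" .
    qed auto
    also have "\<dots> = ennreal (8 / k * (A1 * (2 * h) powr \<sigma>))"
      by (rule ennreal_mult[symmetric]) (use k(1) A1(1) in auto)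
    also have "8 / k * (A1 * (2 * h) powr \<sigma>) = 8 / k * A1 * (16 * M) powr \<sigma> * L powr (- \<sigma>)"
    proof -
      have "2 * h = (16 * M) / L" by (simp add: h_def)
      then have "(2 * h) powr \<sigma> = (16 * M) powr \<sigma> / L powr \<sigma>" using M_pos L1 by (simp add: powr_divide)
      then show ?thesis by (simp add: powr_minus_divide)
    qed
    finally show "(\<integral>\<^sup>+x\<in>K. ennreal (mass i 0 x) * indicator {x. \<bar>V i x\<bar> > L} x \<partial>lborel) \<le>
        ennreal (8 / k * A1 * (16 * M) powr \<sigma> * L powr (- \<sigma>))" .
  qed
qed

text \<open>Dyadic decomposition by the size of \<open>V i\<close>: on the layer at height 2^m the
  extra weight is of order 2^(m \<sigma>'), while \<open>level_estimate\<close> bounds the mass by a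
  multiple of 2^(- m \<sigma>). The geometric series converges because \<sigma>' < \<sigma>.\<close>

lemma decay_imp_loc_int:
  assumes dec: "decay i \<sigma>" and \<sigma>: "0 \<le> \<sigma>'" "\<sigma>' < \<sigma>"
  shows "loc_int i \<sigma>'"
  unfolding loc_int_def
proof (intro allI impI)
  fix K :: "(real^'n) set" assume K: "compact K" "K \<subseteq> \<Omega>"
  have [measurable]: "K \<in> sets borel" using K by (simp add: borel_compact)
  obtain A L0 where A: "A \<ge> 0" "L0 \<ge> 1" "\<And>L. L \<ge> L0 \<Longrightarrow>
    (\<integral>\<^sup>+x\<in>K. ennreal (mass i 0 x) * indicator {x. \<bar>V i x\<bar> > L} x \<partial>lborel) \<le> ennreal (A * L powr (- \<sigma>))"
    by (rule level_estimate[OF dec _ K]) (use \<sigma> in auto)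
  obtain n0 where n0: "L0 < 2 ^ n0" using real_arch_pow[of 2 L0] by auto
  have pw2: "(2 ^ N) powr z = (2::real) powr (real N * z)" for N z
    by (simp add: powr_realpow[symmetric] powr_powr)
  \<comment> \<open>On the layer between 2^(n + n0) and 2^(n + 1 + n0) one has 1 + |v| <= 2 * 2^(n +
    1 + n0), hence \<open>n + n0 + 2\<close>. The offset \<open>n0\<close> keeps all levels above
    \<open>L0\<close>.\<close>
  define T where "T n x = ennreal (2 powr (real (n + n0 + 2) * \<sigma>')) * (ennreal (mass i 0 x) * indicator {x. \<bar>V i x\<bar> > 2 ^ (n + n0)} x * indicator K x)" for n x
  have [measurable]: "T n \<in> borel_measurable borel" for n unfolding T_def by measurable
  define C0 where "C0 = (1 + 2 ^ n0) powr \<sigma>'"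
  have split: "mass i \<sigma>' x = mass i 0 x * (1 + \<bar>V i x\<bar>) powr \<sigma>'" for x
    by (simp add: mass_def powr_add)
  have pw: "ennreal (mass i \<sigma>' x) * indicator K x \<le> ennreal C0 * (ennreal (mass i 0 x) * indicator K x) + (\<Sum>n. T n x)" for x
  proof (cases "x \<in> K")
    case True
    show ?thesis
    proof (cases "\<bar>V i x\<bar> \<le> 2 ^ n0")
      case le: True
      have "mass i \<sigma>' x \<le> C0 * mass i 0 x"
        unfolding split C0_def mult.commute[of "mass i 0 x"] using le \<sigma> mass_ge_1[of 0 i x]
        by (intro mult_right_mono powr_mono2) auto
      then have "ennreal (mass i \<sigma>' x) \<le> ennreal C0 * ennreal (mass i 0 x)"
        using mass_ge_1[of 0 i x] by (subst ennreal_mult[symmetric]) (auto simp: C0_def intro!: ennreal_leI)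
      then show ?thesis using True by (simp add: add_increasing2)
    next
      case False
      have "\<exists>m. \<bar>V i x\<bar> \<le> 2 ^ (m + n0)"
      proof -
        obtain m where "\<bar>V i x\<bar> < 2 ^ m" using real_arch_pow[of 2 "\<bar>V i x\<bar>"] by auto
        moreover have "(2::real) ^ m \<le> 2 ^ (m + n0)" by (intro power_increasing) auto
        ultimately show ?thesis by (intro exI[of _ m]) linarith
      qed
      then obtain m where m: "\<not> \<bar>V i x\<bar> \<le> 2 ^ (m + n0)" "\<bar>V i x\<bar> \<le> 2 ^ (Suc m + n0)"
        using ex_least_nat_less[of "\<lambda>m. \<bar>V i x\<bar> \<le> 2 ^ (m + n0)"] False by (metis add_0 lessI order_refl)
      have "1 + \<bar>V i x\<bar> \<le> 2 ^ (m + n0 + 2)"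
      proof -
        have "(1::real) \<le> 2 ^ (Suc m + n0)" by (rule one_le_power) simp
        then have "1 + \<bar>V i x\<bar> \<le> 2 * 2 ^ (Suc m + n0)" using m(2) by linarith
        then show ?thesis by simp
      qed
      then have "(1 + \<bar>V i x\<bar>) powr \<sigma>' \<le> (2 ^ (m + n0 + 2)) powr \<sigma>'" using \<sigma> by (intro powr_mono2) auto
      also have "\<dots> = 2 powr (real (m + n0 + 2) * \<sigma>')" by (rule pw2)
      finally have "mass i \<sigma>' x \<le> 2 powr (real (m + n0 + 2) * \<sigma>') * mass i 0 x"
        unfolding split mult.commute[of "mass i 0 x"] using mass_ge_1[of 0 i x] by (intro mult_right_mono) auto
      then have "ennreal (mass i \<sigma>' x) \<le> T m x"
        unfolding T_def using True m(1) mass_ge_1[of 0 i x]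
        by (simp add: ennreal_mult[symmetric] ennreal_leI)
      also have "\<dots> \<le> (\<Sum>n. T n x)"
        using sum_le_suminf[of "\<lambda>n. T n x" "{m}"] by simp
      finally show ?thesis using True by (simp add: add_increasing)
    qed
  qed simp
  define b where "b n = 2 powr (real (n + n0 + 2) * \<sigma>') * (A * (2 ^ (n + n0)) powr (- \<sigma>))" for n
  have b: "b n = (A * 2 powr (real (n0 + 2) * \<sigma>' - real n0 * \<sigma>)) * (2 powr (\<sigma>' - \<sigma>)) ^ n" for n
  proof -
    have "(2 ^ (n + n0)) powr (- \<sigma>) = (2::real) powr (- real (n + n0) * \<sigma>)"
      by (simp only: pw2 mult_minus_right mult_minus_left)
    moreover have "(2 powr (\<sigma>' - \<sigma>)) ^ n = 2 powr ((\<sigma>' - \<sigma>) * real n)" by (simp add: powr_realpow[symmetric] powr_powr)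
    ultimately show ?thesis
      unfolding b_def by (simp add: powr_add[symmetric] mult_ac) (simp add: algebra_simps)
  qed
  have "2 powr (\<sigma>' - \<sigma>) < 2 powr (0::real)" using \<sigma> by (intro powr_less_mono) auto
  then have sb: "summable b" unfolding b by (intro summable_mult summable_geometric) simp
  have "(\<integral>\<^sup>+x\<in>K. ennreal (mass i \<sigma>' x) \<partial>lborel) \<le> (\<integral>\<^sup>+x. ennreal C0 * (ennreal (mass i 0 x) * indicator K x) + (\<Sum>n. T n x) \<partial>lborel)"
    by (rule nn_integral_mono[OF pw])
  also have "\<dots> = ennreal C0 * (\<integral>\<^sup>+x\<in>K. ennreal (mass i 0 x) \<partial>lborel) + (\<Sum>n. \<integral>\<^sup>+x. T n x \<partial>lborel)"
    by (simp add: nn_integral_add nn_integral_cmult nn_integral_suminf)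
  also have "\<dots> \<le> ennreal C0 * (\<integral>\<^sup>+x\<in>K. ennreal (mass i 0 x) \<partial>lborel) + (\<Sum>n. ennreal (b n))"
  proof (intro add_left_mono suminf_le)
    fix n
    have "L0 \<le> 2 ^ (n + n0)" 
      using n0 power_increasing[of n0 "n + n0" "2::real"] by linarith
    have "(\<integral>\<^sup>+x. T n x \<partial>lborel) = ennreal (2 powr (real (n + n0 + 2) * \<sigma>')) *
        (\<integral>\<^sup>+x\<in>K. ennreal (mass i 0 x) * indicator {x. \<bar>V i x\<bar> > 2 ^ (n + n0)} x \<partial>lborel)"
      unfolding T_def by (intro nn_integral_cmult) measurable
    also have "\<dots> \<le> ennreal (2 powr (real (n + n0 + 2) * \<sigma>')) * ennreal (A * (2 ^ (n + n0)) powr (- \<sigma>))"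
      by (intro mult_left_mono A(3)[OF \<open>L0 \<le> 2 ^ (n + n0)\<close>]) auto
    also have "\<dots> = ennreal (b n)" using A(1) by (simp add: b_def ennreal_mult)
    finally show "(\<integral>\<^sup>+x. T n x \<partial>lborel) \<le> ennreal (b n)" .
  qed auto
  also have "\<dots> < \<infinity>"
  proof -
    have "(\<Sum>n. ennreal (b n)) = ennreal (suminf b)"
      using A(1) by (intro suminf_ennreal2 sb) (simp add: b_def)
    moreover have "(\<integral>\<^sup>+x\<in>K. ennreal (mass i 0 x) \<partial>lborel) < \<infinity>" using loc_int_0[of i] K by (auto simp: loc_int_def)
    ultimately show ?thesis by (simp add: ennreal_mult_less_top)
  qed
  finally show "(\<integral>\<^sup>+x\<in>K. ennreal (mass i \<sigma>' x) \<partial>lborel) < \<infinity>" .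
qed

end

section \<open>The Caccioppoli inequality\<close>

text \<open>Completing the square; half of the quadratic term \<beta>^2 X is kept for the left side
  of the Caccioppoli inequality.\<close>

lemma cauchy_absorb:
  fixes P X L \<beta> \<gamma> \<Delta> :: real
  assumes "P\<^sup>2 \<le> L * X" "L > 0"
  shows "2 * \<beta> * \<gamma> * \<Delta> * P \<ge> - (1/2 * \<beta>\<^sup>2 * X) - 2 * \<gamma>\<^sup>2 * \<Delta>\<^sup>2 * L"
proof -
  have "0 \<le> (\<beta> * P + 2 * \<gamma> * \<Delta> * L)\<^sup>2 / (2 * L)" using assms(2) by simp
  also have "\<dots> = 1/2 * \<beta>\<^sup>2 * (P\<^sup>2 / L) + 2 * \<beta> * \<gamma> * \<Delta> * P + 2 * \<gamma>\<^sup>2 * \<Delta>\<^sup>2 * L"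
    using assms(2) by (simp add: power2_eq_square field_simps)
  also have "1/2 * \<beta>\<^sup>2 * (P\<^sup>2 / L) \<le> 1/2 * \<beta>\<^sup>2 * X"
    using assms by (intro mult_left_mono) (auto simp: field_simps)
  finally show ?thesis by linarith
qed

text \<open>Monotonicity together with the Lipschitz bound gives (F b - F a)^2 <= L (F b - F a)(b -
  a), so the mixed term is absorbed. The base step uses this for every index, the improvement step
  for j different from i.\<close>

lemma monotone_term_lower:
  fixes F :: "real \<Rightarrow> real"
  assumes mono: "\<And>s t. s \<le> t \<Longrightarrow> F s \<le> F t" and L: "\<bar>F b - F a\<bar> \<le> L * \<bar>b - a\<bar>" "L > 0"
  shows "(F b - F a) * (\<beta>\<^sup>2 * (b - a) + 2 * \<beta> * \<gamma> * \<Delta>) \<ge> 1/2 * \<beta>\<^sup>2 * ((F b - F a) * (b - a)) - 2 * \<gamma>\<^sup>2 * \<Delta>\<^sup>2 * L"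
proof -
  have "\<bar>F b - F a\<bar> * \<bar>b - a\<bar> = (F b - F a) * (b - a)"
    using mono[of a b] mono[of b a] by (cases "a \<le> b") (auto simp: abs_if algebra_simps)
  moreover have "\<bar>F b - F a\<bar> * \<bar>F b - F a\<bar> \<le> \<bar>F b - F a\<bar> * (L * \<bar>b - a\<bar>)"
    using L by (intro mult_left_mono) auto
  ultimately have "(F b - F a)\<^sup>2 \<le> L * ((F b - F a) * (b - a))"
    by (metis abs_mult_self_eq mult.left_commute power2_eq_square)
  note c = cauchy_absorb[OF this L(2), of \<beta> \<gamma> \<Delta>]
  have "(F b - F a) * (\<beta>\<^sup>2 * (b - a) + 2 * \<beta> * \<gamma> * \<Delta>) =
      \<beta>\<^sup>2 * ((F b - F a) * (b - a)) + 2 * \<beta> * \<gamma> * \<Delta> * (F b - F a)" by (simp add: algebra_simps)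
  with c show ?thesis by linarith
qed

text \<open>The increment of \<open>F\<close> splits into \<open>?P\<close> over the positive and
  \<open>?N\<close> over the negative half-line, of equal sign. Only \<open>?P\<close> is absorbed,
  so \<open>L\<close> sees the exponent at plus infinity alone; \<open>?N\<close> stays linear in
  \<Delta> and is estimated by its two ends.\<close>

lemma monotone_term_clamped:
  fixes F :: "real \<Rightarrow> real"
  assumes mono: "\<And>s t. s \<le> t \<Longrightarrow> F s \<le> F t"
    and L: "\<bar>F (max 0 b) - F (max 0 a)\<bar> \<le> L * \<bar>max 0 b - max 0 a\<bar>" "L > 0" and \<beta>: "\<beta> \<ge> 0" and \<Delta>: "\<Delta> \<ge> 0"
  shows "(F b - F a) * (\<beta>\<^sup>2 * (b - a) + 2 * \<beta> * \<gamma> * \<Delta>) \<ge> 1/2 * \<beta>\<^sup>2 * ((F b - F a) * (b - a)) - 2 * \<gamma>\<^sup>2 * \<Delta>\<^sup>2 * L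
    - 2 * \<beta> * \<bar>\<gamma>\<bar> * \<Delta> * (\<bar>F (min 0 a) - F 0\<bar> + \<bar>F (min 0 b) - F 0\<bar>)"
proof -
  let ?P = "F (max 0 b) - F (max 0 a)" and ?N = "F (min 0 b) - F (min 0 a)"
  let ?p = "max 0 b - max 0 a" and ?n = "min 0 b - min 0 a"
  have FPN: "F b - F a = ?P + ?N" by (auto simp: max_def min_def)
  have pn: "b - a = ?p + ?n" by (auto simp: max_def min_def)
  have "?P * ?p \<le> (F b - F a) * (b - a)"
  proof (cases "a \<le> b")
    case True
    then have "0 \<le> ?P" "0 \<le> ?N" "0 \<le> ?p" "0 \<le> ?n" by (auto intro!: mono)
    then show ?thesis unfolding FPN pn by (intro mult_mono) auto
  next
    case False
    then have "?P \<le> 0" "?N \<le> 0" "?p \<le> 0" "?n \<le> 0" by (auto intro!: mono)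
    then have "(- ?P) * (- ?p) \<le> (- (?P + ?N)) * (- (?p + ?n))" by (intro mult_mono) auto
    then show ?thesis unfolding FPN pn by (simp only: minus_mult_minus)
  qed
  then have X: "1/2 * \<beta>\<^sup>2 * (?P * ?p) \<le> 1/2 * \<beta>\<^sup>2 * ((F b - F a) * (b - a))" by (intro mult_left_mono) auto
  have "?P * (\<beta>\<^sup>2 * ?p + 2 * \<beta> * \<gamma> * \<Delta>) \<ge> 1/2 * \<beta>\<^sup>2 * (?P * ?p) - 2 * \<gamma>\<^sup>2 * \<Delta>\<^sup>2 * L"
    by (rule monotone_term_lower[of F "max 0 b" "max 0 a" L, OF mono L])
  then have 1: "2 * \<beta> * \<gamma> * \<Delta> * ?P \<ge> - (1/2 * \<beta>\<^sup>2 * (?P * ?p)) - 2 * \<gamma>\<^sup>2 * \<Delta>\<^sup>2 * L" by (simp add: algebra_simps)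
  have "\<bar>2 * \<beta> * \<gamma> * \<Delta> * ?N\<bar> = 2 * \<beta> * \<bar>\<gamma>\<bar> * \<Delta> * \<bar>?N\<bar>" using \<beta> \<Delta> by (simp add: abs_mult)
  also have "\<dots> \<le> 2 * \<beta> * \<bar>\<gamma>\<bar> * \<Delta> * (\<bar>F (min 0 a) - F 0\<bar> + \<bar>F (min 0 b) - F 0\<bar>)"
    using \<beta> \<Delta> by (intro mult_left_mono) auto
  finally have 2: "2 * \<beta> * \<gamma> * \<Delta> * ?N \<ge> - (2 * \<beta> * \<bar>\<gamma>\<bar> * \<Delta> * (\<bar>F (min 0 a) - F 0\<bar> + \<bar>F (min 0 b) - F 0\<bar>))" by linarith
  have "(F b - F a) * (\<beta>\<^sup>2 * (b - a) + 2 * \<beta> * \<gamma> * \<Delta>) =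
      \<beta>\<^sup>2 * ((F b - F a) * (b - a)) + 2 * \<beta> * \<gamma> * \<Delta> * (F b - F a)" by (simp add: algebra_simps)
  also have "2 * \<beta> * \<gamma> * \<Delta> * (F b - F a) = 2 * \<beta> * \<gamma> * \<Delta> * ?P + 2 * \<beta> * \<gamma> * \<Delta> * ?N"
    unfolding FPN by (rule distrib_left)
  finally show ?thesis using X 1 2 by linarith
qed

context splitting_minimizer
begin

section \<open>Weights and fluxes adapted to the sign of the increment\<close>

definition qside :: "'n \<Rightarrow> real \<Rightarrow> real" where
  "qside i s = (if s > 0 then qp i else qm i)"

definition wside :: "'n \<Rightarrow> real \<Rightarrow> real \<Rightarrow> real" where
  "wside i s t = (1 + max 0 (s * t)) powr max 0 (qside i s - 2)"

text \<open>Vanishes unless \<open>t\<close> has the sign opposite to \<open>s\<close>; with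
  \<open>s\<close> the sign of the increment it records the part not absorbed by clamping.\<close>

definition cross :: "'n \<Rightarrow> real \<Rightarrow> real \<Rightarrow> real" where
  "cross i s t = \<bar>F i (- s * max 0 (- s * t)) - F i 0\<bar>"

text \<open>The j-th summand of the integrand in \<open>difference_equation\<close> for the cutoff
  \<beta>^2.\<close>

definition flux :: "'n \<Rightarrow> (real^'n \<Rightarrow> real) \<Rightarrow> real^'n \<Rightarrow> real^'n \<Rightarrow> real" where
  "flux j \<beta> a x = (F j (V j (x + a)) - F j (V j x)) *
    ((\<beta> x)\<^sup>2 * (V j (x + a) - V j x) + 2 * \<beta> x * partial j \<beta> x * (U (x + a) - U x))"

lemma C_pos: "C j > 0"
  by (rule two_sided_growth.C_pos[OF growth])

lemma F_lipschitz: "\<bar>F j b - F j a\<bar> \<le> C j * (weight (qp j) (qm j) a + weight (qp j) (qm j) b) * \<bar>b - a\<bar>"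
  by (rule two_sided_growth.F_lipschitz[OF growth])

lemma weight_sum_pos: "C j * (weight (qp j) (qm j) a + weight (qp j) (qm j) b) > 0"
  using C_pos[of j] weight_ge_1[of "qp j" "qm j" a] weight_ge_1[of "qp j" "qm j" b] by (intro mult_pos_pos) auto

lemma wside_ge_1: "wside i s t \<ge> 1"
  by (simp add: wside_def ge_one_powr_ge_zero)

lemma weight_clamp: "s \<in> {1, -1} \<Longrightarrow> weight (qp i) (qm i) (s * max 0 (s * t)) = wside i s t"
  by (auto simp: weight_def wside_def qside_def side_def max_def)

lemma flux_lower:
  "flux j \<beta> a x \<ge> 1/2 * (\<beta> x)\<^sup>2 * ((F j (V j (x + a)) - F j (V j x)) * (V j (x + a) - V j x)) -
    2 * (partial j \<beta> x)\<^sup>2 * (U (x + a) - U x)\<^sup>2 * (C j * (weight (qp j) (qm j) (V j x) + weight (qp j) (qm j) (V j (x + a))))"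
  unfolding flux_def by (rule monotone_term_lower[OF F_mono F_lipschitz weight_sum_pos])

text \<open>A negative increment is reduced to a positive one by reflecting \<open>F i\<close> to
  the function t -> - F i (- t).\<close>

lemma clamped_lower:
  assumes s: "s \<in> {1, -1}" and \<Delta>: "s * \<Delta> \<ge> 0" and \<beta>: "\<beta> \<ge> 0"
  shows "(F i b - F i a) * (\<beta>\<^sup>2 * (b - a) + 2 * \<beta> * \<gamma> * \<Delta>) \<ge> 1/2 * \<beta>\<^sup>2 * ((F i b - F i a) * (b - a)) -
    2 * \<gamma>\<^sup>2 * \<Delta>\<^sup>2 * (C i * (wside i s a + wside i s b)) - 2 * \<beta> * \<bar>\<gamma>\<bar> * \<bar>\<Delta>\<bar> * (cross i s a + cross i s b)"
proof -
  let ?L = "C i * (wside i s a + wside i s b)"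
  have L: "?L > 0" using C_pos[of i] wside_ge_1[of i s a] wside_ge_1[of i s b] by (intro mult_pos_pos) auto
  have lip: "\<bar>F i (s * max 0 (s * b)) - F i (s * max 0 (s * a))\<bar> \<le> ?L * \<bar>s * max 0 (s * b) - s * max 0 (s * a)\<bar>"
    using F_lipschitz[of i "s * max 0 (s * b)" "s * max 0 (s * a)"] by (simp add: weight_clamp[OF s])
  consider "s = 1" | "s = -1" using s by auto
  then show ?thesis
  proof cases
    case 1
    have mm: "- max 0 (- t) = min 0 t" for t :: real by auto
    have "(F i b - F i a) * (\<beta>\<^sup>2 * (b - a) + 2 * \<beta> * \<gamma> * \<Delta>) \<ge> 1/2 * \<beta>\<^sup>2 * ((F i b - F i a) * (b - a)) -
      2 * \<gamma>\<^sup>2 * \<Delta>\<^sup>2 * ?L - 2 * \<beta> * \<bar>\<gamma>\<bar> * \<Delta> * (\<bar>F i (min 0 a) - F i 0\<bar> + \<bar>F i (min 0 b) - F i 0\<bar>)"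
      using lip 1 \<Delta> by (intro monotone_term_clamped[OF F_mono _ L \<beta>]) auto
    then show ?thesis using 1 \<Delta> by (simp add: cross_def mm)
  next
    case 2
    let ?F = "\<lambda>t. - F i (- t)"
    have mm: "- min 0 (- t) = max 0 t" for t :: real by auto
    have ab: "\<bar>- F i x + F i 0\<bar> = \<bar>F i x - F i 0\<bar>" for x by (simp add: abs_minus_commute)
    have "(?F (- b) - ?F (- a)) * (\<beta>\<^sup>2 * (- b - - a) + 2 * \<beta> * \<gamma> * (- \<Delta>)) \<ge> 1/2 * \<beta>\<^sup>2 * ((?F (- b) - ?F (- a)) * (- b - - a)) -
      2 * \<gamma>\<^sup>2 * (- \<Delta>)\<^sup>2 * ?L - 2 * \<beta> * \<bar>\<gamma>\<bar> * (- \<Delta>) * (\<bar>?F (min 0 (- a)) - ?F 0\<bar> + \<bar>?F (min 0 (- b)) - ?F 0\<bar>)"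
      using lip 2 \<Delta> by (intro monotone_term_clamped[OF _ _ L \<beta>]) (auto simp: F_mono abs_minus_commute)
    moreover have "(?F (- b) - ?F (- a)) * (\<beta>\<^sup>2 * (- b - - a) + 2 * \<beta> * \<gamma> * (- \<Delta>)) = (F i b - F i a) * (\<beta>\<^sup>2 * (b - a) + 2 * \<beta> * \<gamma> * \<Delta>)"
      "(?F (- b) - ?F (- a)) * (- b - - a) = (F i b - F i a) * (b - a)" by (simp_all add: algebra_simps)
    ultimately show ?thesis using 2 \<Delta> by (simp add: cross_def mm ab abs_minus_commute[of "F i 0"])
  qed
qed

text \<open>The common frame of both Caccioppoli estimates. With the cutoff \<beta>^2 the mixed
  terms carry a factor \<beta>, so they can be absorbed pointwise; the total flux has integral at
  most 0, which leaves only the error \<open>E\<close>. If \<open>E\<close> has infinite integral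
  the claim is trivial.\<close>

lemma good_bound:
  assumes \<beta>: "\<beta> \<in> test_functions \<Omega>" "\<And>x. 0 \<le> \<beta> x" "\<And>x. \<beta> x \<le> 1"
    and a: "\<And>x. x \<in> closure {x. \<beta> x \<noteq> 0} \<Longrightarrow> x + h *\<^sub>R dir i \<in> \<Omega>"
    and E: "E \<in> borel_measurable borel" "\<And>x. E x \<ge> 0"
    and le: "\<And>x. x \<in> closure {x. \<beta> x \<noteq> 0} \<Longrightarrow> 1/2 * (\<beta> x)\<^sup>2 * good i h x \<le> (\<Sum>j\<in>UNIV. flux j \<beta> (h *\<^sub>R dir i) x) + E x"
    and K: "\<kappa> > 0" "\<And>x. x \<in> K \<Longrightarrow> \<beta> x \<ge> \<kappa>"
  shows "(\<integral>\<^sup>+x\<in>K. ennreal (good i h x) \<partial>lborel) \<le> ennreal (2 / \<kappa>\<^sup>2) * (\<integral>\<^sup>+x\<in>closure {x. \<beta> x \<noteq> 0}. ennreal (E x) \<partial>lborel)"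
proof (cases "(\<integral>\<^sup>+x\<in>closure {x. \<beta> x \<noteq> 0}. ennreal (E x) \<partial>lborel) < \<infinity>")
  case False
  then have "(\<integral>\<^sup>+x\<in>closure {x. \<beta> x \<noteq> 0}. ennreal (E x) \<partial>lborel) = \<infinity>" by (simp add: less_top[symmetric])
  then show ?thesis using K(1) by (simp add: ennreal_mult_top)
next
  case fin: True
  let ?S = "closure {x. \<beta> x \<noteq> 0}" and ?a = "h *\<^sub>R dir i"
  note [measurable] = E(1) test_functions_measurable[OF \<beta>(1)]
  define \<zeta> where "\<zeta> x = \<beta> x * \<beta> x" for x
  have \<zeta>: "\<zeta> \<in> test_functions \<Omega>"
    unfolding \<zeta>_def by (rule test_functions_mult[OF \<beta>(1) test_functionsD(1)[OF \<beta>(1)]])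
  have \<zeta>01: "0 \<le> \<zeta> x" "\<zeta> x \<le> 1" for x using \<beta>(2,3)[of x] by (auto simp: \<zeta>_def mult_le_one)
  have supp: "{x. \<zeta> x \<noteq> 0} = {x. \<beta> x \<noteq> 0}" by (auto simp: \<zeta>_def)
  have p\<zeta>: "partial j \<zeta> x = 2 * \<beta> x * partial j \<beta> x" for j x
    unfolding \<zeta>_def by (subst partial_mult[OF test_functionsD(2)[OF \<beta>(1)] test_functionsD(2)[OF \<beta>(1)]]) simp
  define I where "I x = (\<Sum>j\<in>UNIV. (F j (V j (x + ?a)) - F j (V j x)) * variation \<zeta> ?a j x)" for x
  have I: "I x = (\<Sum>j\<in>UNIV. flux j \<beta> ?a x)" for x
    by (simp add: I_def flux_def variation_def \<zeta>_def p\<zeta> power2_eq_square)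
  have iI: "integrable lborel I" and I0: "(\<integral>x. I x \<partial>lborel) \<le> 0"
    unfolding I_def using difference_equation[OF \<zeta> \<zeta>01, of ?a] a by (simp_all add: supp)
  have Iout: "I x = 0" if "x \<notin> ?S" for x
    using variation_outside[OF \<zeta>, of x ?a] that by (simp add: I_def supp)
  have iE: "integrable lborel (\<lambda>x. E x * indicator ?S x)"
  proof (rule integrableI_nonneg)
    have "(\<integral>\<^sup>+x. ennreal (E x * indicator ?S x) \<partial>lborel) = (\<integral>\<^sup>+x\<in>?S. ennreal (E x) \<partial>lborel)"
      by (intro nn_integral_cong) (auto simp: indicator_def)
    then show "(\<integral>\<^sup>+x. ennreal (E x * indicator ?S x) \<partial>lborel) < \<infinity>" using fin by simp
  qed (use E(2) in auto)
  have main: "1/2 * (\<beta> x)\<^sup>2 * good i h x \<le> I x + E x * indicator ?S x" for x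
  proof (cases "x \<in> ?S")
    case True
    then show ?thesis using le[of x] by (simp add: I)
  next
    case False
    then show ?thesis using Iout[OF False] test_functions_zero_outside(1)[OF \<beta>(1) False] by simp
  qed
  have "ennreal (\<kappa>\<^sup>2 / 2) * (\<integral>\<^sup>+x\<in>K. ennreal (good i h x) \<partial>lborel) \<le> (\<integral>\<^sup>+x. ennreal (I x + E x * indicator ?S x) \<partial>lborel)"
  proof -
    have "ennreal (\<kappa>\<^sup>2 / 2) * (\<integral>\<^sup>+x\<in>K. ennreal (good i h x) \<partial>lborel) \<le> ennreal (\<kappa>\<^sup>2 / 2) * (\<integral>\<^sup>+x. ennreal (good i h x) * indicator {x. \<beta> x \<ge> \<kappa>} x \<partial>lborel)"
      using K(2) by (intro mult_left_mono nn_integral_mono) (auto simp: indicator_def)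
    also have "\<dots> = (\<integral>\<^sup>+x. ennreal (\<kappa>\<^sup>2 / 2) * (ennreal (good i h x) * indicator {x. \<beta> x \<ge> \<kappa>} x) \<partial>lborel)"
      by (rule nn_integral_cmult[symmetric]) measurable
    also have "\<dots> \<le> (\<integral>\<^sup>+x. ennreal (I x + E x * indicator ?S x) \<partial>lborel)"
    proof (rule nn_integral_mono)
      fix x
      show "ennreal (\<kappa>\<^sup>2 / 2) * (ennreal (good i h x) * indicator {x. \<beta> x \<ge> \<kappa>} x) \<le> ennreal (I x + E x * indicator ?S x)"
      proof (cases "\<beta> x \<ge> \<kappa>")
        case True
        have "\<kappa>\<^sup>2 / 2 * good i h x \<le> 1/2 * (\<beta> x)\<^sup>2 * good i h x"
          using True K(1) good_nonneg[of i h x] by (intro mult_right_mono) (auto intro!: power_mono)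
        also have "\<dots> \<le> I x + E x * indicator ?S x" by (rule main)
        finally show ?thesis using True good_nonneg[of i h x] by (simp add: ennreal_mult[symmetric] ennreal_leI)
      qed simp
    qed
    finally show ?thesis .
  qed
  also have "\<dots> = ennreal (\<integral>x. I x + E x * indicator ?S x \<partial>lborel)"
  proof (intro nn_integral_eq_integral Bochner_Integration.integrable_add iI iE AE_I2)
    fix x
    have "0 \<le> 1/2 * (\<beta> x)\<^sup>2 * good i h x" using good_nonneg[of i h x] by simp
    then show "0 \<le> I x + E x * indicator ?S x" using main[of x] by linarith
  qed
  also have "\<dots> \<le> ennreal (\<integral>x. E x * indicator ?S x \<partial>lborel)"
    using I0 iI iE by (intro ennreal_leI) simp
  also have "\<dots> = (\<integral>\<^sup>+x. ennreal (E x * indicator ?S x) \<partial>lborel)"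
    using E(2) iE by (intro nn_integral_eq_integral[symmetric]) auto
  also have "\<dots> = (\<integral>\<^sup>+x\<in>?S. ennreal (E x) \<partial>lborel)"
    by (intro nn_integral_cong) (auto simp: indicator_def)
  finally have *: "ennreal (\<kappa>\<^sup>2 / 2) * (\<integral>\<^sup>+x\<in>K. ennreal (good i h x) \<partial>lborel) \<le> (\<integral>\<^sup>+x\<in>?S. ennreal (E x) \<partial>lborel)" .
  have "ennreal (2 / \<kappa>\<^sup>2) * (ennreal (\<kappa>\<^sup>2 / 2) * (\<integral>\<^sup>+x\<in>K. ennreal (good i h x) \<partial>lborel)) \<le> ennreal (2 / \<kappa>\<^sup>2) * (\<integral>\<^sup>+x\<in>?S. ennreal (E x) \<partial>lborel)"
    by (rule mult_left_mono[OF *]) simp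
  moreover have "ennreal (2 / \<kappa>\<^sup>2) * (ennreal (\<kappa>\<^sup>2 / 2) * z) = z" for z
    using K(1) by (simp add: mult.assoc[symmetric] ennreal_mult[symmetric])
  ultimately show ?thesis by simp
qed

text \<open>\<kappa> is the minimum of the positive continuous \<beta> over the compact
  \<open>K\<close>; \<open>K1\<close> holds the support of \<beta> together with its translates by
  vectors of length up to \<open>r\<close>.\<close>

lemma cutoff:
  assumes K: "compact K" "K \<subseteq> \<Omega>"
  obtains \<beta> \<kappa> B K1 r where "\<beta> \<in> test_functions \<Omega>" "\<And>x. 0 \<le> \<beta> x" "\<And>x. \<beta> x \<le> 1"
    "\<kappa> > 0" "\<And>x. x \<in> K \<Longrightarrow> \<beta> x \<ge> \<kappa>" "B > 0" "\<And>j x. \<bar>partial j \<beta> x\<bar> \<le> B"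
    "compact K1" "K1 \<subseteq> \<Omega>" "r > 0" "\<And>x d. x \<in> closure {x. \<beta> x \<noteq> 0} \<Longrightarrow> norm d \<le> r \<Longrightarrow> x + d \<in> K1"
proof -
  obtain \<beta>0 where b: "\<beta>0 \<in> test_functions \<Omega>" "\<And>x. \<beta>0 x \<ge> 0" "\<And>x. x \<in> K \<Longrightarrow> \<beta>0 x > 0"
    using test_function_positive_on_compact[OF K open_domain] by blast
  obtain B0 where B0: "B0 > 0" "\<And>x. \<bar>\<beta>0 x\<bar> \<le> B0" using test_functions_bounded[OF b(1)] by blast
  define \<beta> where "\<beta> x = \<beta>0 x * (1 / B0)" for x
  have \<beta>: "\<beta> \<in> test_functions \<Omega>" unfolding \<beta>_def by (rule test_functions_mult[OF b(1) C_k_const])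
  have 01: "0 \<le> \<beta> x" "\<beta> x \<le> 1" for x using b(2)[of x] B0(1) B0(2)[of x] by (auto simp: \<beta>_def field_simps)
  have pos: "\<beta> x > 0" if "x \<in> K" for x using b(3)[OF that] B0(1) by (simp add: \<beta>_def)
  obtain \<kappa> where \<kappa>: "\<kappa> > 0" "\<And>x. x \<in> K \<Longrightarrow> \<beta> x \<ge> \<kappa>"
  proof (cases "K = {}")
    case True
    then show ?thesis using that[of 1] by simp
  next
    case False
    obtain x0 where "x0 \<in> K" "\<And>x. x \<in> K \<Longrightarrow> \<beta> x0 \<le> \<beta> x"
      using continuous_attains_inf[OF K(1) False continuous_on_subset[OF test_functionsD(3)[OF \<beta>] subset_UNIV]] by blast
    then show ?thesis using that[of "\<beta> x0"] pos by blast
  qed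
  obtain B where B: "B > 0" "\<And>j x. \<bar>partial j \<beta> x\<bar> \<le> B" using test_functions_bounded[OF \<beta>] by blast
  obtain K1 r where "compact K1" "K1 \<subseteq> \<Omega>" "r > 0" "\<And>x d. x \<in> closure {x. \<beta> x \<noteq> 0} \<Longrightarrow> norm d \<le> r \<Longrightarrow> x + d \<in> K1"
    using compact_neighbourhood[OF test_functionsD(5,6)[OF \<beta>] open_domain] by blast
  from that[OF \<beta> 01 \<kappa> B this] show ?thesis .
qed

end

section \<open>Improving the decay of increments\<close>

text \<open>Interpolation: of the two powers of the increment h z, 2 - \<rho> are paid by the bound
  2 M, and the remaining \<rho> give h^\<rho> at the cost of the power \<rho> of the difference
  quotient z.\<close>

lemma square_le_powr:
  fixes h z M \<rho> :: real
  assumes "0 < h" "0 \<le> z" "h * z \<le> 2 * M" "0 < \<rho>" "\<rho> \<le> 2"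
  shows "(h * z)\<^sup>2 \<le> (2 * M) powr (2 - \<rho>) * h powr \<rho> * (1 + z) powr \<rho>"
proof (cases "z = 0")
  case False
  then have z: "z > 0" "h * z > 0" using assms by auto
  have "(h * z)\<^sup>2 = (h * z) powr 2" using z by (simp add: powr_numeral)
  also have "\<dots> = (h * z) powr (2 - \<rho>) * (h * z) powr \<rho>" by (simp add: powr_add[symmetric])
  also have "(h * z) powr \<rho> = h powr \<rho> * z powr \<rho>" using assms z by (simp add: powr_mult)
  also have "(h * z) powr (2 - \<rho>) * (h powr \<rho> * z powr \<rho>) \<le> (2 * M) powr (2 - \<rho>) * (h powr \<rho> * (1 + z) powr \<rho>)"
  proof (rule mult_mono)
    show "(h * z) powr (2 - \<rho>) \<le> (2 * M) powr (2 - \<rho>)" using assms z by (intro powr_mono2) auto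
    show "h powr \<rho> * z powr \<rho> \<le> h powr \<rho> * (1 + z) powr \<rho>" using assms z by (intro mult_left_mono powr_mono2) auto
  qed auto
  finally show ?thesis by (simp add: mult.assoc)
qed simp

lemma nn_integral_sum_le:
  fixes p :: "'b \<Rightarrow> 'a::euclidean_space \<Rightarrow> real"
  assumes J: "finite J" and e: "\<And>j. j \<in> J \<Longrightarrow> e j \<ge> 0" and p: "\<And>j x. j \<in> J \<Longrightarrow> p j x \<ge> 0"
    and m: "\<And>j. j \<in> J \<Longrightarrow> p j \<in> borel_measurable borel" and K[measurable]: "K \<in> sets borel"
    and n: "\<And>j. j \<in> J \<Longrightarrow> n j \<ge> 0" and le: "\<And>j. j \<in> J \<Longrightarrow> (\<integral>\<^sup>+x\<in>K. ennreal (p j x) \<partial>lborel) \<le> ennreal (n j)"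
  shows "(\<integral>\<^sup>+x\<in>K. ennreal (\<Sum>j\<in>J. e j * p j x) \<partial>lborel) \<le> ennreal (\<Sum>j\<in>J. e j * n j)"
proof -
  have "(\<integral>\<^sup>+x\<in>K. ennreal (\<Sum>j\<in>J. e j * p j x) \<partial>lborel) = (\<integral>\<^sup>+x. (\<Sum>j\<in>J. ennreal (e j) * (ennreal (p j x) * indicator K x)) \<partial>lborel)"
  proof (rule nn_integral_cong)
    fix x
    have "ennreal (\<Sum>j\<in>J. e j * p j x) = (\<Sum>j\<in>J. ennreal (e j * p j x))"
      using e p by (intro sum_ennreal[symmetric]) auto
    also have "\<dots> = (\<Sum>j\<in>J. ennreal (e j) * ennreal (p j x))"
      using e p by (intro sum.cong refl ennreal_mult) auto
    finally show "ennreal (\<Sum>j\<in>J. e j * p j x) * indicator K x = (\<Sum>j\<in>J. ennreal (e j) * (ennreal (p j x) * indicator K x))"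
      by (simp add: sum_distrib_right mult.assoc)
  qed
  also have "\<dots> = (\<Sum>j\<in>J. \<integral>\<^sup>+x. ennreal (e j) * (ennreal (p j x) * indicator K x) \<partial>lborel)"
    using m by (intro nn_integral_sum) auto
  also have "\<dots> = (\<Sum>j\<in>J. ennreal (e j) * (\<integral>\<^sup>+x\<in>K. ennreal (p j x) \<partial>lborel))"
    using m by (intro sum.cong refl nn_integral_cmult) auto
  also have "\<dots> \<le> (\<Sum>j\<in>J. ennreal (e j) * ennreal (n j))"
    using le by (intro sum_mono mult_left_mono) auto
  also have "\<dots> = (\<Sum>j\<in>J. ennreal (e j * n j))"
    using e n by (intro sum.cong refl ennreal_mult[symmetric]) auto
  also have "\<dots> = ennreal (\<Sum>j\<in>J. e j * n j)"
    using e n by (intro sum_ennreal) auto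
  finally show ?thesis .
qed

context splitting_minimizer
begin

lemma weight_le_mass: "weight (qp j) (qm j) (V j x) \<le> mass j 0 x"
  using exponents[of j] unfolding weight_def mass_def by (intro powr_mono) (auto simp: side_def)

lemma mass_nonneg: "0 \<le> mass j \<tau> x"
  by (simp add: mass_def)

definition mass_on :: "'n \<Rightarrow> real \<Rightarrow> (real^'n) set \<Rightarrow> real" where
  "mass_on j \<tau> K = enn2real (\<integral>\<^sup>+x\<in>K. ennreal (mass j \<tau> x) \<partial>lborel)"

lemma mass_on_nonneg: "mass_on j \<tau> K \<ge> 0"
  by (simp add: mass_on_def)

lemma nn_integral_mass:
  assumes "loc_int j \<tau>" "compact K" "K \<subseteq> \<Omega>"
  shows "(\<integral>\<^sup>+x\<in>K. ennreal (mass j \<tau> x) \<partial>lborel) = ennreal (mass_on j \<tau> K)"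
  using assms unfolding loc_int_def mass_on_def by (simp add: ennreal_enn2real)

lemma nn_integral_mass_shift_le:
  assumes "loc_int j \<tau>" "compact K1" "K1 \<subseteq> \<Omega>" "\<And>x. x \<in> K \<Longrightarrow> x + a \<in> K1"
  shows "(\<integral>\<^sup>+x\<in>K. ennreal (mass j \<tau> (x + a)) \<partial>lborel) \<le> ennreal (mass_on j \<tau> K1)"
  unfolding nn_integral_mass[OF assms(1-3), symmetric]
  by (rule set_nn_integral_shift_le[of "\<lambda>x. ennreal (mass j \<tau> x)"]) (use assms(2,4) in \<open>auto simp: borel_compact\<close>)

lemma nn_integral_mass_pair_le:
  assumes "loc_int j \<tau>" "compact K1" "K1 \<subseteq> \<Omega>" "\<And>x. x \<in> K \<Longrightarrow> x + 0 \<in> K1" "\<And>x. x \<in> K \<Longrightarrow> x + a \<in> K1"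
    and [measurable]: "K \<in> sets borel"
  shows "(\<integral>\<^sup>+x\<in>K. ennreal (mass j \<tau> x + mass j \<tau> (x + a)) \<partial>lborel) \<le> ennreal (2 * mass_on j \<tau> K1)"
proof -
  have "(\<integral>\<^sup>+x\<in>K. ennreal (mass j \<tau> x + mass j \<tau> (x + a)) \<partial>lborel) =
      (\<integral>\<^sup>+x. ennreal (mass j \<tau> (x + 0)) * indicator K x + ennreal (mass j \<tau> (x + a)) * indicator K x \<partial>lborel)"
    by (intro nn_integral_cong) (simp add: ennreal_plus mass_nonneg distrib_right)
  also have "\<dots> = (\<integral>\<^sup>+x\<in>K. ennreal (mass j \<tau> (x + 0)) \<partial>lborel) + (\<integral>\<^sup>+x\<in>K. ennreal (mass j \<tau> (x + a)) \<partial>lborel)"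
    by (rule nn_integral_add) measurable
  also have "\<dots> \<le> ennreal (mass_on j \<tau> K1) + ennreal (mass_on j \<tau> K1)"
    by (intro add_mono nn_integral_mass_shift_le assms)
  also have "\<dots> = ennreal (2 * mass_on j \<tau> K1)"
    using mass_on_nonneg[of j \<tau> K1] by (simp add: ennreal_plus[symmetric] del: ennreal_plus)
  finally show ?thesis .
qed

text \<open>The increment is at most 2 M and the weights are at most the mass of order 0, so the
  error is bounded uniformly in \<open>h\<close>.\<close>

lemma decay_0: "decay i 0"
  unfolding decay_def
proof (intro allI impI)
  fix K :: "(real^'n) set" assume K: "compact K" "K \<subseteq> \<Omega>"
  obtain \<beta> \<kappa> B K1 r where \<beta>: "\<beta> \<in> test_functions \<Omega>" "\<And>x. 0 \<le> \<beta> x" "\<And>x. \<beta> x \<le> 1"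
    and \<kappa>: "\<kappa> > 0" "\<And>x. x \<in> K \<Longrightarrow> \<beta> x \<ge> \<kappa>" and B: "B > 0" "\<And>j x. \<bar>partial j \<beta> x\<bar> \<le> B"
    and K1: "compact K1" "K1 \<subseteq> \<Omega>" "r > 0" "\<And>x d. x \<in> closure {x. \<beta> x \<noteq> 0} \<Longrightarrow> norm d \<le> r \<Longrightarrow> x + d \<in> K1"
    using cutoff[OF K] by blast
  let ?S = "closure {x. \<beta> x \<noteq> 0}"
  have [measurable]: "K1 \<in> sets borel" using K1 by (simp add: borel_compact)
  have S[measurable]: "?S \<in> sets borel" by auto
  define e where "e j = 2 * B\<^sup>2 * (2 * M)\<^sup>2 * C j" for j
  have e: "e j \<ge> 0" for j using C_pos[of j] by (simp add: e_def)
  define N where "N = (\<Sum>j\<in>UNIV. e j * (2 * mass_on j 0 K1))"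
  have N: "N \<ge> 0" unfolding N_def by (intro sum_nonneg mult_nonneg_nonneg e mass_on_nonneg) auto
  show "\<exists>A\<ge>0. \<exists>h0>0. \<forall>h. 0 < h \<longrightarrow> h \<le> h0 \<longrightarrow> (\<integral>\<^sup>+x\<in>K. ennreal (good i h x) \<partial>lborel) \<le> ennreal (A * h powr 0)"
  proof (rule exI[of _ "2 / \<kappa>\<^sup>2 * N"], rule conjI[rotated], rule exI[of _ r], rule conjI[rotated], intro allI impI)
    fix h :: real assume h: "0 < h" "h \<le> r"
    let ?a = "h *\<^sub>R dir i"
    have a: "x + ?a \<in> K1" if "x \<in> ?S" for x using that h by (intro K1(4)) auto
    have a0: "x + 0 \<in> K1" if "x \<in> ?S" for x using that K1(3) by (intro K1(4)) auto
    define E where "E x = (\<Sum>j\<in>UNIV. e j * (mass j 0 x + mass j 0 (x + ?a)))" for x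
    have E0: "E x \<ge> 0" for x unfolding E_def
      by (intro sum_nonneg mult_nonneg_nonneg add_nonneg_nonneg e mass_nonneg)
    have "(\<integral>\<^sup>+x\<in>K. ennreal (good i h x) \<partial>lborel) \<le> ennreal (2 / \<kappa>\<^sup>2) * (\<integral>\<^sup>+x\<in>?S. ennreal (E x) \<partial>lborel)"
    proof (rule good_bound[OF \<beta> _ _ E0 _ \<kappa>])
      show "x + ?a \<in> \<Omega>" if "x \<in> ?S" for x using a[OF that] K1(2) by auto
      show "E \<in> borel_measurable borel" unfolding E_def by measurable
      fix x
      \<comment> \<open>Only the index i keeps its monotone term; those of the other indices are
        nonnegative and are dropped.\<close>
      have "(if j = i then 1/2 * (\<beta> x)\<^sup>2 * good i h x else 0) \<le> flux j \<beta> ?a x + e j * (mass j 0 x + mass j 0 (x + ?a))" for j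
      proof -
        have "2 * (partial j \<beta> x)\<^sup>2 * (U (x + ?a) - U x)\<^sup>2 * (C j * (weight (qp j) (qm j) (V j x) + weight (qp j) (qm j) (V j (x + ?a))))
            \<le> 2 * B\<^sup>2 * (2 * M)\<^sup>2 * (C j * (mass j 0 x + mass j 0 (x + ?a)))"
        proof (intro mult_mono add_mono weight_le_mass)
          show "(partial j \<beta> x)\<^sup>2 \<le> B\<^sup>2" using B(2)[of j x] B(1) by (simp add: abs_le_square_iff[symmetric])
          have "\<bar>U (x + ?a) - U x\<bar> \<le> \<bar>2 * M\<bar>" using U_bound[of x] U_bound[of "x + ?a"] by linarith
          then show "(U (x + ?a) - U x)\<^sup>2 \<le> (2 * M)\<^sup>2" by (simp only: abs_le_square_iff)
        qed (use C_pos[of j] in \<open>auto intro!: mult_nonneg_nonneg add_nonneg_nonneg simp: weight_def\<close>)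
        moreover have "0 \<le> 1/2 * (\<beta> x)\<^sup>2 * ((F j (V j (x + ?a)) - F j (V j x)) * (V j (x + ?a) - V j x))"
          by (rule mult_nonneg_nonneg[OF _ F_product_nonneg]) simp
        moreover have "2 * B\<^sup>2 * (2 * M)\<^sup>2 * (C j * (mass j 0 x + mass j 0 (x + ?a))) = e j * (mass j 0 x + mass j 0 (x + ?a))"
          by (simp only: e_def mult.assoc)
        ultimately have main: "1/2 * (\<beta> x)\<^sup>2 * ((F j (V j (x + ?a)) - F j (V j x)) * (V j (x + ?a) - V j x)) \<le> flux j \<beta> ?a x + e j * (mass j 0 x + mass j 0 (x + ?a))"
          and nn: "0 \<le> flux j \<beta> ?a x + e j * (mass j 0 x + mass j 0 (x + ?a))"
          using flux_lower[of \<beta> x j ?a] by linarith+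
        show ?thesis
        proof (cases "j = i")
          case True
          with main show ?thesis by (simp add: good_def)
        next
          case False
          with nn show ?thesis by simp
        qed
      qed
      then have "(\<Sum>j\<in>UNIV. if j = i then 1/2 * (\<beta> x)\<^sup>2 * good i h x else 0) \<le> (\<Sum>j\<in>UNIV. flux j \<beta> ?a x + e j * (mass j 0 x + mass j 0 (x + ?a)))"
        by (rule sum_mono)
      then show "1/2 * (\<beta> x)\<^sup>2 * good i h x \<le> (\<Sum>j\<in>UNIV. flux j \<beta> ?a x) + E x"
        by (simp add: E_def sum.distrib)
    qed
    also have "(\<integral>\<^sup>+x\<in>?S. ennreal (E x) \<partial>lborel) \<le> ennreal N"
      unfolding E_def N_def
      by (intro nn_integral_sum_le e add_nonneg_nonneg mass_nonneg nn_integral_mass_pair_le loc_int_0 K1(1,2) a a0 S)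
        (auto simp: mass_on_nonneg)
    finally have *: "(\<integral>\<^sup>+x\<in>K. ennreal (good i h x) \<partial>lborel) \<le> ennreal (2 / \<kappa>\<^sup>2) * ennreal N"
      by (simp add: mult_left_mono)
    show "(\<integral>\<^sup>+x\<in>K. ennreal (good i h x) \<partial>lborel) \<le> ennreal (2 / \<kappa>\<^sup>2 * N * h powr 0)"
    proof -
      have "ennreal (2 / \<kappa>\<^sup>2) * ennreal N = ennreal (2 / \<kappa>\<^sup>2 * N * h powr 0)"
        using h N by (subst ennreal_mult[symmetric]) auto
      with * show ?thesis by simp
    qed
  qed (use N \<kappa> K1 in auto)
qed

section \<open>Difference quotients as means of the weak derivative\<close>

definition quot :: "'n \<Rightarrow> real \<Rightarrow> real^'n \<Rightarrow> real" where
  "quot i h x = (U (x + h *\<^sub>R dir i) - U x) / h"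

lemma quot_measurable[measurable]: "quot i h \<in> borel_measurable borel"
  unfolding quot_def by measurable

lemma quot_bound: "h > 0 \<Longrightarrow> h * \<bar>quot i h x\<bar> \<le> 2 * M"
  using U_bound[of x] U_bound[of "x + h *\<^sub>R dir i"] by (simp add: quot_def abs_mult)

text \<open>Because \<open>ennreal\<close> truncates, the factor \<open>s\<close> selects one sign:
  the positive part of s times the quotient is at most the mean of the positive part of s times the
  derivative. Signs are kept apart so that each meets its own exponent.\<close>

lemma quot_average:
  assumes K: "compact K" "K \<subseteq> \<Omega>"
  obtains h0 where "h0 > 0" "\<And>h s. 0 < h \<Longrightarrow> h \<le> h0 \<Longrightarrow> AE x in lborel. x \<in> K \<longrightarrow>
    ennreal (s * quot i h x) \<le> (\<integral>\<^sup>+t\<in>{0..1}. ennreal (s * V i (x + (t * h) *\<^sub>R dir i)) \<partial>lborel)"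
proof -
  obtain h0 where h0: "h0 > 0" "\<And>h. 0 < h \<Longrightarrow> h \<le> h0 \<Longrightarrow> AE x in lborel. x \<in> K \<longrightarrow>
    integrable lborel (\<lambda>t. indicator {0..1} t * V i (x + (t * h) *\<^sub>R dir i)) \<and>
    U (x + h *\<^sub>R dir i) - U x = h * (\<integral>t. indicator {0..1} t * V i (x + (t * h) *\<^sub>R dir i) \<partial>lborel)"
    using line_identity[OF K, of i] by blast
  show ?thesis
  proof (rule that[OF h0(1)])
    fix h s :: real assume h: "0 < h" "h \<le> h0"
    from h0(2)[OF h] show "AE x in lborel. x \<in> K \<longrightarrow>
      ennreal (s * quot i h x) \<le> (\<integral>\<^sup>+t\<in>{0..1}. ennreal (s * V i (x + (t * h) *\<^sub>R dir i)) \<partial>lborel)"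
    proof eventually_elim
      case (elim x)
      show ?case
      proof
        assume "x \<in> K"
        with elim h have "quot i h x = (\<integral>t. indicator {0..1} t * V i (x + (t * h) *\<^sub>R dir i) \<partial>lborel)"
          by (simp add: quot_def)
        then have "s * quot i h x = (\<integral>t. s * (indicator {0..1} t * V i (x + (t * h) *\<^sub>R dir i)) \<partial>lborel)" by simp
        then have "ennreal (s * quot i h x) \<le> (\<integral>\<^sup>+t. ennreal (s * (indicator {0..1} t * V i (x + (t * h) *\<^sub>R dir i))) \<partial>lborel)"
          by (simp only: ennreal_integral_le)
        also have "\<dots> = (\<integral>\<^sup>+t\<in>{0..1}. ennreal (s * V i (x + (t * h) *\<^sub>R dir i)) \<partial>lborel)"
          by (intro nn_integral_cong) (auto simp: indicator_def)
        finally show "ennreal (s * quot i h x) \<le> (\<integral>\<^sup>+t\<in>{0..1}. ennreal (s * V i (x + (t * h) *\<^sub>R dir i)) \<partial>lborel)" .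
      qed
    qed
  qed
qed

lemma side_le_mass:
  assumes "s \<in> {1, -1}" "\<sigma> \<ge> 0"
  shows "(1 + max 0 (s * V i x)) powr (qside i s + \<sigma>) \<le> mass i \<sigma> x"
proof (cases "s * V i x > 0")
  case True
  then show ?thesis using assms(1) by (auto simp: mass_def qside_def side_def)
next
  case False
  then have "(1 + max 0 (s * V i x)) powr (qside i s + \<sigma>) = 1" by (simp add: max_def)
  then show ?thesis using mass_ge_1[OF assms(2)] by simp
qed

lemma qside_gt_1: "qside i s > 1"
  using exponents[of i] by (simp add: qside_def)

text \<open>Jensen's inequality on one sign, where the exponent is a constant, followed by
  translation under the mean.\<close>

lemma quot_powr_integral_le:
  assumes K: "K \<in> sets borel" and K1: "K1 \<in> sets borel" "\<And>x d. x \<in> K \<Longrightarrow> norm d \<le> r \<Longrightarrow> x + d \<in> K1"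
    and h: "0 < h" "h \<le> r" and s: "s \<in> {1, -1}" and \<sigma>: "\<sigma> \<ge> 0"
    and ae: "AE x in lborel. x \<in> K \<longrightarrow>
      ennreal (s * quot i h x) \<le> (\<integral>\<^sup>+t\<in>{0..1}. ennreal (s * V i (x + (t * h) *\<^sub>R dir i)) \<partial>lborel)"
  shows "(\<integral>\<^sup>+x\<in>K. ennreal ((1 + max 0 (s * quot i h x)) powr (qside i s + \<sigma>)) \<partial>lborel) \<le> (\<integral>\<^sup>+x\<in>K1. ennreal (mass i \<sigma> x) \<partial>lborel)"
proof -
  note [measurable] = K K1(1)
  have "(\<integral>\<^sup>+x\<in>K. ennreal ((1 + max 0 (s * quot i h x)) powr (qside i s + \<sigma>)) \<partial>lborel) \<le>
      (\<integral>\<^sup>+x\<in>K. (\<integral>\<^sup>+t\<in>{0..1}. ennreal (mass i \<sigma> (x + (t * h) *\<^sub>R dir i)) \<partial>lborel) \<partial>lborel)"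
  proof (rule nn_integral_mono_AE)
    from ae show "AE x in lborel. ennreal ((1 + max 0 (s * quot i h x)) powr (qside i s + \<sigma>)) * indicator K x \<le>
        (\<integral>\<^sup>+t\<in>{0..1}. ennreal (mass i \<sigma> (x + (t * h) *\<^sub>R dir i)) \<partial>lborel) * indicator K x"
    proof eventually_elim
      case (elim x)
      show ?case
      proof (cases "x \<in> K")
        case True
        have "ennreal ((1 + max 0 (s * quot i h x)) powr (qside i s + \<sigma>)) \<le>
            (\<integral>\<^sup>+t\<in>{0..1}. ennreal ((1 + max 0 (s * V i (x + (t * h) *\<^sub>R dir i))) powr (qside i s + \<sigma>)) \<partial>lborel)"
        proof (rule powr_jensen)
          show "qside i s + \<sigma> \<ge> 1" using qside_gt_1[of i s] \<sigma> by simp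
          have "ennreal (max 0 z) = ennreal z" for z by (simp add: max_def ennreal_neg)
          then show "ennreal (max 0 (s * quot i h x)) \<le> (\<integral>\<^sup>+t\<in>{0..1}. ennreal (s * V i (x + (t * h) *\<^sub>R dir i)) \<partial>lborel)"
            using elim True by simp
        qed auto
        also have "\<dots> \<le> (\<integral>\<^sup>+t\<in>{0..1}. ennreal (mass i \<sigma> (x + (t * h) *\<^sub>R dir i)) \<partial>lborel)"
          by (intro nn_integral_mono mult_right_mono ennreal_leI side_le_mass s \<sigma>) auto
        finally show ?thesis using True by simp
      qed simp
    qed
  qed
  also have "\<dots> \<le> (\<integral>\<^sup>+x\<in>K1. ennreal (mass i \<sigma> x) \<partial>lborel)"
  proof (rule set_nn_integral_average_le[OF _ K])
    show "(\<lambda>(t, x). ennreal (mass i \<sigma> (x + (t * h) *\<^sub>R dir i))) \<in> borel_measurable (borel \<Otimes>\<^sub>M borel)" by measurable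
    fix t :: real assume t: "0 \<le> t" "t \<le> 1"
    have "t * h \<le> 1 * r" using t h by (intro mult_mono) auto
    then have "norm ((t * h) *\<^sub>R dir i) \<le> r" using t h by simp
    then show "(\<integral>\<^sup>+x\<in>K. ennreal (mass i \<sigma> (x + (t * h) *\<^sub>R dir i)) \<partial>lborel) \<le> (\<integral>\<^sup>+x\<in>K1. ennreal (mass i \<sigma> x) \<partial>lborel)"
      using K1(2) by (intro set_nn_integral_shift_le[of "\<lambda>x. ennreal (mass i \<sigma> x)"]) auto
  qed
  finally show ?thesis .
qed

text \<open>Where \<open>V i x\<close> and the difference quotient have opposite signs, \<open>V i\<close> changes sign along the segment.
  The mixed product is therefore dominated by the monotonicity terms for steps smaller than \<open>h\<close>.\<close>

lemma cross_le:
  assumes "s \<in> {1, -1}"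
  shows "cross i s a * max 0 (s * y) \<le> (F i y - F i a) * (y - a)"
proof (cases "s * y > 0 \<and> s * a < 0")
  case True
  consider "s = 1" | "s = -1" using assms by auto
  then show ?thesis
  proof cases
    case 1
    have "cross i s a * max 0 (s * y) = (F i 0 - F i a) * y"
      using 1 True F_mono[of a 0 i] by (simp add: cross_def max_def)
    also have "\<dots> \<le> (F i y - F i a) * (y - a)"
      using 1 True F_mono[of 0 y i] F_mono[of a 0 i] by (intro mult_mono) auto
    finally show ?thesis .
  next
    case 2
    have "cross i s a * max 0 (s * y) = (F i a - F i 0) * (- y)"
      using 2 True F_mono[of 0 a i] by (simp add: cross_def max_def)
    also have "\<dots> \<le> (F i a - F i y) * (a - y)"
      using 2 True F_mono[of y 0 i] F_mono[of 0 a i] by (intro mult_mono) auto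
    also have "\<dots> = (F i y - F i a) * (y - a)" by (simp add: algebra_simps)
    finally show ?thesis .
  qed
next
  case False
  then have "cross i s a * max 0 (s * y) = 0" by (auto simp: cross_def max_def)
  then show ?thesis using F_product_nonneg[of i y a] by linarith
qed

lemma cross_measurable[measurable]: "cross i s \<in> borel_measurable borel"
  unfolding cross_def by measurable

text \<open>\<open>cross_le\<close> is applied between an end of the segment and its running point
  \<open>x + (t * h) *\<^sub>R dir i\<close>. From the end x the step is t h; for the end x + h e_i
  the pair is read from the running point, with step (1 - t) h. All steps are at most h, so the
  known decay applies to each.\<close>

lemma cross_integral_le:
  assumes K: "K \<in> sets borel" and K1: "K1 \<in> sets borel" "\<And>x d. x \<in> K \<Longrightarrow> norm d \<le> r \<Longrightarrow> x + d \<in> K1"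
    and h: "0 < h" "h \<le> r" "h \<le> h1" and s: "s \<in> {1, -1}" and \<sigma>: "\<sigma> \<ge> 0" and A: "A \<ge> 0"
    and dec: "\<And>h. 0 < h \<Longrightarrow> h \<le> h1 \<Longrightarrow> (\<integral>\<^sup>+x\<in>K1. ennreal (good i h x) \<partial>lborel) \<le> ennreal (A * h powr \<sigma>)"
    and ae: "AE x in lborel. x \<in> K \<longrightarrow>
      ennreal (s * quot i h x) \<le> (\<integral>\<^sup>+t\<in>{0..1}. ennreal (s * V i (x + (t * h) *\<^sub>R dir i)) \<partial>lborel)"
  shows "(\<integral>\<^sup>+x\<in>K. ennreal (max 0 (s * quot i h x) * cross i s (V i x)) \<partial>lborel) \<le> ennreal (A * h powr \<sigma>)"
    "(\<integral>\<^sup>+x\<in>K. ennreal (max 0 (s * quot i h x) * cross i s (V i (x + h *\<^sub>R dir i))) \<partial>lborel) \<le> ennreal (A * h powr \<sigma>)"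
proof -
  note [measurable] = K K1(1)
  \<comment> \<open>The step 0 occurs at an end of the segment and is outside the range of
    \<open>decay\<close>; \<open>good\<close> vanishes there.\<close>
  have dec': "(\<integral>\<^sup>+x\<in>K1. ennreal (good i h' x) \<partial>lborel) \<le> ennreal (A * h powr \<sigma>)" if "0 \<le> h'" "h' \<le> h" for h'
  proof (cases "h' = 0")
    case False
    have "(\<integral>\<^sup>+x\<in>K1. ennreal (good i h' x) \<partial>lborel) \<le> ennreal (A * h' powr \<sigma>)" using that False h by (intro dec) auto
    also have "\<dots> \<le> ennreal (A * h powr \<sigma>)" using that A \<sigma> by (intro ennreal_leI mult_left_mono powr_mono2) auto
    finally show ?thesis .
  qed (simp add: good_0)
  have main: "(\<integral>\<^sup>+x\<in>K. ennreal (max 0 (s * quot i h x) * cross i s (V i (b x))) \<partial>lborel) \<le> ennreal (A * h powr \<sigma>)"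
    if m[measurable]: "b \<in> borel_measurable borel"
      and g: "\<And>t x. 0 \<le> t \<Longrightarrow> t \<le> 1 \<Longrightarrow> (F i (V i (x + (t * h) *\<^sub>R dir i)) - F i (V i (b x))) * (V i (x + (t * h) *\<^sub>R dir i) - V i (b x)) = g t x"
      and gm: "(\<lambda>(t, x). ennreal (g t x)) \<in> borel_measurable (borel \<Otimes>\<^sub>M borel)"
      and gi: "\<And>t. 0 \<le> t \<Longrightarrow> t \<le> 1 \<Longrightarrow> (\<integral>\<^sup>+x\<in>K. ennreal (g t x) \<partial>lborel) \<le> ennreal (A * h powr \<sigma>)"
    for b :: "real^'n \<Rightarrow> real^'n" and g
  proof -
    have "(\<integral>\<^sup>+x\<in>K. ennreal (max 0 (s * quot i h x) * cross i s (V i (b x))) \<partial>lborel) \<le>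
        (\<integral>\<^sup>+x\<in>K. (\<integral>\<^sup>+t\<in>{0..1}. ennreal (g t x) \<partial>lborel) \<partial>lborel)"
    proof (rule nn_integral_mono_AE)
      from ae show "AE x in lborel. ennreal (max 0 (s * quot i h x) * cross i s (V i (b x))) * indicator K x \<le>
          (\<integral>\<^sup>+t\<in>{0..1}. ennreal (g t x) \<partial>lborel) * indicator K x"
      proof eventually_elim
        case (elim x)
        show ?case
        proof (cases "x \<in> K")
          case True
          have mx: "ennreal (max 0 z) = ennreal z" for z by (simp add: max_def ennreal_neg)
          have c0: "cross i s (V i (b x)) \<ge> 0" by (simp add: cross_def)
          have "ennreal (max 0 (s * quot i h x) * cross i s (V i (b x))) = ennreal (cross i s (V i (b x))) * ennreal (s * quot i h x)"
            using c0 by (subst mult.commute) (simp add: ennreal_mult mx)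
          also have "\<dots> \<le> ennreal (cross i s (V i (b x))) * (\<integral>\<^sup>+t\<in>{0..1}. ennreal (s * V i (x + (t * h) *\<^sub>R dir i)) \<partial>lborel)"
            using elim True by (intro mult_left_mono) auto
          also have "\<dots> = (\<integral>\<^sup>+t. ennreal (cross i s (V i (b x))) * (ennreal (s * V i (x + (t * h) *\<^sub>R dir i)) * indicator {0..1} t) \<partial>lborel)"
            by (rule nn_integral_cmult[symmetric]) measurable
          also have "\<dots> \<le> (\<integral>\<^sup>+t\<in>{0..1}. ennreal (g t x) \<partial>lborel)"
          proof (rule nn_integral_mono)
            fix t :: real
            show "ennreal (cross i s (V i (b x))) * (ennreal (s * V i (x + (t * h) *\<^sub>R dir i)) * indicator {0..1} t) \<le> ennreal (g t x) * indicator {0..1} t"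
            proof (cases "t \<in> {0..1}")
              case t: True
              have "ennreal (cross i s (V i (b x))) * ennreal (s * V i (x + (t * h) *\<^sub>R dir i)) = ennreal (cross i s (V i (b x)) * max 0 (s * V i (x + (t * h) *\<^sub>R dir i)))"
                using c0 by (simp add: ennreal_mult mx)
              also have "\<dots> \<le> ennreal (g t x)"
                using cross_le[OF s, of i "V i (b x)" "V i (x + (t * h) *\<^sub>R dir i)"] g[of t x] t by (intro ennreal_leI) auto
              finally show ?thesis using t by simp
            qed simp
          qed
          finally show ?thesis using True by simp
        qed simp
      qed
    qed
    also have "\<dots> \<le> ennreal (A * h powr \<sigma>)" by (rule set_nn_integral_average_le[OF gm K gi])
    finally show ?thesis .
  qed
  have th: "0 \<le> t * h" "t * h \<le> h" "0 \<le> (1 - t) * h" "(1 - t) * h \<le> h" if "0 \<le> t" "t \<le> 1" for t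
    using that h by (auto simp: mult_left_le_one_le)
  show "(\<integral>\<^sup>+x\<in>K. ennreal (max 0 (s * quot i h x) * cross i s (V i x)) \<partial>lborel) \<le> ennreal (A * h powr \<sigma>)"
  proof (rule main[where b = "\<lambda>x. x" and g = "\<lambda>t x. good i (t * h) x"])
    show "(\<lambda>(t, x). ennreal (good i (t * h) x)) \<in> borel_measurable (borel \<Otimes>\<^sub>M borel)" unfolding good_def by measurable
    fix t :: real assume t: "0 \<le> t" "t \<le> 1"
    show "(F i (V i (x + (t * h) *\<^sub>R dir i)) - F i (V i x)) * (V i (x + (t * h) *\<^sub>R dir i) - V i x) = good i (t * h) x" for x
      by (simp add: good_def)
    have "(\<integral>\<^sup>+x\<in>K. ennreal (good i (t * h) (x + 0)) \<partial>lborel) \<le> (\<integral>\<^sup>+x\<in>K1. ennreal (good i (t * h) x) \<partial>lborel)"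
      using K1(2)[of _ 0] h by (intro set_nn_integral_shift_le[of "\<lambda>x. ennreal (good i (t * h) x)"]) auto
    also have "\<dots> \<le> ennreal (A * h powr \<sigma>)" by (intro dec' th t)
    finally show "(\<integral>\<^sup>+x\<in>K. ennreal (good i (t * h) x) \<partial>lborel) \<le> ennreal (A * h powr \<sigma>)" by simp
  qed measurable
  show "(\<integral>\<^sup>+x\<in>K. ennreal (max 0 (s * quot i h x) * cross i s (V i (x + h *\<^sub>R dir i))) \<partial>lborel) \<le> ennreal (A * h powr \<sigma>)"
  proof (rule main[where b = "\<lambda>x. x + h *\<^sub>R dir i" and g = "\<lambda>t x. good i ((1 - t) * h) (x + (t * h) *\<^sub>R dir i)"])
    show "(\<lambda>(t, x). ennreal (good i ((1 - t) * h) (x + (t * h) *\<^sub>R dir i))) \<in> borel_measurable (borel \<Otimes>\<^sub>M borel)" unfolding good_def by measurable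
    fix t :: real assume t: "0 \<le> t" "t \<le> 1"
    have sh: "x + (t * h) *\<^sub>R dir i + ((1 - t) * h) *\<^sub>R dir i = x + h *\<^sub>R dir i" for x :: "real^'n"
    proof -
      have "t * h + (1 - t) * h = h" by (simp add: algebra_simps)
      then show ?thesis by (metis add.assoc scaleR_left_distrib)
    qed
    have sq: "(p - q) * (u - w) = (q - p) * (w - u)" for p q u w :: real by (simp add: algebra_simps)
    show "(F i (V i (x + (t * h) *\<^sub>R dir i)) - F i (V i (x + h *\<^sub>R dir i))) * (V i (x + (t * h) *\<^sub>R dir i) - V i (x + h *\<^sub>R dir i)) =
        good i ((1 - t) * h) (x + (t * h) *\<^sub>R dir i)" for x
      unfolding good_def sh by (rule sq)
    have "t * h \<le> r" using th(2)[OF t] h(2) by linarith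
    then have "norm ((t * h) *\<^sub>R dir i) \<le> r" using t h by simp
    then have "(\<integral>\<^sup>+x\<in>K. ennreal (good i ((1 - t) * h) (x + (t * h) *\<^sub>R dir i)) \<partial>lborel) \<le> (\<integral>\<^sup>+x\<in>K1. ennreal (good i ((1 - t) * h) x) \<partial>lborel)"
      using K1(2) by (intro set_nn_integral_shift_le[of "\<lambda>x. ennreal (good i ((1 - t) * h) x)"]) auto
    also have "\<dots> \<le> ennreal (A * h powr \<sigma>)" by (intro dec' th t)
    finally show "(\<integral>\<^sup>+x\<in>K. ennreal (good i ((1 - t) * h) (x + (t * h) *\<^sub>R dir i)) \<partial>lborel) \<le> ennreal (A * h powr \<sigma>)" .
  qed measurable
qed

text \<open>Each condition on \<rho> has one source. Interpolation of the squared increment uses 0 <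
  \<rho> <= 2. The cross terms have order h * h^\<sigma>, hence \<rho> <= 1 + \<sigma>. The bound by
  min (q_i^+, q_i^-) + \<sigma> serves the index i when the exponent is below 2. Finally
  \<open>ex\<close> is Young's condition for the products of the weight of \<open>V j\<close> with
  the power \<rho> of the quotient.\<close>

lemma decay_step:
  assumes dec: "decay i \<sigma>" and li: "loc_int i \<sigma>" and \<sigma>: "\<sigma> \<ge> 0"
    and \<tau>: "\<And>j. j \<noteq> i \<Longrightarrow> \<tau> j \<ge> 0" "\<And>j. j \<noteq> i \<Longrightarrow> loc_int j (\<tau> j)"
    and \<rho>: "0 < \<rho>" "\<rho> \<le> 2" "\<rho> \<le> 1 + \<sigma>" "\<rho> \<le> min (qp i) (qm i) + \<sigma>"
    and ex: "\<And>j Q. j \<noteq> i \<Longrightarrow> Q \<in> {qp j, qm j} \<Longrightarrow> max 0 (Q - 2) / (Q + \<tau> j) + \<rho> / (min (qp i) (qm i) + \<sigma>) \<le> 1"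
  shows "decay i \<rho>"
  unfolding decay_def
proof (intro allI impI)
  fix K :: "(real^'n) set" assume K: "compact K" "K \<subseteq> \<Omega>"
  obtain \<beta> \<kappa> B K1 r where \<beta>: "\<beta> \<in> test_functions \<Omega>" "\<And>x. 0 \<le> \<beta> x" "\<And>x. \<beta> x \<le> 1"
    and \<kappa>: "\<kappa> > 0" "\<And>x. x \<in> K \<Longrightarrow> \<beta> x \<ge> \<kappa>" and B: "B > 0" "\<And>j x. \<bar>partial j \<beta> x\<bar> \<le> B"
    and K1: "compact K1" "K1 \<subseteq> \<Omega>" "r > 0" "\<And>x d. x \<in> closure {x. \<beta> x \<noteq> 0} \<Longrightarrow> norm d \<le> r \<Longrightarrow> x + d \<in> K1"
    using cutoff[OF K] by blast
  let ?S = "closure {x. \<beta> x \<noteq> 0}"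
  have K1m[measurable]: "K1 \<in> sets borel" using K1 by (simp add: borel_compact)
  have S[measurable]: "?S \<in> sets borel" by auto
  obtain A h1 where A: "A \<ge> 0" "h1 > 0" "\<And>h. 0 < h \<Longrightarrow> h \<le> h1 \<Longrightarrow>
      (\<integral>\<^sup>+x\<in>K1. ennreal (good i h x) \<partial>lborel) \<le> ennreal (A * h powr \<sigma>)"
    using dec K1(1,2) unfolding decay_def by blast
  obtain h2 where h2: "h2 > 0" "\<And>h s. 0 < h \<Longrightarrow> h \<le> h2 \<Longrightarrow> AE x in lborel. x \<in> ?S \<longrightarrow>
    ennreal (s * quot i h x) \<le> (\<integral>\<^sup>+t\<in>{0..1}. ennreal (s * V i (x + (t * h) *\<^sub>R dir i)) \<partial>lborel)"
    using quot_average[OF test_functionsD(5,6)[OF \<beta>(1)], of i] by blast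
  define q where "q = min (qp i) (qm i)"
  have q: "q > 1" using exponents[of i] by (simp add: q_def)
  define c0 where "c0 = (2 * M) powr (2 - \<rho>)"
  have c0: "c0 > 0" using M_pos by (simp add: c0_def)
  define \<Lambda> where "\<Lambda> = (\<Sum>j\<in>UNIV. 4 * B\<^sup>2 * C j * c0)"
  have \<Lambda>: "\<Lambda> \<ge> 0" unfolding \<Lambda>_def using C_pos c0 by (intro sum_nonneg mult_nonneg_nonneg) (auto intro: less_imp_le)
  \<comment> \<open>For the index i the mass of order 0 is enough; its extra integrability \<sigma>
    enters through the difference quotient.\<close>
  define \<tau>' where "\<tau>' = \<tau>(i := 0)"
  have li': "loc_int j (\<tau>' j)" for j using \<tau>(2)[of j] loc_int_0[of i] by (auto simp: \<tau>'_def)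
  define N where "N = (\<Sum>j\<in>UNIV. 1 * (2 * mass_on j (\<tau>' j) K1)) + 2 * mass_on i \<sigma> K1"
  have N: "N \<ge> 0" unfolding N_def by (intro add_nonneg_nonneg sum_nonneg mult_nonneg_nonneg mass_on_nonneg) auto
  \<comment> \<open>In the cross terms the factor 2 B meets 4 A: two signs \<open>s\<close> and two
    ends of the segment.\<close>
  define Z where "Z = 2 / \<kappa>\<^sup>2 * (\<Lambda> * N + 8 * B * A)"
  show "\<exists>A\<ge>0. \<exists>h0>0. \<forall>h. 0 < h \<longrightarrow> h \<le> h0 \<longrightarrow> (\<integral>\<^sup>+x\<in>K. ennreal (good i h x) \<partial>lborel) \<le> ennreal (A * h powr \<rho>)"
  proof (rule exI[of _ Z], rule conjI[rotated], rule exI[of _ "min (min 1 r) (min h1 h2)"], rule conjI[rotated], intro allI impI)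
    show "Z \<ge> 0" unfolding Z_def using \<Lambda> N A(1) B(1) by (intro mult_nonneg_nonneg add_nonneg_nonneg) auto
    show "min (min 1 r) (min h1 h2) > 0" using K1(3) A(2) h2(1) by simp
    fix h :: real assume h: "0 < h" "h \<le> min (min 1 r) (min h1 h2)"
    then have hle: "h \<le> 1" "h \<le> r" "h \<le> h1" "h \<le> h2" by auto
    let ?a = "h *\<^sub>R dir i"
    have a: "x + ?a \<in> K1" if "x \<in> ?S" for x using that h by (intro K1(4)) auto
    have a0: "x + 0 \<in> K1" if "x \<in> ?S" for x using that K1(3) by (intro K1(4)) auto
    define P where "P s x = (1 + max 0 (s * quot i h x)) powr (qside i s + \<sigma>)" for s x
    have P0: "P s x \<ge> 0" for s x by (simp add: P_def)
    define pair where "pair j x = mass j (\<tau>' j) x + mass j (\<tau>' j) (x + ?a)" for j x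
    have pair0: "pair j x \<ge> 0" for j x by (simp add: pair_def mass_nonneg)
    define T where "T x = (\<Sum>j\<in>UNIV. 1 * pair j x) + (P 1 x + P (-1) x)" for x
    have T0: "T x \<ge> 0" for x unfolding T_def by (intro add_nonneg_nonneg sum_nonneg mult_nonneg_nonneg pair0 P0) auto
    have pairT: "pair j x + (P 1 x + P (-1) x) \<le> T x" for j x
      unfolding T_def using member_le_sum[of j UNIV "\<lambda>j. 1 * pair j x"] pair0 by auto
    define R where "R s x = max 0 (s * quot i h x) * cross i s (V i x) + max 0 (s * quot i h x) * cross i s (V i (x + ?a))" for s x
    have R0: "R s x \<ge> 0" for s x by (simp add: R_def cross_def)
    define E where "E x = \<Lambda> * h powr \<rho> * T x + 2 * B * h * (R 1 x + R (-1) x)" for x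
    have [measurable]: "P s \<in> borel_measurable borel" "pair j \<in> borel_measurable borel" "R s \<in> borel_measurable borel" for s j
      unfolding P_def pair_def R_def by measurable
    have [measurable]: "T \<in> borel_measurable borel" unfolding T_def by measurable
    have E0: "E x \<ge> 0" for x
      unfolding E_def using \<Lambda> B(1) h T0 R0 by (intro add_nonneg_nonneg mult_nonneg_nonneg) auto
    have Dq: "U (x + ?a) - U x = h * quot i h x" for x using h by (simp add: quot_def)
    have sqD: "(h * \<bar>quot i h x\<bar>)\<^sup>2 \<le> c0 * h powr \<rho> * (1 + \<bar>quot i h x\<bar>) powr \<rho>" for x
      unfolding c0_def by (rule square_le_powr[OF h(1) _ quot_bound[OF h(1)] \<rho>(1,2)]) simp
    \<comment> \<open>The sign of the quotient is not tied to \<open>V j\<close>, so for j different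
      from i only the smaller exponent \<open>q\<close> of the index i can be used.\<close>
    have Pabs: "(1 + \<bar>quot i h x\<bar>) powr (q + \<sigma>) \<le> P 1 x + P (-1) x" for x
    proof -
      have "(1 + \<bar>quot i h x\<bar>) powr (q + \<sigma>) \<le> P (if quot i h x \<ge> 0 then 1 else -1) x"
        unfolding P_def by (auto simp: qside_def q_def intro!: powr_mono)
      then show ?thesis using P0[of 1 x] P0[of "-1" x] by (auto split: if_splits)
    qed
    have errj: "2 * (partial j \<beta> x)\<^sup>2 * (U (x + ?a) - U x)\<^sup>2 * (C j * (weight (qp j) (qm j) (V j x) + weight (qp j) (qm j) (V j (x + ?a))))
        \<le> 4 * B\<^sup>2 * C j * c0 * h powr \<rho> * T x" if ji: "j \<noteq> i" for j x
    proof -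
      have y: "weight (qp j) (qm j) (V j z) * (1 + \<bar>quot i h x\<bar>) powr \<rho> \<le> mass j (\<tau>' j) z + (1 + \<bar>quot i h x\<bar>) powr (q + \<sigma>)" for z
        unfolding weight_def mass_def
      proof (rule young_powr)
        have Q: "side (qp j) (qm j) (V j z) \<in> {qp j, qm j}" by (auto simp: side_def)
        have t: "\<tau>' j = \<tau> j" using ji by (simp add: \<tau>'_def)
        show "max 0 (side (qp j) (qm j) (V j z) - 2) / (side (qp j) (qm j) (V j z) + \<tau>' j) + \<rho> / (q + \<sigma>) \<le> 1"
          using ex[OF ji Q] unfolding t q_def .
        show "side (qp j) (qm j) (V j z) + \<tau>' j > 0" using exponents[of j] \<tau>(1)[OF ji] by (auto simp: t side_def)
      qed (use \<rho> q \<sigma> in auto)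
      have "(U (x + ?a) - U x)\<^sup>2 * (weight (qp j) (qm j) (V j x) + weight (qp j) (qm j) (V j (x + ?a))) \<le>
          (c0 * h powr \<rho> * (1 + \<bar>quot i h x\<bar>) powr \<rho>) * (weight (qp j) (qm j) (V j x) + weight (qp j) (qm j) (V j (x + ?a)))"
      proof (rule mult_right_mono)
        show "(U (x + ?a) - U x)\<^sup>2 \<le> c0 * h powr \<rho> * (1 + \<bar>quot i h x\<bar>) powr \<rho>"
          using sqD[of x] unfolding Dq by (simp add: power_mult_distrib)
      qed (simp add: weight_def)
      also have "\<dots> = c0 * h powr \<rho> * (weight (qp j) (qm j) (V j x) * (1 + \<bar>quot i h x\<bar>) powr \<rho> +
          weight (qp j) (qm j) (V j (x + ?a)) * (1 + \<bar>quot i h x\<bar>) powr \<rho>)" by (simp add: algebra_simps)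
      also have "\<dots> \<le> c0 * h powr \<rho> * (2 * T x)"
      proof (rule mult_left_mono)
        show "weight (qp j) (qm j) (V j x) * (1 + \<bar>quot i h x\<bar>) powr \<rho> +
            weight (qp j) (qm j) (V j (x + ?a)) * (1 + \<bar>quot i h x\<bar>) powr \<rho> \<le> 2 * T x"
          using y[of x] y[of "x + ?a"] Pabs[of x] pairT[of j x] pair0[of j x] unfolding pair_def by linarith
      qed (use c0 in simp)
      finally have *: "(U (x + ?a) - U x)\<^sup>2 * (weight (qp j) (qm j) (V j x) + weight (qp j) (qm j) (V j (x + ?a))) \<le> c0 * h powr \<rho> * (2 * T x)" .
      have "2 * (partial j \<beta> x)\<^sup>2 * (U (x + ?a) - U x)\<^sup>2 * (C j * (weight (qp j) (qm j) (V j x) + weight (qp j) (qm j) (V j (x + ?a)))) =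
          (2 * (partial j \<beta> x)\<^sup>2 * C j) * ((U (x + ?a) - U x)\<^sup>2 * (weight (qp j) (qm j) (V j x) + weight (qp j) (qm j) (V j (x + ?a))))"
        by (simp add: mult_ac)
      also have "\<dots> \<le> (2 * B\<^sup>2 * C j) * (c0 * h powr \<rho> * (2 * T x))"
      proof (rule mult_mono)
        have "(partial j \<beta> x)\<^sup>2 \<le> B\<^sup>2" using B(2)[of j x] B(1) by (simp add: abs_le_square_iff[symmetric])
        then show "2 * (partial j \<beta> x)\<^sup>2 * C j \<le> 2 * B\<^sup>2 * C j" using C_pos[of j] by simp
      qed (use * C_pos[of j] in \<open>auto simp: weight_def\<close>)
      finally show ?thesis by (simp add: mult_ac)
    qed
    have erri: "1/2 * (\<beta> x)\<^sup>2 * good i h x \<le> flux i \<beta> ?a x + 4 * B\<^sup>2 * C i * c0 * h powr \<rho> * T x + 2 * B * h * (R 1 x + R (-1) x)" for x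
    proof -
      \<comment> \<open>With \<open>s\<close> the sign of the increment, the clamped weight of
        \<open>V i\<close> and the power of the quotient share the exponent
        \<open>qside i s\<close>; hence no relation between the two exponents of f_i is
        required.\<close>
      define s where "s = (if quot i h x \<ge> 0 then 1 else -1 :: real)"
      have s: "s \<in> {1, -1}" "s * quot i h x = \<bar>quot i h x\<bar>" by (auto simp: s_def)
      have mq: "max 0 (s * quot i h x) = \<bar>quot i h x\<bar>" using s by simp
      let ?\<gamma> = "partial i \<beta> x" and ?\<Delta> = "U (x + ?a) - U x"
      have low: "flux i \<beta> ?a x \<ge> 1/2 * (\<beta> x)\<^sup>2 * good i h x -
        2 * ?\<gamma>\<^sup>2 * ?\<Delta>\<^sup>2 * (C i * (wside i s (V i x) + wside i s (V i (x + ?a)))) - 2 * \<beta> x * \<bar>?\<gamma>\<bar> * \<bar>?\<Delta>\<bar> * (cross i s (V i x) + cross i s (V i (x + ?a)))"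
        unfolding flux_def good_def using s h by (intro clamped_lower[OF s(1) _ \<beta>(2)]) (simp add: Dq mult.left_commute)
      have y: "wside i s (V i z) * (1 + \<bar>quot i h x\<bar>) powr \<rho> \<le> mass i 0 z + P s x" for z
      proof -
        have "wside i s (V i z) * (1 + \<bar>quot i h x\<bar>) powr \<rho> \<le>
            (1 + max 0 (s * V i z)) powr (qside i s) + (1 + \<bar>quot i h x\<bar>) powr (qside i s + \<sigma>)"
          unfolding wside_def
        proof (rule young_powr)
          have Q: "qside i s \<ge> q" "qside i s > 1" using qside_gt_1[of i s] by (auto simp: qside_def q_def)
          \<comment> \<open>For an exponent at least 2 the condition follows from \<rho> <= 2; below
            2 the weight is 1 and \<rho> only has to stay below the exponent plus \<sigma>.\<close>
          show "max 0 (qside i s - 2) / qside i s + \<rho> / (qside i s + \<sigma>) \<le> 1"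
          proof (cases "qside i s \<ge> 2")
            case True
            have "\<rho> / (qside i s + \<sigma>) \<le> 2 / qside i s" using \<rho> \<sigma> Q by (intro frac_le) auto
            moreover have "max 0 (qside i s - 2) / qside i s = 1 - 2 / qside i s" using True by (simp add: diff_divide_distrib)
            ultimately show ?thesis by linarith
          next
            case False
            have "\<rho> \<le> qside i s + \<sigma>" using \<rho>(4) Q unfolding q_def by linarith
            then have "\<rho> / (qside i s + \<sigma>) \<le> 1" using Q \<sigma> by simp
            then show ?thesis using False by simp
          qed
          show "0 < qside i s" "0 < qside i s + \<sigma>" using Q \<sigma> by auto
        qed (use \<rho> in auto)
        also have "(1 + max 0 (s * V i z)) powr (qside i s) \<le> mass i 0 z" using side_le_mass[OF s(1), of 0 i z] by simp
        finally show ?thesis by (simp add: P_def mq)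
      qed
      have Ps: "P s x \<le> P 1 x + P (-1) x" using s(1) P0[of 1 x] P0[of "-1" x] by auto
      have "?\<Delta>\<^sup>2 * (wside i s (V i x) + wside i s (V i (x + ?a))) \<le>
          (c0 * h powr \<rho> * (1 + \<bar>quot i h x\<bar>) powr \<rho>) * (wside i s (V i x) + wside i s (V i (x + ?a)))"
      proof (rule mult_right_mono)
        show "?\<Delta>\<^sup>2 \<le> c0 * h powr \<rho> * (1 + \<bar>quot i h x\<bar>) powr \<rho>"
          using sqD[of x] unfolding Dq by (simp add: power_mult_distrib)
      qed (simp add: wside_def)
      also have "\<dots> = c0 * h powr \<rho> * (wside i s (V i x) * (1 + \<bar>quot i h x\<bar>) powr \<rho> +
          wside i s (V i (x + ?a)) * (1 + \<bar>quot i h x\<bar>) powr \<rho>)" by (simp add: algebra_simps)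
      also have "\<dots> \<le> c0 * h powr \<rho> * (2 * T x)"
      proof (rule mult_left_mono)
        have "\<tau>' i = 0" by (simp add: \<tau>'_def)
        then show "wside i s (V i x) * (1 + \<bar>quot i h x\<bar>) powr \<rho> +
            wside i s (V i (x + ?a)) * (1 + \<bar>quot i h x\<bar>) powr \<rho> \<le> 2 * T x"
          using y[of x] y[of "x + ?a"] Ps pairT[of i x] pair0[of i x] unfolding pair_def by simp
      qed (use c0 in simp)
      finally have *: "?\<Delta>\<^sup>2 * (wside i s (V i x) + wside i s (V i (x + ?a))) \<le> c0 * h powr \<rho> * (2 * T x)" .
      have "2 * ?\<gamma>\<^sup>2 * ?\<Delta>\<^sup>2 * (C i * (wside i s (V i x) + wside i s (V i (x + ?a)))) =
          (2 * ?\<gamma>\<^sup>2 * C i) * (?\<Delta>\<^sup>2 * (wside i s (V i x) + wside i s (V i (x + ?a))))"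
        by (simp add: mult_ac)
      also have "\<dots> \<le> (2 * B\<^sup>2 * C i) * (c0 * h powr \<rho> * (2 * T x))"
      proof (rule mult_mono)
        have "?\<gamma>\<^sup>2 \<le> B\<^sup>2" using B(2)[of i x] B(1) by (simp add: abs_le_square_iff[symmetric])
        then show "2 * ?\<gamma>\<^sup>2 * C i \<le> 2 * B\<^sup>2 * C i" using C_pos[of i] by simp
      qed (use * C_pos[of i] in \<open>auto simp: wside_def\<close>)
      finally have 1: "2 * ?\<gamma>\<^sup>2 * ?\<Delta>\<^sup>2 * (C i * (wside i s (V i x) + wside i s (V i (x + ?a)))) \<le> 4 * B\<^sup>2 * C i * c0 * h powr \<rho> * T x"
        by (simp add: mult_ac)
      have "2 * \<beta> x * \<bar>?\<gamma>\<bar> * \<bar>?\<Delta>\<bar> * (cross i s (V i x) + cross i s (V i (x + ?a))) = (2 * (\<beta> x * \<bar>?\<gamma>\<bar>) * h) * R s x"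
        using h by (simp add: R_def mq Dq abs_mult algebra_simps)
      also have "\<dots> \<le> (2 * B * h) * (R 1 x + R (-1) x)"
      proof (rule mult_mono)
        have "\<beta> x * \<bar>?\<gamma>\<bar> \<le> 1 * B" using \<beta>(2,3)[of x] B by (intro mult_mono) auto
        then show "2 * (\<beta> x * \<bar>?\<gamma>\<bar>) * h \<le> 2 * B * h" using h by simp
        show "R s x \<le> R 1 x + R (-1) x" using s(1) R0[of 1 x] R0[of "-1" x] by auto
      qed (use B h R0 in auto)
      finally show ?thesis using low 1 by linarith
    qed
    have "(\<integral>\<^sup>+x\<in>K. ennreal (good i h x) \<partial>lborel) \<le> ennreal (2 / \<kappa>\<^sup>2) * (\<integral>\<^sup>+x\<in>?S. ennreal (E x) \<partial>lborel)"
    proof (rule good_bound[OF \<beta> _ _ E0 _ \<kappa>])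
      show "x + ?a \<in> \<Omega>" if "x \<in> ?S" for x using a[OF that] K1(2) by auto
      show "E \<in> borel_measurable borel" unfolding E_def by measurable
      fix x
      have "(if j = i then 1/2 * (\<beta> x)\<^sup>2 * good i h x - 2 * B * h * (R 1 x + R (-1) x) else 0) \<le> flux j \<beta> ?a x + 4 * B\<^sup>2 * C j * c0 * h powr \<rho> * T x" for j
      proof (cases "j = i")
        case True
        then show ?thesis using erri[of x] by simp
      next
        case False
        have "0 \<le> 1/2 * (\<beta> x)\<^sup>2 * ((F j (V j (x + ?a)) - F j (V j x)) * (V j (x + ?a) - V j x))"
          by (rule mult_nonneg_nonneg[OF _ F_product_nonneg]) simp
        then have "0 \<le> flux j \<beta> ?a x + 4 * B\<^sup>2 * C j * c0 * h powr \<rho> * T x"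
          using flux_lower[of \<beta> x j ?a] errj[OF False, of x] by linarith
        then show ?thesis using False by simp
      qed
      then have "(\<Sum>j\<in>UNIV. if j = i then 1/2 * (\<beta> x)\<^sup>2 * good i h x - 2 * B * h * (R 1 x + R (-1) x) else 0) \<le>
          (\<Sum>j\<in>UNIV. flux j \<beta> ?a x + 4 * B\<^sup>2 * C j * c0 * h powr \<rho> * T x)"
        by (rule sum_mono)
      also have "\<dots> = (\<Sum>j\<in>UNIV. flux j \<beta> ?a x) + \<Lambda> * h powr \<rho> * T x"
        by (simp add: \<Lambda>_def sum.distrib sum_distrib_right)
      finally show "1/2 * (\<beta> x)\<^sup>2 * good i h x \<le> (\<Sum>j\<in>UNIV. flux j \<beta> ?a x) + E x"
        by (simp add: E_def)
    qed
    also have "(\<integral>\<^sup>+x\<in>?S. ennreal (E x) \<partial>lborel) \<le> ennreal (\<Lambda> * h powr \<rho> * N + 2 * B * h * (4 * (A * h powr \<sigma>)))"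
    proof -
      have PS: "(\<integral>\<^sup>+x\<in>?S. ennreal (P s x) \<partial>lborel) \<le> ennreal (mass_on i \<sigma> K1)" if "s \<in> {1, -1}" for s
        unfolding P_def nn_integral_mass[OF li K1(1,2), symmetric]
        by (rule quot_powr_integral_le[OF S K1m K1(4) h(1) hle(2) that \<sigma> h2(2)[OF h(1) hle(4)]])
      have RS: "(\<integral>\<^sup>+x\<in>?S. ennreal (R s x) \<partial>lborel) \<le> ennreal (2 * (A * h powr \<sigma>))" if "s \<in> {1, -1}" for s
      proof -
        have "(\<integral>\<^sup>+x\<in>?S. ennreal (R s x) \<partial>lborel) =
            (\<integral>\<^sup>+x. ennreal (max 0 (s * quot i h x) * cross i s (V i x)) * indicator ?S x +
              ennreal (max 0 (s * quot i h x) * cross i s (V i (x + ?a))) * indicator ?S x \<partial>lborel)"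
          unfolding R_def by (intro nn_integral_cong) (simp add: ennreal_plus cross_def distrib_right)
        also have "\<dots> = (\<integral>\<^sup>+x\<in>?S. ennreal (max 0 (s * quot i h x) * cross i s (V i x)) \<partial>lborel) +
              (\<integral>\<^sup>+x\<in>?S. ennreal (max 0 (s * quot i h x) * cross i s (V i (x + ?a))) \<partial>lborel)"
          by (rule nn_integral_add) measurable
        also have "\<dots> \<le> ennreal (A * h powr \<sigma>) + ennreal (A * h powr \<sigma>)"
          by (intro add_mono cross_integral_le[OF S K1m K1(4) h(1) hle(2,3) that \<sigma> A(1) A(3) h2(2)[OF h(1) hle(4)]])
        also have "\<dots> = ennreal (2 * (A * h powr \<sigma>))" using A(1) by (simp add: ennreal_plus[symmetric] del: ennreal_plus)
        finally show ?thesis .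
      qed
      have TS: "(\<integral>\<^sup>+x\<in>?S. ennreal (T x) \<partial>lborel) \<le> ennreal N"
      proof -
        have "(\<integral>\<^sup>+x\<in>?S. ennreal (T x) \<partial>lborel) = (\<integral>\<^sup>+x. ennreal (\<Sum>j\<in>UNIV. 1 * pair j x) * indicator ?S x +
            (ennreal (P 1 x) * indicator ?S x + ennreal (P (-1) x) * indicator ?S x) \<partial>lborel)"
          unfolding T_def using P0 pair0 by (intro nn_integral_cong) (simp add: ennreal_plus sum_nonneg distrib_right)
        also have "\<dots> = (\<integral>\<^sup>+x\<in>?S. ennreal (\<Sum>j\<in>UNIV. 1 * pair j x) \<partial>lborel) +
            ((\<integral>\<^sup>+x\<in>?S. ennreal (P 1 x) \<partial>lborel) + (\<integral>\<^sup>+x\<in>?S. ennreal (P (-1) x) \<partial>lborel))"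
          by (subst nn_integral_add, measurable, subst nn_integral_add, measurable)
        also have "\<dots> \<le> ennreal (\<Sum>j\<in>UNIV. 1 * (2 * mass_on j (\<tau>' j) K1)) + (ennreal (mass_on i \<sigma> K1) + ennreal (mass_on i \<sigma> K1))"
        proof (intro add_mono PS nn_integral_sum_le pair0 S)
          show "(\<integral>\<^sup>+x\<in>?S. ennreal (pair j x) \<partial>lborel) \<le> ennreal (2 * mass_on j (\<tau>' j) K1)" for j
            unfolding pair_def by (rule nn_integral_mass_pair_le[OF li' K1(1,2) a0 a S])
        qed (auto simp: mass_on_nonneg)
        also have "\<dots> = ennreal N"
          unfolding N_def using mass_on_nonneg
          by (simp add: ennreal_plus[symmetric] sum_nonneg del: ennreal_plus)
        finally show ?thesis .
      qed
      have "(\<integral>\<^sup>+x\<in>?S. ennreal (E x) \<partial>lborel) = (\<integral>\<^sup>+x. ennreal (\<Lambda> * h powr \<rho>) * (ennreal (T x) * indicator ?S x) +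
          ennreal (2 * B * h) * (ennreal (R 1 x) * indicator ?S x + ennreal (R (-1) x) * indicator ?S x) \<partial>lborel)"
      proof (rule nn_integral_cong)
        fix x
        have "ennreal (E x) = ennreal (\<Lambda> * h powr \<rho>) * ennreal (T x) + ennreal (2 * B * h) * (ennreal (R 1 x) + ennreal (R (-1) x))"
          unfolding E_def using \<Lambda> T0[of x] B(1) h(1) R0
          by (simp add: ennreal_plus[symmetric] ennreal_mult[symmetric] del: ennreal_plus)
        then show "ennreal (E x) * indicator ?S x = ennreal (\<Lambda> * h powr \<rho>) * (ennreal (T x) * indicator ?S x) +
          ennreal (2 * B * h) * (ennreal (R 1 x) * indicator ?S x + ennreal (R (-1) x) * indicator ?S x)"
          by (cases "x \<in> ?S") auto
      qed
      also have "\<dots> = ennreal (\<Lambda> * h powr \<rho>) * (\<integral>\<^sup>+x\<in>?S. ennreal (T x) \<partial>lborel) +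
          ennreal (2 * B * h) * ((\<integral>\<^sup>+x\<in>?S. ennreal (R 1 x) \<partial>lborel) + (\<integral>\<^sup>+x\<in>?S. ennreal (R (-1) x) \<partial>lborel))"
        by (subst nn_integral_add, measurable, subst nn_integral_cmult, measurable, subst nn_integral_cmult, measurable, subst nn_integral_add, measurable)
      also have "\<dots> \<le> ennreal (\<Lambda> * h powr \<rho>) * ennreal N + ennreal (2 * B * h) * (ennreal (2 * (A * h powr \<sigma>)) + ennreal (2 * (A * h powr \<sigma>)))"
        by (intro add_mono mult_left_mono TS RS) auto
      also have "\<dots> = ennreal (\<Lambda> * h powr \<rho> * N + 2 * B * h * (4 * (A * h powr \<sigma>)))"
        using \<Lambda> N B(1) h(1) A(1)
        by (simp add: ennreal_plus[symmetric] ennreal_mult[symmetric] del: ennreal_plus)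
      finally show ?thesis .
    qed
    also have "ennreal (2 / \<kappa>\<^sup>2) * ennreal (\<Lambda> * h powr \<rho> * N + 2 * B * h * (4 * (A * h powr \<sigma>))) \<le> ennreal (Z * h powr \<rho>)"
    proof -
      \<comment> \<open>Here h <= 1 turns the order 1 + \<sigma> of the cross terms into the order
        \<rho>.\<close>
      have "h * h powr \<sigma> = h powr (1 + \<sigma>)" using h(1) by (simp add: powr_mult_base)
      also have "\<dots> \<le> h powr \<rho>" using h(1) hle(1) \<rho>(3) by (intro powr_mono') auto
      finally have "8 * B * A * (h * h powr \<sigma>) \<le> 8 * B * A * h powr \<rho>" using B(1) A(1) by (intro mult_left_mono) auto
      then have "\<Lambda> * h powr \<rho> * N + 2 * B * h * (4 * (A * h powr \<sigma>)) \<le> (\<Lambda> * N + 8 * B * A) * h powr \<rho>" by (simp add: algebra_simps)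
      then have "2 / \<kappa>\<^sup>2 * (\<Lambda> * h powr \<rho> * N + 2 * B * h * (4 * (A * h powr \<sigma>))) \<le> 2 / \<kappa>\<^sup>2 * ((\<Lambda> * N + 8 * B * A) * h powr \<rho>)"
        by (intro mult_left_mono) auto
      also have "\<dots> = Z * h powr \<rho>" by (simp add: Z_def)
      finally show ?thesis
        using \<Lambda> N B(1) h(1) A(1) by (subst ennreal_mult[symmetric]) (auto intro!: ennreal_leI)
    qed
    finally show "(\<integral>\<^sup>+x\<in>K. ennreal (good i h x) \<partial>lborel) \<le> ennreal (Z * h powr \<rho>)"
      by (simp add: mult_left_mono)
  qed
qed

end

section \<open>The bootstrap and the theorem\<close>

text \<open>For Q >= 2, clearing the denominator leaves (2 + \<tau>)(q + 1) > Q + \<tau>, which is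
  the assumed inequality; \<tau> = 0 and \<tau> = 1 are the two exponent hypotheses of the
  theorem.\<close>

lemma gap_condition:
  assumes "Q > 1" "q > 1" "\<tau> \<in> {0, 1}" "Q < (2 + \<tau>) * q + 2"
  shows "(1 - max 0 (Q - 2) / (Q + \<tau>)) * (q + 1) > (1::real)"
proof (cases "Q \<ge> 2")
  case True
  have pos: "Q + \<tau> > 0" using assms by auto
  have "1 - max 0 (Q - 2) / (Q + \<tau>) = ((Q + \<tau>) - (Q - 2)) / (Q + \<tau>)"
    by (subst diff_divide_distrib) (use True pos in simp)
  then have "(1 - max 0 (Q - 2) / (Q + \<tau>)) * (q + 1) = ((2 + \<tau>) * (q + 1)) / (Q + \<tau>)" by simp
  moreover have "(2 + \<tau>) * (q + 1) > Q + \<tau>" using assms by (auto simp: algebra_simps)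
  ultimately show ?thesis using pos by simp
next
  case False
  then show ?thesis using assms by simp
qed

context splitting_minimizer
begin

lemma decay_mono:
  assumes "decay i \<rho>" "\<rho>' \<le> \<rho>"
  shows "decay i \<rho>'"
  unfolding decay_def
proof (intro allI impI)
  fix K :: "(real^'n) set" assume "compact K" "K \<subseteq> \<Omega>"
  then obtain A h0 where A: "A \<ge> 0" "h0 > 0" "\<And>h. 0 < h \<Longrightarrow> h \<le> h0 \<Longrightarrow>
      (\<integral>\<^sup>+x\<in>K. ennreal (good i h x) \<partial>lborel) \<le> ennreal (A * h powr \<rho>)"
    using assms(1) unfolding decay_def by blast
  have "(\<integral>\<^sup>+x\<in>K. ennreal (good i h x) \<partial>lborel) \<le> ennreal (A * h powr \<rho>')" if h: "0 < h" "h \<le> min 1 h0" for h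
  proof -
    have "(\<integral>\<^sup>+x\<in>K. ennreal (good i h x) \<partial>lborel) \<le> ennreal (A * h powr \<rho>)" using h by (intro A(3)) auto
    also have "\<dots> \<le> ennreal (A * h powr \<rho>')"
      using h A(1) assms(2) by (intro ennreal_leI mult_left_mono powr_mono') auto
    finally show ?thesis .
  qed
  moreover have "min 1 h0 > 0" using A(2) by simp
  ultimately show "\<exists>A\<ge>0. \<exists>h0>0. \<forall>h. 0 < h \<longrightarrow> h \<le> h0 \<longrightarrow> (\<integral>\<^sup>+x\<in>K. ennreal (good i h x) \<partial>lborel) \<le> ennreal (A * h powr \<rho>')"
    using A(1) by blast
qed

lemma loc_int_mono:
  assumes "loc_int j \<sigma>" "\<tau> \<le> \<sigma>"
  shows "loc_int j \<tau>"
  unfolding loc_int_def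
proof (intro allI impI)
  fix K :: "(real^'n) set" assume K: "compact K" "K \<subseteq> \<Omega>"
  have "(\<integral>\<^sup>+x\<in>K. ennreal (mass j \<tau> x) \<partial>lborel) \<le> (\<integral>\<^sup>+x\<in>K. ennreal (mass j \<sigma> x) \<partial>lborel)"
    using assms(2) unfolding mass_def by (intro nn_integral_mono mult_right_mono ennreal_leI powr_mono) auto
  also have "\<dots> < \<infinity>" using assms(1) K by (auto simp: loc_int_def)
  finally show "(\<integral>\<^sup>+x\<in>K. ennreal (mass j \<tau> x) \<partial>lborel) < \<infinity>" .
qed

text \<open>\<open>gap\<close> is Young's condition of \<open>decay_step\<close> for \<rho> =
  \<sigma> = 1, made strict. There are finitely many pairs j, Q, so the slack is uniform and every
  round gains the same \<epsilon>.\<close>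

lemma bootstrap:
  assumes \<tau>: "\<And>j. j \<noteq> i \<Longrightarrow> \<tau> j \<ge> 0" "\<And>j. j \<noteq> i \<Longrightarrow> loc_int j (\<tau> j)"
    and gap: "\<And>j Q. j \<noteq> i \<Longrightarrow> Q \<in> {qp j, qm j} \<Longrightarrow> (1 - max 0 (Q - 2) / (Q + \<tau> j)) * (min (qp i) (qm i) + 1) > 1"
  shows "\<exists>\<sigma>>1. loc_int i \<sigma>"
proof -
  define q where "q = min (qp i) (qm i)"
  have q: "q > 1" using exponents[of i] by (simp add: q_def)
  \<comment> \<open>Including 1 keeps the set nonempty even with a single variable and makes
    \<kappa> <= 1, which gives the bound of \<rho> by q + \<sigma>.\<close>
  define S where "S = insert 1 ((\<lambda>j. 1 - max 0 (qp j - 2) / (qp j + \<tau> j)) ` (UNIV - {i}) \<union> (\<lambda>j. 1 - max 0 (qm j - 2) / (qm j + \<tau> j)) ` (UNIV - {i}))"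
  have S: "finite S" "S \<noteq> {}" by (auto simp: S_def)
  define \<kappa> where "\<kappa> = Min S"
  have \<kappa>1: "\<kappa> \<le> 1" unfolding \<kappa>_def using S by (intro Min_le) (auto simp: S_def)
  have \<kappa>le: "\<kappa> \<le> 1 - max 0 (Q - 2) / (Q + \<tau> j)" if "j \<noteq> i" "Q \<in> {qp j, qm j}" for j Q
    unfolding \<kappa>_def using S that by (intro Min_le) (auto simp: S_def)
  have "s * (q + 1) > 1" if "s \<in> S" for s
    using that gap q unfolding S_def q_def by auto
  then have \<kappa>q: "\<kappa> * (q + 1) > 1" using Min_in[OF S] by (simp add: \<kappa>_def)
  have \<kappa>: "\<kappa> > 0"
  proof (rule ccontr)
    assume "\<not> \<kappa> > 0"
    then have "\<kappa> * (q + 1) \<le> 0" using q by (intro mult_nonpos_nonneg) auto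
    with \<kappa>q show False by simp
  qed
  \<comment> \<open>The affine function \<kappa> (q + \<sigma>) - \<sigma> takes the values \<kappa>
    q and \<kappa> (q + 1) - 1 at 0 and 1, so it is at least 2 \<epsilon> on [0, 1]. Decay gains 2
    \<epsilon>, and half of it is given up for integrability. The bound 2 \<epsilon> <= 1 secures
    \<rho> <= 1 + \<sigma> and \<rho> <= 2.\<close>
  define \<epsilon> where "\<epsilon> = min 1 (min (\<kappa> * q) (\<kappa> * (q + 1) - 1)) / 2"
  have \<epsilon>: "\<epsilon> > 0" "2 * \<epsilon> \<le> 1" "2 * \<epsilon> \<le> \<kappa> * q" "2 * \<epsilon> \<le> \<kappa> * (q + 1) - 1"
    using \<kappa> q \<kappa>q by (auto simp: \<epsilon>_def)
  have step: "decay i (\<sigma> + \<epsilon>) \<and> loc_int i (\<sigma> + \<epsilon>)" if d: "decay i \<sigma>" "loc_int i \<sigma>" and \<sigma>: "0 \<le> \<sigma>" "\<sigma> \<le> 1" for \<sigma>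
  proof -
    have lin: "\<sigma> + 2 * \<epsilon> \<le> \<kappa> * (q + \<sigma>)"
    proof -
      have "(1 - \<sigma>) * (2 * \<epsilon>) \<le> (1 - \<sigma>) * (\<kappa> * q)" "\<sigma> * (2 * \<epsilon>) \<le> \<sigma> * (\<kappa> * (q + 1) - 1)"
        using \<sigma> \<epsilon> by (auto intro!: mult_left_mono)
      then have "(1 - \<sigma>) * (2 * \<epsilon>) + \<sigma> * (2 * \<epsilon>) \<le> (1 - \<sigma>) * (\<kappa> * q) + \<sigma> * (\<kappa> * (q + 1) - 1)" by (rule add_mono)
      then show ?thesis by (simp add: algebra_simps)
    qed
    have d2: "decay i (\<sigma> + 2 * \<epsilon>)"
    proof (rule decay_step[OF d \<sigma>(1) \<tau>])
      show "\<sigma> + 2 * \<epsilon> \<le> min (qp i) (qm i) + \<sigma>"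
      proof -
        have "\<kappa> * (q + \<sigma>) \<le> 1 * (q + \<sigma>)" using \<kappa>1 q \<sigma> by (intro mult_right_mono) auto
        from order_trans[OF lin this] show ?thesis by (simp add: q_def)
      qed
      fix j Q assume j: "j \<noteq> i" "Q \<in> {qp j, qm j}"
      have "(\<sigma> + 2 * \<epsilon>) / (q + \<sigma>) \<le> \<kappa>" using lin q \<sigma> by (simp add: divide_le_eq)
      with \<kappa>le[OF j] show "max 0 (Q - 2) / (Q + \<tau> j) + (\<sigma> + 2 * \<epsilon>) / (min (qp i) (qm i) + \<sigma>) \<le> 1"
        unfolding q_def[symmetric] by linarith
    qed (use \<sigma> \<epsilon> in auto)
    have "decay i (\<sigma> + \<epsilon>)" by (rule decay_mono[OF d2]) (use \<epsilon> in simp)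
    moreover have "loc_int i (\<sigma> + \<epsilon>)" by (rule decay_imp_loc_int[OF d2]) (use \<sigma> \<epsilon> in auto)
    ultimately show ?thesis by simp
  qed
  \<comment> \<open>The range up to 1 + \<epsilon> means that the last round may start at any order
    up to 1 and so ends above 1.\<close>
  have iter: "real n * \<epsilon> \<le> 1 + \<epsilon> \<Longrightarrow> decay i (real n * \<epsilon>) \<and> loc_int i (real n * \<epsilon>)" for n
  proof (induction n)
    case 0
    then show ?case using decay_0 loc_int_0 by simp
  next
    case (Suc n)
    then have n: "real n * \<epsilon> \<le> 1" by (simp add: algebra_simps)
    with Suc.IH \<epsilon>(1) have "decay i (real n * \<epsilon>)" "loc_int i (real n * \<epsilon>)" by auto
    from step[OF this _ n] \<epsilon>(1) show ?case by (simp add: algebra_simps)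
  qed
  obtain n where n: "real n * \<epsilon> > 1" "real n * \<epsilon> \<le> 1 + \<epsilon>"
  proof -
    define n where "n = nat \<lfloor>1 / \<epsilon>\<rfloor> + 1"
    have "real n = of_int \<lfloor>1 / \<epsilon>\<rfloor> + 1" using \<epsilon>(1) by (simp add: n_def)
    then have "1 / \<epsilon> < real n" "real n \<le> 1 / \<epsilon> + 1" by linarith+
    then have "real n * \<epsilon> > 1" "real n * \<epsilon> \<le> (1 / \<epsilon> + 1) * \<epsilon>"
      using \<epsilon>(1) by (auto simp: pos_divide_less_eq)
    then show ?thesis using that[of n] \<epsilon>(1) by (simp add: algebra_simps)
  qed
  from iter[OF n(2)] n(1) show ?thesis by blast
qed

end

theorem theorem1p1:
  fixes \<Omega> :: "(real, 'n::{finite,linorder}) vec set"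
    and qp qm :: "'n \<Rightarrow> real"
    and a_low a_up :: "'n \<Rightarrow> real"
    and h H f :: "'n \<Rightarrow> real \<Rightarrow> real"
    and u :: "(real, 'n) vec \<Rightarrow> real"
  assumes "bounded \<Omega>" and "lipschitz_domain \<Omega>"
    and "\<And>i. qp i > 1" and "\<And>i. qm i > 1"
    and "\<And>i. a_low i > 0" and "\<And>i. a_up i > 0"
    and "\<And>i t. h i t > 0" and "\<And>i t. H i t > 0"
    and "\<And>i t. t < -1 \<Longrightarrow> a_low i * Gam \<bar>t\<bar> powr ((qm i - 2) / 2) \<le> h i t"
    and "\<And>i t. t < -1 \<Longrightarrow> H i t \<le> a_up i * Gam \<bar>t\<bar> powr ((qm i - 2) / 2)"
    and "\<And>i t. t > 1 \<Longrightarrow> a_low i * Gam \<bar>t\<bar> powr ((qp i - 2) / 2) \<le> h i t"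
    and "\<And>i t. t > 1 \<Longrightarrow> H i t \<le> a_up i * Gam \<bar>t\<bar> powr ((qp i - 2) / 2)"
    and "\<And>i t. f i t \<ge> 0" and "\<And>i. C2_real (f i)"
    and "\<And>i t. h i t \<le> deriv (deriv (f i)) t" and "\<And>i t. deriv (deriv (f i)) t \<le> H i t"
    and "\<And>i j. i < j \<Longrightarrow> max (qp j) (qm j) < 2 * min (qp i) (qm i) + 2"
    and "\<And>i j. j < i \<Longrightarrow> max (qp j) (qm j) < 3 * min (qp i) (qm i) + 2"
    and "u \<in> L_infty \<Omega> \<inter> energy_class (split_density f) \<Omega>"
    and "local_minimizer (split_density f) \<Omega> u"
  shows "\<exists>\<delta>>-1/2. \<forall>i x\<^sub>0 r \<eta> c\<^sub>0.
    r > 0 \<and> compactly_contained (ball x\<^sub>0 (2 * r)) \<Omega> \<and>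
    \<eta> \<in> test_functions (ball x\<^sub>0 (2 * r)) \<and> (\<forall>x. 0 \<le> \<eta> x \<and> \<eta> x \<le> 1) \<and>
    (\<forall>x\<in>ball x\<^sub>0 r. \<eta> x = 1) \<and> (\<forall>x. norm (gradient \<eta> x) \<le> c\<^sub>0 / r) \<longrightarrow>
    (\<exists>k\<^sub>0>0. \<forall>k\<ge>k\<^sub>0. \<exists>c::real.
      (\<integral>\<^sup>+x. ennreal (f i (weak_partial \<Omega> i u x) * Gam \<bar>weak_partial \<Omega> i u x\<bar> powr (1 + \<delta>) *
          \<eta> x powr (2 * k)) \<partial>lebesgue_on (ball x\<^sub>0 (2 * r))) \<le> ennreal c)"
proof -
  have op: "open \<Omega>" using assms(2) by (simp add: lipschitz_domain_def)
  have "\<forall>j. \<exists>c C. two_sided_growth (f j) (deriv (f j)) (deriv (deriv (f j))) (qp j) (qm j) c C"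
    by (intro allI two_sided_growthI[where al = "a_low _" and au = "a_up _" and h = "h _" and H = "H _"]) (use assms in auto)
  then obtain c C where growth: "\<And>j. two_sided_growth (f j) (deriv (f j)) (deriv (deriv (f j))) (qp j) (qm j) (c j) (C j)"
    by metis
  have u: "u \<in> W11 \<Omega>" and iu: "integrable (lebesgue_on \<Omega>) u"
    and wp: "\<And>j. is_weak_partial \<Omega> j u (weak_partial \<Omega> j u)" and iv: "\<And>j. integrable (lebesgue_on \<Omega>) (weak_partial \<Omega> j u)"
  proof -
    show u: "u \<in> W11 \<Omega>" using assms(19) by (simp add: energy_class_def)
    then show "integrable (lebesgue_on \<Omega>) u" "\<And>j. integrable (lebesgue_on \<Omega>) (weak_partial \<Omega> j u)" by (auto simp: W11_def)
    show "is_weak_partial \<Omega> j u (weak_partial \<Omega> j u)" for j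
    proof -
      obtain v where "is_weak_partial \<Omega> j u v" using u unfolding W11_def by blast
      then show ?thesis by (rule weak_partial_AE_eq(1)[OF op])
    qed
  qed
  obtain M0 where M0: "AE x in lebesgue_on \<Omega>. \<bar>u x\<bar> \<le> M0" using assms(19) by (auto simp: L_infty_def)
  define M where "M = max 1 M0"
  obtain U0 where U0: "integrable lborel U0" "AE x in lebesgue_on \<Omega>. u x = U0 x"
    using lebesgue_on_borel_representative[OF op iu] by blast
  \<comment> \<open>The truncation changes the representative on a null set of \<Omega> only and
    makes the bound valid everywhere.\<close>
  define U where "U x = max (- M) (min M (U0 x))" for x
  have M: "M > 0" by (simp add: M_def)
  have mU: "U \<in> borel_measurable lborel" unfolding U_def using borel_measurable_integrable[OF U0(1)] by measurable
  have iU: "integrable lborel U"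
    by (rule Bochner_Integration.integrable_bound[OF U0(1) mU]) (use M in \<open>auto simp: U_def\<close>)
  have UM: "\<bar>U x\<bar> \<le> M" for x using M by (auto simp: U_def)
  have uU: "AE x in lebesgue_on \<Omega>. u x = U x"
    using U0(2) M0 by eventually_elim (auto simp: U_def M_def)
  have "\<forall>j. \<exists>V. integrable lborel V \<and> (AE x in lebesgue_on \<Omega>. weak_partial \<Omega> j u x = V x)"
    using lebesgue_on_borel_representative[OF op iv] by metis
  then obtain V where V: "\<And>j. integrable lborel (V j)" "\<And>j. AE x in lebesgue_on \<Omega>. weak_partial \<Omega> j u x = V j x"
    by metis
  have weak: "weak_deriv \<Omega> j U (V j)" for j
    by (rule is_weak_partial_imp_weak_deriv[OF op wp iU uU V(1) V(2) iu iv])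
  have fcont: "continuous_on UNIV (f j)" for j
    using two_sided_growth.f_deriv[OF growth[of j]] by (meson DERIV_isCont continuous_at_imp_continuous_on)
  have Fcont: "continuous_on UNIV (deriv (f j))" for j
    using two_sided_growth.F_deriv[OF growth[of j]] by (meson DERIV_isCont continuous_at_imp_continuous_on)
  have fin: "(\<integral>\<^sup>+x\<in>\<Omega>. ennreal (\<Sum>j\<in>UNIV. f j (V j x)) \<partial>lborel) < \<infinity>"
    using assms(19) energy_eq_nn_integral[OF op fcont V] by (simp add: energy_class_def)
  have cd: "convex_densities f (\<lambda>j. deriv (f j))"
  proof (rule convex_densities.intro)
    fix j s t E
    show "f j t \<ge> 0" by (rule assms(13))
    show "(f j has_real_derivative deriv (f j) t) (at t)" by (rule two_sided_growth.f_deriv[OF growth])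
    show "deriv (f j) s \<le> deriv (f j) t" if "s \<le> t" by (rule two_sided_growth.F_mono[OF growth that])
    show "continuous_on UNIV (deriv (f j))" by (rule Fcont)
    show "\<exists>C. \<forall>a b t e. 0 \<le> t \<longrightarrow> t \<le> 1 \<longrightarrow> \<bar>e\<bar> \<le> E \<longrightarrow> f j ((1 - t) * a + t * b + e) \<le> C * (1 + f j a + f j b)"
      by (rule two_sided_growth.perturb[OF growth])
  qed
  have bm: "bounded_minimizer f (\<lambda>j. deriv (f j)) \<Omega> U V M"
  proof (intro bounded_minimizer.intro cd bounded_minimizer_axioms.intro)
    show "(\<integral>\<^sup>+x\<in>\<Omega>. ennreal (\<Sum>j\<in>UNIV. f j (V j x)) \<partial>lborel) \<le> (\<integral>\<^sup>+x\<in>\<Omega>. ennreal (\<Sum>j\<in>UNIV. f j (Z j x)) \<partial>lborel)"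
      if "\<And>j. weak_deriv \<Omega> j W (Z j)" "compact K" "K \<subseteq> \<Omega>" "\<And>x. x \<notin> K \<Longrightarrow> W x = U x"
        "(\<integral>\<^sup>+x\<in>\<Omega>. ennreal (\<Sum>j\<in>UNIV. f j (Z j x)) \<partial>lborel) < \<infinity>" for W Z K
      by (rule local_minimizer_compare[OF op fcont assms(20) uU V that])
  qed (use op weak UM M fin in auto)
  interpret S: splitting_minimizer f "\<lambda>j. deriv (f j)" \<Omega> U V M "\<lambda>j. deriv (deriv (f j))" qp qm c C
    by (intro splitting_minimizer.intro bm splitting_minimizer_axioms.intro growth)
  have ex: "\<exists>\<sigma>>1. S.loc_int i \<sigma>" for i
  proof (induction i rule: measure_induct_rule[where f = "\<lambda>i. card {j. j < i}"])
    case (less i)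
    have "S.loc_int j 1" if "j < i" for j
    proof -
      have "{k. k < j} \<subset> {k. k < i}" using that by (auto intro: less_trans)
      then have "card {k. k < j} < card {k. k < i}" by (intro psubset_card_mono) auto
      from less[OF this] obtain \<sigma> where "\<sigma> > 1" "S.loc_int j \<sigma>" by blast
      then show ?thesis by (intro S.loc_int_mono[of j \<sigma> 1]) auto
    qed
    then show ?case
    \<comment> \<open>Smaller indices are already known to have order above 1 and contribute 1; for
      the larger ones only finite energy is available.\<close>
    proof (intro S.bootstrap[where \<tau> = "\<lambda>j. if j < i then 1 else 0"])
      fix j Q assume j: "j \<noteq> i" "Q \<in> {qp j, qm j}"
      have Q: "Q > 1" "Q \<le> max (qp j) (qm j)" using j assms(3,4) by auto
      have q: "min (qp i) (qm i) > 1" using assms(3,4) by simp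
      show "(1 - max 0 (Q - 2) / (Q + (if j < i then 1 else 0))) * (min (qp i) (qm i) + 1) > 1"
      proof (rule gap_condition[OF Q(1) q])
        show "Q < (2 + (if j < i then 1 else 0)) * min (qp i) (qm i) + 2"
        proof (cases "j < i")
          case True
          with le_less_trans[OF Q(2) assms(18)[OF True]] show ?thesis by simp
        next
          case False
          then have "i < j" using j(1) by simp
          from le_less_trans[OF Q(2) assms(17)[OF this]] False show ?thesis by simp
        qed
      qed auto
    qed (auto intro: S.loc_int_0)
  qed
  then obtain \<sigma> where \<sigma>: "\<And>i. \<sigma> i > 1" "\<And>i. S.loc_int i (\<sigma> i)" by metis
  \<comment> \<open>A single \<delta> has to serve all indices, so the smallest of the finitely many
    orders is taken.\<close>
  obtain m where m: "m > 1" "\<And>i. m \<le> \<sigma> i"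
  proof (rule that)
    have "Min (range \<sigma>) \<in> range \<sigma>" by (rule Min_in) auto
    then show "Min (range \<sigma>) > 1" using \<sigma>(1) by auto
    show "Min (range \<sigma>) \<le> \<sigma> i" for i by (rule Min_le) auto
  qed
  \<comment> \<open>Chosen so that 2 (1 + \<delta>) = m, since \<open>Gam\<close> is of quadratic
    growth; m > 1 then reads \<delta> > -1/2.\<close>
  define \<delta> where "\<delta> = (m - 2) / 2"
  have \<delta>: "\<delta> > -1/2" using m(1) by (simp add: \<delta>_def)
  have \<delta>le: "2 * (1 + \<delta>) \<le> \<sigma> i" for i using m(2)[of i] by (simp add: \<delta>_def field_simps)
  show ?thesis
  proof (rule exI[of _ \<delta>], rule conjI[OF \<delta>], intro allI impI)
    fix i x0 r \<eta> c0
    assume *: "r > 0 \<and> compactly_contained (ball x0 (2 * r)) \<Omega> \<and>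
      \<eta> \<in> test_functions (ball x0 (2 * r)) \<and> (\<forall>x. 0 \<le> \<eta> x \<and> \<eta> x \<le> 1) \<and>
      (\<forall>x\<in>ball x0 r. \<eta> x = 1) \<and> (\<forall>x. norm (gradient \<eta> x) \<le> c0 / r)"
    let ?B = "ball x0 (2 * r)"
    obtain A where A: "A > 0" "\<And>t. f i t \<le> A * (1 + \<bar>t\<bar>) powr side (qp i) (qm i) t"
      using two_sided_growth.growth_bounds[OF growth[of i]] by blast
    have K: "compact (closure ?B)" "closure ?B \<subseteq> \<Omega>" using * by (auto simp: compactly_contained_def)
    have bound: "f i v * Gam \<bar>v\<bar> powr (1 + \<delta>) * z \<le> A * (1 + \<bar>v\<bar>) powr (side (qp i) (qm i) v + \<sigma> i)"
      if "0 \<le> z" "z \<le> 1" for v z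
    proof -
      have "Gam \<bar>v\<bar> powr (1 + \<delta>) \<le> ((1 + \<bar>v\<bar>)\<^sup>2) powr (1 + \<delta>)"
        using \<delta> by (intro powr_mono2) (auto simp: Gam_def power2_eq_square algebra_simps)
      also have "\<dots> = (1 + \<bar>v\<bar>) powr (2 * (1 + \<delta>))"
      proof -
        have "(1 + \<bar>v\<bar>)\<^sup>2 = (1 + \<bar>v\<bar>) powr 2" by (simp add: powr_numeral)
        then show ?thesis by (simp only: powr_powr)
      qed
      also have "\<dots> \<le> (1 + \<bar>v\<bar>) powr \<sigma> i" using \<delta>le[of i] by (intro powr_mono) auto
      finally have "f i v * Gam \<bar>v\<bar> powr (1 + \<delta>) \<le> (A * (1 + \<bar>v\<bar>) powr side (qp i) (qm i) v) * (1 + \<bar>v\<bar>) powr \<sigma> i"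
        using A assms(13)[of i v] by (intro mult_mono) auto
      then have "f i v * Gam \<bar>v\<bar> powr (1 + \<delta>) \<le> A * (1 + \<bar>v\<bar>) powr (side (qp i) (qm i) v + \<sigma> i)"
        by (simp add: powr_add mult.assoc)
      moreover have "f i v * Gam \<bar>v\<bar> powr (1 + \<delta>) * z \<le> f i v * Gam \<bar>v\<bar> powr (1 + \<delta>)"
        using assms(13)[of i v] that by (intro mult_right_le_one_le) auto
      ultimately show ?thesis by linarith
    qed
    \<comment> \<open>Since 0 <= \<eta> <= 1, the powers of \<eta> are at most 1, and what remains
      is the mass of order \<open>\<sigma> i\<close> on the closed ball, a compact subset of
      \<Omega>. Thus \<open>k\<^sub>0 = 1\<close> will do.\<close>
    have "\<exists>c::real. (\<integral>\<^sup>+x. ennreal (f i (weak_partial \<Omega> i u x) * Gam \<bar>weak_partial \<Omega> i u x\<bar> powr (1 + \<delta>) *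
          \<eta> x powr (2 * k)) \<partial>lebesgue_on ?B) \<le> ennreal c" if k: "k \<ge> 1" for k
    proof -
      have ae: "AE x in lebesgue. x \<in> \<Omega> \<longrightarrow> weak_partial \<Omega> i u x = V i x"
        using V(2)[of i] op by (subst (asm) AE_restrict_space_iff) auto
      have "(\<integral>\<^sup>+x. ennreal (f i (weak_partial \<Omega> i u x) * Gam \<bar>weak_partial \<Omega> i u x\<bar> powr (1 + \<delta>) *
          \<eta> x powr (2 * k)) \<partial>lebesgue_on ?B) =
        (\<integral>\<^sup>+x\<in>?B. ennreal (f i (weak_partial \<Omega> i u x) * Gam \<bar>weak_partial \<Omega> i u x\<bar> powr (1 + \<delta>) *
          \<eta> x powr (2 * k)) \<partial>lebesgue)"
        by (rule nn_integral_restrict_space) auto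
      also have "\<dots> \<le> (\<integral>\<^sup>+x. ennreal A * (ennreal (S.mass i (\<sigma> i) x) * indicator (closure ?B) x) \<partial>lebesgue)"
      proof (rule nn_integral_mono_AE)
        from ae show "AE x in lebesgue. ennreal (f i (weak_partial \<Omega> i u x) * Gam \<bar>weak_partial \<Omega> i u x\<bar> powr (1 + \<delta>) *
            \<eta> x powr (2 * k)) * indicator ?B x \<le> ennreal A * (ennreal (S.mass i (\<sigma> i) x) * indicator (closure ?B) x)"
        proof eventually_elim
          case (elim x)
          show ?case
          proof (cases "x \<in> ?B")
            case True
            then have xc: "x \<in> closure ?B" by (rule closure_subset[THEN subsetD])
            with elim K(2) have v: "weak_partial \<Omega> i u x = V i x" by (meson subsetD)
            have "0 \<le> \<eta> x powr (2 * k)" "\<eta> x powr (2 * k) \<le> 1" using * k by (auto intro!: powr_le1)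
            from bound[OF this, of "V i x"] have "ennreal (f i (V i x) * Gam \<bar>V i x\<bar> powr (1 + \<delta>) * \<eta> x powr (2 * k)) \<le> ennreal (A * S.mass i (\<sigma> i) x)"
              by (intro ennreal_leI) (simp add: S.mass_def)
            also have "\<dots> = ennreal A * ennreal (S.mass i (\<sigma> i) x)" using A(1) by (intro ennreal_mult S.mass_nonneg) auto
            finally show ?thesis using True xc unfolding v by simp
          qed simp
        qed
      qed
      also have "\<dots> = (\<integral>\<^sup>+x. ennreal A * (ennreal (S.mass i (\<sigma> i) x) * indicator (closure ?B) x) \<partial>lborel)"
        by (rule nn_integral_completion)
      also have "\<dots> = ennreal A * (\<integral>\<^sup>+x\<in>closure ?B. ennreal (S.mass i (\<sigma> i) x) \<partial>lborel)"
        by (rule nn_integral_cmult) measurable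
      also have "\<dots> = ennreal A * ennreal (S.mass_on i (\<sigma> i) (closure ?B))"
        by (simp only: S.nn_integral_mass[OF \<sigma>(2) K])
      also have "\<dots> = ennreal (A * S.mass_on i (\<sigma> i) (closure ?B))"
        using A(1) by (intro ennreal_mult[symmetric] S.mass_on_nonneg) auto
      finally show ?thesis by blast
    qed
    then show "\<exists>k\<^sub>0>0. \<forall>k\<ge>k\<^sub>0. \<exists>c::real.
      (\<integral>\<^sup>+x. ennreal (f i (weak_partial \<Omega> i u x) * Gam \<bar>weak_partial \<Omega> i u x\<bar> powr (1 + \<delta>) *
          \<eta> x powr (2 * k)) \<partial>lebesgue_on ?B) \<le> ennreal c"
      by (intro exI[of _ 1]) auto
  qed
qed

end
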